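(* Let $m\in\mathbb Z^+$ and $\mathcal D_{2m}=\{(z,w)\in\mathbb C^2:|z|^2+|w|^{2m}<1\}$, and let $SK_{\mathcal D_{2m}}(z,w)=S_{\mathcal D_{2m}}(z,w)^3/K_{\mathcal D_{2m}}(z,w)^2$ for $(z,w)\in\mathcal D_{2m}$, where $S_{\mathcal D_{2m}}(z,w)$ and $K_{\mathcal D_{2m}}(z,w)$ are the diagonal values at $(z,w)$ of the Fefferman--Szegő kernel and of the Bergman kernel of $\mathcal D_{2m}$. Then $SK_{\mathcal D_{2m}}$ is uniformly bounded above and below on $\mathcal D_{2m}$, i.e. there are constants $0<c\le C<\infty$ such that $c\le SK_{\mathcal D_{2m}}(z,w)\le C$ for all $(z,w)\in\mathcal D_{2m}$.
   Context: Put $\rho(z,w)=|z|^2+|w|^{2m}-1$ and let $\sigma_{\mathrm E}$ be the Euclidean surface measure on $\partial\mathcal D_{2m}$. The Fefferman surface area measure is $d\sigma_{\mathrm F}=\varpi_{\mathrm F}\,d\sigma_{\mathrm E}$ with $$\varpi_{\mathrm F}=\frac1{|d\rho|}\left|\det\begin{pmatrix}\rho&\partial_{\bar j}\rho\\ \partial_i\rho&\partial_i\partial_{\bar j}\rho\end{pmatrix}_{1\le i,j\le 2}\right|^{\frac13},\qquad |d\rho|=\big(|\partial_z\rho|^2+|\partial_w\rho|^2\big)^{1/2},$$ i.e. $\varpi_{\mathrm F}(z,w)=\dfrac{(m^2|w|^{2m-2})^{1/3}}{\sqrt{|z|^2+m^2|w|^{4m-2}}}$ on $\partial\mathcal D_{2m}$.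 For $\xi\in\partial\mathcal D_{2m}$ let $\nu_\xi$ be the outward unit normal and let $\delta_\xi(z)$ be the minimum of the Euclidean distances from $z$ to $\partial\mathcal D_{2m}$ and to the tangent plane of $\partial\mathcal D_{2m}$ at $\xi$. For $\alpha>0$ let $\Gamma_\alpha(\xi)=\{z\in\mathcal D_{2m}:|(\xi-z)\cdot\overline{\nu_\xi}|<(1+\alpha)\delta_\xi(z),\ |\xi-z|^2<\alpha\delta_\xi(z)\}$, where $\cdot$ is the complex bilinear dot product, and let $\mathcal N(f)(\xi)=\sup_{z\in\Gamma_\alpha(\xi)}|f(z)|$. The Fefferman--Hardy space $\mathrm H^2_{\mathrm F}(\partial\mathcal D_{2m})$ is the set of holomorphic $f$ on $\mathcal D_{2m}$ with $\mathcal N(f)\in L^2(\partial\mathcal D_{2m},\sigma_{\mathrm F})$. Each such $f$ has a non-tangential boundary value $f^*$ $\sigma_{\mathrm F}$-a.e., and with the norm $\big(\int|f^*|^2d\sigma_{\mathrm F}\big)^{1/2}$ the space is a reproducing kernel Hilbert space. Its reproducing kernel $S_{\mathcal D_{2m}}(\zeta,\eta)$, satisfying $f(\zeta)=\int_{\partial\mathcal D_{2m}}S_{\mathcal D_{2m}}(\zeta,\xi)f^*(\xi)\,d\sigma_{\mathrm F}(\xi)$, is the Fefferman--Szegő kernel. The Bergman kernel is with respect to Lebesgue measure on $\mathbb C^2$; its diagonal values are $$K_{\mathcal D_{2m}}(z,w)=\frac{(m+1)(1-|z|^2)^{\frac1m}-(m-1)|w|^2}{m\pi^2\big((1-|z|^2)^{\frac1m}-|w|^2\big)^3(1-|z|^2)^{\frac{2m-1}m}}.$$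 *)

theory Defs
  imports "HOL-Analysis.Analysis"
begin

definition egg :: "nat \<Rightarrow> (complex \<times> complex) set" where
  "egg m = {(z, w). (cmod z)\<^sup>2 + (cmod w) ^ (2 * m) < 1}"

definition rho :: "nat \<Rightarrow> complex \<times> complex \<Rightarrow> real" where
  "rho m = (\<lambda>(z, w). (cmod z)\<^sup>2 + (cmod w) ^ (2 * m) - 1)"

text \<open>
  Wirtinger derivatives in the complex direction \<open>e\<close>, obtained from the real Frechet derivative;
  \<open>e = (1, 0)\<close> and \<open>e = (0, 1)\<close> give the derivatives in \<open>z\<close> and \<open>w\<close>.
\<close>

definition d_hol ::
  "complex \<times> complex \<Rightarrow> (complex \<times> complex \<Rightarrow> complex) \<Rightarrow> complex \<times> complex \<Rightarrow> complex" where
  "d_hol e f p = (frechet_derivative f (at p) e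
                  - \<i> * frechet_derivative f (at p) (\<i> * fst e, \<i> * snd e)) / 2"

definition d_bar ::
  "complex \<times> complex \<Rightarrow> (complex \<times> complex \<Rightarrow> complex) \<Rightarrow> complex \<times> complex \<Rightarrow> complex" where
  "d_bar e f p = (frechet_derivative f (at p) e
                  + \<i> * frechet_derivative f (at p) (\<i> * fst e, \<i> * snd e)) / 2"

abbreviation rhoC :: "nat \<Rightarrow> complex \<times> complex \<Rightarrow> complex" where
  "rhoC m \<equiv> (\<lambda>p. complex_of_real (rho m p))"

definition d_rho_norm :: "nat \<Rightarrow> complex \<times> complex \<Rightarrow> real" where
  "d_rho_norm m p =
     sqrt ((cmod (d_hol (1, 0) (rhoC m) p))\<^sup>2 + (cmod (d_hol (0, 1) (rhoC m) p))\<^sup>2)"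

text \<open>
  The Euclidean area element of a parametrization \<open>\<Phi>\<close> of a real hypersurface of complex
  2-space: the square root of the Gram determinant of its three tangent vectors. The inner product
  on \<^typ>\<open>complex \<times> complex\<close> is the real one of Euclidean 4-space.
\<close>

definition area_element ::
  "(real \<times> real \<times> real \<Rightarrow> complex \<times> complex) \<Rightarrow> real \<times> real \<times> real \<Rightarrow> real" where
  "area_element \<Phi> u =
     (let D = frechet_derivative \<Phi> (at u);
          t = (vector [D (1, 0, 0), D (0, 1, 0), D (0, 0, 1)] :: (complex \<times> complex) ^ 3)
      in sqrt (det ((\<chi> i j. (t $ i) \<bullet> (t $ j)) :: real ^ 3 ^ 3)))"

definition surface_measure ::
  "(complex \<times> complex) set \<Rightarrow> (real \<times> real \<times> real) set \<Rightarrow>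
   (real \<times> real \<times> real \<Rightarrow> complex \<times> complex) \<Rightarrow> (complex \<times> complex) measure" where
  "surface_measure M U \<Phi> =
     distr (density (restrict_space lborel U) (\<lambda>u. ennreal (area_element \<Phi> u)))
           (restrict_space borel M) \<Phi>"

text \<open>
  A parametrization of the boundary up to a null set: it is injective and smooth on the open set
  \<open>bd_params\<close>, and its image omits only the boundary points with \<open>z\<close> or \<open>w\<close> in the
  half-line of nonnegative reals; see \<open>bd_chart_inj\<close> and \<open>bd_chart_image\<close> below.
\<close>

definition bd_params :: "(real \<times> real \<times> real) set" where
  "bd_params = {0<..<1} \<times> {0<..<2 * pi} \<times> {0<..<2 * pi}"

definition bd_chart :: "nat \<Rightarrow> real \<times> real \<times> real \<Rightarrow> complex \<times> complex" where
  "bd_chart m = (\<lambda>(r, s, t). (complex_of_real (sqrt (1 - r ^ (2 * m))) * cis s,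
                              complex_of_real r * cis t))"

definition sigma_E :: "nat \<Rightarrow> (complex \<times> complex) measure" where
  "sigma_E m = surface_measure (frontier (egg m)) bd_params (bd_chart m)"

definition fefferman_matrix :: "nat \<Rightarrow> complex \<times> complex \<Rightarrow> complex ^ 3 ^ 3" where
  "fefferman_matrix m p =
     (let r = rhoC m; a = (1, 0); b = (0, 1) in
      vector [vector [r p,         d_bar a r p,             d_bar b r p],
              vector [d_hol a r p, d_hol a (d_bar a r) p,   d_hol a (d_bar b r) p],
              vector [d_hol b r p, d_hol b (d_bar a r) p,   d_hol b (d_bar b r) p]])"

definition fefferman_weight :: "nat \<Rightarrow> complex \<times> complex \<Rightarrow> real" where
  "fefferman_weight m p = root 3 (cmod (det (fefferman_matrix m p))) / d_rho_norm m p"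

definition sigma_F :: "nat \<Rightarrow> (complex \<times> complex) measure" where
  "sigma_F m = density (sigma_E m) (\<lambda>\<xi>. ennreal (fefferman_weight m \<xi>))"

text \<open>The real gradient of \<^term>\<open>rho m\<close> is twice the vector of its anti-holomorphic derivatives.\<close>

definition outer_normal :: "nat \<Rightarrow> complex \<times> complex \<Rightarrow> complex \<times> complex" where
  "outer_normal m \<xi> =
     (1 / d_rho_norm m \<xi>) *\<^sub>R (d_bar (1, 0) (rhoC m) \<xi>, d_bar (0, 1) (rhoC m) \<xi>)"

definition tangent_plane :: "nat \<Rightarrow> complex \<times> complex \<Rightarrow> (complex \<times> complex) set" where
  "tangent_plane m \<xi> = {p. (p - \<xi>) \<bullet> outer_normal m \<xi> = 0}"

definition cdot :: "complex \<times> complex \<Rightarrow> complex \<times> complex \<Rightarrow> complex" where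
  "cdot p q = fst p * fst q + snd p * snd q"

definition conj2 :: "complex \<times> complex \<Rightarrow> complex \<times> complex" where
  "conj2 p = (cnj (fst p), cnj (snd p))"

definition delta :: "nat \<Rightarrow> complex \<times> complex \<Rightarrow> complex \<times> complex \<Rightarrow> real" where
  "delta m \<xi> p = min (infdist p (frontier (egg m))) (infdist p (tangent_plane m \<xi>))"

definition approach_region :: "real \<Rightarrow> nat \<Rightarrow> complex \<times> complex \<Rightarrow> (complex \<times> complex) set" where
  "approach_region \<alpha> m \<xi> =
     {p \<in> egg m. cmod (cdot (\<xi> - p) (conj2 (outer_normal m \<xi>))) < (1 + \<alpha>) * delta m \<xi> p
                 \<and> (norm (\<xi> - p))\<^sup>2 < \<alpha> * delta m \<xi> p}"

definition nt_max :: "real \<Rightarrow> nat \<Rightarrow> (complex \<times> complex \<Rightarrow> complex) \<Rightarrow> complex \<times> complex \<Rightarrow> ennreal" where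
  "nt_max \<alpha> m f \<xi> = (SUP p\<in>approach_region \<alpha> m \<xi>. ennreal (cmod (f p)))"

text \<open>Boundary values are determined only up to null sets, whence a relation.\<close>

definition has_boundary_value ::
  "real \<Rightarrow> nat \<Rightarrow> (complex \<times> complex \<Rightarrow> complex) \<Rightarrow> (complex \<times> complex \<Rightarrow> complex) \<Rightarrow> bool" where
  "has_boundary_value \<alpha> m f g \<longleftrightarrow>
     g \<in> borel_measurable (sigma_F m) \<and>
     (AE \<xi> in sigma_F m. (f \<longlongrightarrow> g \<xi>) (at \<xi> within approach_region \<alpha> m \<xi>))"

definition holomorphic2_on :: "(complex \<times> complex \<Rightarrow> complex) \<Rightarrow> (complex \<times> complex) set \<Rightarrow> bool" where
  "holomorphic2_on f A \<longleftrightarrow>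
     (\<forall>p\<in>A. \<exists>a b. (f has_derivative (\<lambda>h. a * fst h + b * snd h)) (at p within A))"

definition fefferman_hardy :: "real \<Rightarrow> nat \<Rightarrow> (complex \<times> complex \<Rightarrow> complex) set" where
  "fefferman_hardy \<alpha> m =
     {f. holomorphic2_on f (egg m) \<and>
         nt_max \<alpha> m f \<in> borel_measurable (sigma_F m) \<and>
         (\<integral>\<^sup>+\<xi>. (nt_max \<alpha> m f \<xi>)\<^sup>2 \<partial>sigma_F m) < \<infinity>}"

text \<open>
  As for any reproducing kernel, \<open>S(\<zeta>, \<xi>)\<close> at a boundary point \<open>\<xi>\<close> is the conjugate of the boundary
  value of the space element \<open>S(\<cdot>, \<zeta>)\<close>, so that the integral is the inner product of the boundary
  values of \<open>f\<close> and \<open>S(\<cdot>, \<zeta>)\<close>.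
\<close>

definition is_fefferman_szego_kernel ::
  "real \<Rightarrow> nat \<Rightarrow> (complex \<times> complex \<Rightarrow> complex \<times> complex \<Rightarrow> complex) \<Rightarrow> bool" where
  "is_fefferman_szego_kernel \<alpha> m S \<longleftrightarrow>
     (\<forall>\<zeta>\<in>egg m. (\<lambda>\<eta>. S \<eta> \<zeta>) \<in> fefferman_hardy \<alpha> m) \<and>
     (\<forall>f\<in>fefferman_hardy \<alpha> m. \<forall>\<zeta>\<in>egg m. \<exists>f' s'.
        has_boundary_value \<alpha> m f f' \<and>
        has_boundary_value \<alpha> m (\<lambda>\<eta>. S \<eta> \<zeta>) s' \<and>
        f \<zeta> = (\<integral>\<xi>. cnj (s' \<xi>) * f' \<xi> \<partial>sigma_F m))"

definition bergman_space :: "(complex \<times> complex) set \<Rightarrow> (complex \<times> complex \<Rightarrow> complex) set" where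
  "bergman_space D =
     {f. holomorphic2_on f D \<and> (\<integral>\<^sup>+p\<in>D. ennreal ((cmod (f p))\<^sup>2) \<partial>lborel) < \<infinity>}"

definition is_bergman_kernel ::
  "(complex \<times> complex) set \<Rightarrow> (complex \<times> complex \<Rightarrow> complex \<times> complex \<Rightarrow> complex) \<Rightarrow> bool" where
  "is_bergman_kernel D K \<longleftrightarrow>
     (\<forall>\<zeta>\<in>D. (\<lambda>\<eta>. K \<eta> \<zeta>) \<in> bergman_space D) \<and>
     (\<forall>f\<in>bergman_space D. \<forall>\<zeta>\<in>D. f \<zeta> = (LINT \<xi>:D|lborel. cnj (K \<xi> \<zeta>) * f \<xi>))"

definition SK ::
  "(complex \<times> complex \<Rightarrow> complex \<times> complex \<Rightarrow> complex) \<Rightarrow>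
   (complex \<times> complex \<Rightarrow> complex \<times> complex \<Rightarrow> complex) \<Rightarrow> complex \<times> complex \<Rightarrow> complex" where
  "SK S K p = (S p p) ^ 3 / (K p p)\<^sup>2"

lemma d_hol_eq:
  assumes "(f has_derivative f') (at p)"
  shows "d_hol e f p = (f' e - \<i> * f' (\<i> * fst e, \<i> * snd e)) / 2"
  using frechet_derivative_at[OF assms] by (simp add: d_hol_def)

lemma d_bar_eq:
  assumes "(f has_derivative f') (at p)"
  shows "d_bar e f p = (f' e + \<i> * f' (\<i> * fst e, \<i> * snd e)) / 2"
  using frechet_derivative_at[OF assms] by (simp add: d_bar_def)

lemma rhoC_eq: "rhoC m = (\<lambda>p. fst p * cnj (fst p) + (snd p * cnj (snd p)) ^ m - 1)"
  by (auto simp: rho_def fun_eq_iff complex_norm_square[symmetric] power_mult)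

lemma power_has_derivative:
  "((\<lambda>p :: complex \<times> complex. (snd p * cnj (snd p)) ^ k) has_derivative
      (\<lambda>h. of_nat k * (snd p * cnj (snd p)) ^ (k - 1)
           * (snd h * cnj (snd p) + snd p * cnj (snd h)))) (at p)"
proof -
  have "((\<lambda>p. snd p * cnj (snd p)) has_derivative
      (\<lambda>h. snd h * cnj (snd p) + snd p * cnj (snd h))) (at p)"
    by (auto intro!: derivative_eq_intros)
  from has_derivative_power[OF this, of k] show ?thesis
    by (rule has_derivative_eq_rhs) (simp only: fun_eq_iff mult_ac, simp)
qed

lemma rhoC_has_derivative:
  "(rhoC m has_derivative (\<lambda>h. fst h * cnj (fst p) + fst p * cnj (fst h)
      + of_nat m * (snd p * cnj (snd p)) ^ (m - 1)
        * (snd h * cnj (snd p) + snd p * cnj (snd h)))) (at p)"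
  unfolding rhoC_eq
  by (rule derivative_eq_intros power_has_derivative refl)+
     (simp only: fun_eq_iff algebra_simps, simp)

lemma d_rho:
  "d_hol (1, 0) (rhoC m) p = cnj (fst p)"
  "d_hol (0, 1) (rhoC m) p = of_nat m * (snd p * cnj (snd p)) ^ (m - 1) * cnj (snd p)"
  "d_bar (1, 0) (rhoC m) p = fst p"
  "d_bar (0, 1) (rhoC m) p = of_nat m * (snd p * cnj (snd p)) ^ (m - 1) * snd p"
  by (simp_all add: d_hol_eq[OF rhoC_has_derivative] d_bar_eq[OF rhoC_has_derivative] algebra_simps)

lemma d_hol_d_bar_rho:
  assumes "m \<ge> 1"
  shows "d_hol (1, 0) (d_bar (1, 0) (rhoC m)) p = 1"
    "d_hol (0, 1) (d_bar (1, 0) (rhoC m)) p = 0"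
    "d_hol (1, 0) (d_bar (0, 1) (rhoC m)) p = 0"
    "d_hol (0, 1) (d_bar (0, 1) (rhoC m)) p = (of_nat m)\<^sup>2 * (snd p * cnj (snd p)) ^ (m - 1)"
proof -
  have 1: "d_bar (1, 0) (rhoC m) = fst" by (simp add: fun_eq_iff d_rho)
  have D1: "(fst has_derivative fst) (at p)" by (rule derivative_eq_intros refl)+
  show "d_hol (1, 0) (d_bar (1, 0) (rhoC m)) p = 1" "d_hol (0, 1) (d_bar (1, 0) (rhoC m)) p = 0"
    unfolding 1 by (simp_all add: d_hol_eq[OF D1])
  have 2: "d_bar (0, 1) (rhoC m) = (\<lambda>p. of_nat m * (snd p * cnj (snd p)) ^ (m - 1) * snd p)"
    by (simp add: fun_eq_iff d_rho)
  have D2: "((\<lambda>p. of_nat m * (snd p * cnj (snd p)) ^ (m - 1) * snd p) has_derivative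
      (\<lambda>h. of_nat m * (of_nat (m - 1) * (snd p * cnj (snd p)) ^ (m - 1 - 1)
             * (snd h * cnj (snd p) + snd p * cnj (snd h))) * snd p
           + of_nat m * (snd p * cnj (snd p)) ^ (m - 1) * snd h)) (at p)"
    by (rule derivative_eq_intros power_has_derivative refl)+
       (simp only: fun_eq_iff algebra_simps, simp)
  show "d_hol (1, 0) (d_bar (0, 1) (rhoC m)) p = 0"
    unfolding 2 d_hol_eq[OF D2] by simp
  show "d_hol (0, 1) (d_bar (0, 1) (rhoC m)) p = (of_nat m)\<^sup>2 * (snd p * cnj (snd p)) ^ (m - 1)"
  proof (cases "m = 1")
    case True
    then show ?thesis unfolding 2 d_hol_eq[OF D2] by simp
  next
    case False
    with assms obtain k where m: "m = Suc (Suc k)"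
      by (metis One_nat_def Suc_le_D old.nat.exhaust)
    show ?thesis unfolding 2 d_hol_eq[OF D2]
      by (simp add: m algebra_simps power2_eq_square)
  qed
qed

lemma d_rho_norm_eq:
  assumes "m \<ge> 1"
  shows "d_rho_norm m (z, w) = sqrt ((cmod z)\<^sup>2 + (real m)\<^sup>2 * cmod w ^ (4 * m - 2))"
proof -
  have m: "4 * m - 2 = 2 * (2 * (m - 1) + 1)" using assms by auto
  have "cmod (of_nat m * (w * cnj w) ^ (m - 1) * v) = real m * cmod w ^ (2 * (m - 1) + 1)"
    if "cmod v = cmod w" for v
    using that by (simp add: norm_mult norm_power power_mult power2_eq_square)
  from this[of w] this[of "cnj w"] show ?thesis
    unfolding d_rho_norm_def d_rho m fst_conv snd_conv
    by (simp only: complex_mod_cnj power_mult_distrib power_mult[symmetric] mult.commute refl)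
qed

lemma fefferman_weight_eq:
  assumes "m \<ge> 1" "rho m (z, w) = 0"
  shows "fefferman_weight m (z, w) =
    root 3 ((real m)\<^sup>2 * cmod w ^ (2 * m - 2)) / sqrt ((cmod z)\<^sup>2 + (real m)\<^sup>2 * cmod w ^ (4 * m - 2))"
proof -
  define q where "q = (w * cnj w) ^ (m - 1)"
  have q: "w * cnj w * q = (w * cnj w) ^ m"
    using assms(1) by (simp add: q_def power_eq_if)
  have s: "z * cnj z + (w * cnj w) ^ m = 1"
    using assms(2) fun_cong[OF rhoC_eq, of m "(z, w)"] by simp
  have "det (fefferman_matrix m (z, w)) = - (of_nat m)\<^sup>2 * q * (z * cnj z + w * cnj w * q)"
    using assms(2)
    by (simp add: fefferman_matrix_def Let_def det_3 d_rho d_hol_d_bar_rho[OF assms(1)] q_def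
        algebra_simps power2_eq_square)
  then have "det (fefferman_matrix m (z, w)) = - (of_nat m)\<^sup>2 * q"
    unfolding q s by simp
  moreover have "cmod q = cmod w ^ (2 * m - 2)"
  proof -
    have "2 * m - 2 = 2 * (m - 1)" by simp
    then show ?thesis
      unfolding q_def norm_power norm_mult complex_mod_cnj
      by (simp only: power_mult power2_eq_square)
  qed
  ultimately have "cmod (det (fefferman_matrix m (z, w))) = (real m)\<^sup>2 * cmod w ^ (2 * m - 2)"
    by (simp add: norm_mult norm_power)
  then show ?thesis
    by (simp add: fefferman_weight_def d_rho_norm_eq[OF assms(1)])
qed

lemma frontier_egg:
  assumes "m \<ge> 1"
  shows "frontier (egg m) = {p. rho m p = 0}"
proof -
  have cont: "continuous_on UNIV (rho m)"
    unfolding rho_def case_prod_unfold by (intro continuous_intros)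
  have egg: "egg m = {p. rho m p < 0}"
    by (auto simp: egg_def rho_def)
  have op: "open (egg m)"
    unfolding egg using open_Collect_less[OF cont continuous_on_const] .
  have "closed {p. rho m p \<le> 0}"
    using closed_Collect_le[OF cont continuous_on_const] .
  then have le: "closure (egg m) \<subseteq> {p. rho m p \<le> 0}"
    by (rule closure_minimal[rotated]) (auto simp: egg)
  have "p \<in> closure (egg m)" if p: "rho m p = 0" for p
  proof -
    obtain z w where zw: "p = (z, w)" by force
    define x where "x n = (1 - inverse (real (Suc n))) *\<^sub>R p" for n :: nat
    have "x n \<in> egg m" for n
    proof -
      define r where "r = 1 - inverse (real (Suc n))"
      have r: "0 \<le> r" "r < 1" by (auto simp: r_def inverse_le_1_iff)
      have a: "r ^ (2 * m) * cmod w ^ (2 * m) \<le> r\<^sup>2 * cmod w ^ (2 * m)"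
        using r assms by (intro mult_right_mono power_decreasing) auto
      have b: "(cmod z)\<^sup>2 + cmod w ^ (2 * m) = 1"
        using p by (simp add: rho_def zw)
      have "r\<^sup>2 < 1" using r by (simp add: power_less_one_iff abs_square_less_1)
      moreover have "r\<^sup>2 * (cmod z)\<^sup>2 + r\<^sup>2 * cmod w ^ (2 * m) = r\<^sup>2"
        using b by (metis distrib_left mult.right_neutral)
      ultimately show ?thesis
        using a r by (simp add: x_def zw egg_def power_mult_distrib flip: r_def del: of_nat_Suc)
    qed
    moreover have "x \<longlonglongrightarrow> (1 - 0) *\<^sub>R p"
      unfolding x_def
      by (intro tendsto_intros LIMSEQ_inverse_real_of_nat)
    ultimately show ?thesis
      unfolding closure_sequential by auto
  qed
  with le show ?thesis
    using closure_subset[of "egg m"] unfolding frontier_def interior_open[OF op] by (fastforce simp: egg)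
qed

lemma cis_eq_imp_eq:
  assumes "cis s = cis t" "s \<in> {0<..<2 * pi}" "t \<in> {0<..<2 * pi}"
  shows "s = t"
proof -
  have "Arg2pi (cis s) = s" "Arg2pi (cis t) = t"
    using assms by (auto intro!: Arg2pi_unique[of 1] simp: cis_conv_exp)
  with assms(1) show ?thesis by metis
qed

lemma cis_notin_nonneg:
  assumes "t \<in> {0<..<2 * pi}" "r > 0"
  shows "complex_of_real r * cis t \<notin> \<real>\<^sub>\<ge>\<^sub>0"
proof
  assume "complex_of_real r * cis t \<in> \<real>\<^sub>\<ge>\<^sub>0"
  then have "Arg2pi (complex_of_real r * cis t) = 0"
    by (auto simp: Arg2pi_eq_0 complex_nonneg_Reals_iff complex_is_Real_iff)
  moreover have "Arg2pi (complex_of_real r * cis t) = t"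
    using assms by (intro Arg2pi_unique[of r]) (auto simp: cis_conv_exp)
  ultimately show False using assms by simp
qed

lemma polar_ex:
  assumes "z \<notin> \<real>\<^sub>\<ge>\<^sub>0"
  obtains t where "t \<in> {0<..<2 * pi}" "z = complex_of_real (cmod z) * cis t"
proof
  show "z = complex_of_real (cmod z) * cis (Arg2pi z)"
    using Arg2pi_eq[of z] by (simp add: cis_conv_exp)
  show "Arg2pi z \<in> {0<..<2 * pi}"
    using Arg2pi_ge_0[of z] Arg2pi_lt_2pi[of z] Arg2pi_eq_0[of z] assms
    by (auto simp: less_le complex_nonneg_Reals_iff complex_is_Real_iff)
qed

lemma bd_chart_inj:
  assumes "m \<ge> 1"
  shows "inj_on (bd_chart m) bd_params"
proof (rule inj_onI)
  fix x y
  assume xy: "x \<in> bd_params" "y \<in> bd_params" and eq: "bd_chart m x = bd_chart m y"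
  obtain r s t where x: "x = (r, s, t)" by (metis prod.exhaust)
  obtain r' s' t' where y: "y = (r', s', t')" by (metis prod.exhaust)
  have r: "0 < r" "r < 1" "0 < r'" using xy by (auto simp: x y bd_params_def)
  have e: "complex_of_real r * cis t = complex_of_real r' * cis t'"
      "complex_of_real (sqrt (1 - r ^ (2 * m))) * cis s
        = complex_of_real (sqrt (1 - r' ^ (2 * m))) * cis s'"
    using eq by (auto simp: x y bd_chart_def)
  from arg_cong[OF e(1), of cmod] r have rr: "r = r'" by (simp add: norm_mult)
  have "r ^ (2 * m) < 1" using r assms by (simp add: power_less_one_iff)
  with e r have "cis t = cis t'" "cis s = cis s'" by (auto simp: rr)
  then show "x = y"
    using xy rr cis_eq_imp_eq by (auto simp: x y bd_params_def)
qed

lemma bd_chart_image: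
  assumes "m \<ge> 1"
  shows "bd_chart m ` bd_params =
    {p \<in> frontier (egg m). fst p \<notin> \<real>\<^sub>\<ge>\<^sub>0 \<and> snd p \<notin> \<real>\<^sub>\<ge>\<^sub>0}"
proof (intro equalityI subsetI)
  fix p assume "p \<in> bd_chart m ` bd_params"
  then obtain r s t where p: "p = bd_chart m (r, s, t)" and
    rst: "0 < r" "r < 1" "s \<in> {0<..<2 * pi}" "t \<in> {0<..<2 * pi}"
    by (auto simp: bd_params_def)
  have "r ^ (2 * m) < 1" using rst assms by (simp add: power_less_one_iff)
  with rst show "p \<in> {p \<in> frontier (egg m). fst p \<notin> \<real>\<^sub>\<ge>\<^sub>0 \<and> snd p \<notin> \<real>\<^sub>\<ge>\<^sub>0}"
    using cis_notin_nonneg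
    by (auto simp: frontier_egg[OF assms] p bd_chart_def rho_def norm_mult)
next
  fix p assume p: "p \<in> {p \<in> frontier (egg m). fst p \<notin> \<real>\<^sub>\<ge>\<^sub>0 \<and> snd p \<notin> \<real>\<^sub>\<ge>\<^sub>0}"
  obtain z w where zw: "p = (z, w)" by force
  have eq: "(cmod z)\<^sup>2 + cmod w ^ (2 * m) = 1"
    using p by (simp add: frontier_egg[OF assms] rho_def zw)
  obtain s where s: "s \<in> {0<..<2 * pi}" "z = complex_of_real (cmod z) * cis s"
    using polar_ex p zw by auto
  obtain t where t: "t \<in> {0<..<2 * pi}" "w = complex_of_real (cmod w) * cis t"
    using polar_ex p zw by auto
  have nz: "z \<noteq> 0" "w \<noteq> 0" using p zw by auto
  then have "cmod w ^ (2 * m) < 1" using eq by (smt (verit) zero_less_norm_iff zero_less_power)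
  then have "cmod w < 1" by (meson norm_ge_zero not_less one_le_power)
  moreover have "sqrt (1 - cmod w ^ (2 * m)) = cmod z"
    by (metis add_diff_cancel_right' eq norm_ge_zero real_sqrt_unique)
  ultimately have "p = bd_chart m (cmod w, s, t)" "(cmod w, s, t) \<in> bd_params"
    using s t nz by (auto simp: bd_chart_def bd_params_def zw)
  then show "p \<in> bd_chart m ` bd_params" by blast
qed

end

(*
The boundary measure and Lebesgue measure are invariant under rotations of z and of w, so the
monomials z^a w^b are orthogonal for both inner products, and every holomorphic function on the egg
is the sum of its monomial expansion. In polar coordinates the density of sigma_F collapses to
m^(2/3) r^((2m+1)/3) dr ds dt, so in both cases the squared norms of the monomials are Beta integrals.
With X = 1 - |z|^2 and t = |w|^2 X^(-1/m), summing |z^a w^b|^2 / ||z^a w^b||^2 first over a (binomial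
series) and then over b shows that on the diagonal S is comparable to X^(-4/3-2/(3m)) (1-t)^(-2) and
K to X^(-2-1/m) (1-t)^(-3). The powers cancel in S^3 / K^2.

That the series really is the value S(p,p) of a kernel given only by its reproducing property needs
a single test function, the series itself: it is bounded and holomorphic, and pairing it with S(.,p)
in the two possible roles gives S(p,p). The boundary values of an arbitrary element are reached along
radii, which stay in the approach regions uniformly near the boundary, so that dominated convergence
with the maximal function carries the coefficients of the expansion to the boundary.
*)
theory Submission
  imports Defs "HOL-Complex_Analysis.Complex_Analysis"
begin

section \<open>Power series in two variables\<close>


text \<open>The two diagonal series are compared, not evaluated. After the exact summation over
  \<open>a\<close> there remains a series in \<open>b\<close> with polynomial coefficients: of
  degree 1 for S, where one factor is split off a Pochhammer symbol of length \<open>a + 1\<close>,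
  and of degree 2 for K, where two factors are split off a symbol of length \<open>a + 2\<close>,
  because integrating over the solid egg raises the power in the Beta integral by one. Comparison
  with the coefficients of \<open>(1 - t)^(-2)\<close> and \<open>(1 - t)^(-3)\<close> costs only
  constants. The powers of X are exact and cancel because 3 (4/3 + 2/(3m)) = 2 (2 + 1/m). The
  obstacle is that the expansion of a general element of either space may have no summable majorant
  on the whole space of integration, so it cannot be integrated term by term there. A dilation
  restores the majorant. For \<open>sigma_F\<close> the function is dilated and the maximal function
  dominates; for Lebesgue measure the domain is shrunk and the function dominates itself. The kernel
  series at an interior point, in contrast, converges uniformly up to the boundary.\<close>

definition mon :: "nat \<times> nat \<Rightarrow> complex \<times> complex \<Rightarrow> complex" where
  "mon i p = fst p ^ fst i * snd p ^ snd i"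

lemma norm_mon: "cmod (mon i p) = cmod (fst p) ^ fst i * cmod (snd p) ^ snd i"
  by (simp add: mon_def norm_mult norm_power)

lemma mon_scaleR: "mon i (t *\<^sub>R p) = of_real (t ^ (fst i + snd i)) * mon i p"
  by (simp add: mon_def scaleR_conv_of_real power_mult_distrib power_add mult_ac)

lemma continuous_on_mon [continuous_intros]: "continuous_on A (mon i)"
  unfolding mon_def by (intro continuous_intros)

text \<open>The majorant to which the Taylor expansions and the kernel series are reduced.\<close>

lemma geometric_pair_summable:
  assumes "0 \<le> x" "x < 1" "0 \<le> y" "y < (1::real)"
  shows "(\<lambda>i. x ^ fst i * y ^ snd i) summable_on (UNIV :: (nat \<times> nat) set)"
proof -
  have s: "((\<lambda>n. t ^ n) has_sum (1 / (1 - t))) UNIV" if "0 \<le> t" "t < 1" for t :: real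
    using that by (intro norm_summable_imp_has_sum) (auto simp: geometric_sums)
  have "(\<lambda>i. x ^ fst i * y ^ snd i) summable_on (UNIV \<times> UNIV :: (nat \<times> nat) set)"
  proof (rule summable_on_SigmaI)
    show "((\<lambda>b. x ^ fst (a, b) * y ^ snd (a, b)) has_sum (x ^ a * (1 / (1 - y)))) UNIV" for a
      using has_sum_cmult_right[OF s[OF assms(3,4)], of "x ^ a"] by simp
    show "(\<lambda>a. x ^ a * (1 / (1 - y))) summable_on UNIV"
      using s[OF assms(1,2)] by (intro summable_on_cmult_left) (auto simp: summable_on_def)
  qed (use assms in auto)
  then show ?thesis by simp
qed

lemma summable_on_dominated:
  fixes f :: "'a \<Rightarrow> 'b :: banach"
  assumes "g summable_on A" "\<And>x. x \<in> A \<Longrightarrow> norm (f x) \<le> g x"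
  shows "(\<lambda>x. norm (f x)) summable_on A" "f summable_on A"
proof -
  show "(\<lambda>x. norm (f x)) summable_on A"
    by (rule Infinite_Sum.abs_summable_on_comparison_test'[OF assms])
  then show "f summable_on A" by (rule abs_summable_summable)
qed

text \<open>Continuity up to the edge of the disc is not given, so Cauchy's inequality is used on
  radii s < r, and s tends to r.\<close>

lemma taylor_coeff_bound:
  assumes f: "f holomorphic_on ball 0 r" and "r > 0" and M: "\<And>w. w \<in> ball 0 r \<Longrightarrow> cmod (f w) \<le> M"
  shows "cmod ((deriv ^^ n) f 0 / fact n) * r ^ n \<le> M"
proof (rule tendsto_upperbound)
  let ?c = "cmod ((deriv ^^ n) f 0 / fact n)"
  show "((\<lambda>s. ?c * s ^ n) \<longlongrightarrow> ?c * r ^ n) (at_left r)"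
    by (intro tendsto_intros)
  show "\<forall>\<^sub>F s in at_left r. ?c * s ^ n \<le> M"
    unfolding eventually_at_left_field
  proof (intro exI[of _ 0] conjI allI impI)
    fix s assume s: "0 < s" "s < r"
    have "cmod ((deriv ^^ n) f 0) \<le> fact n * M / s ^ n"
    proof (rule Cauchy_inequality)
      show "f holomorphic_on ball 0 s" by (rule holomorphic_on_subset[OF f]) (use s in auto)
      show "continuous_on (cball 0 s) f"
        by (rule continuous_on_subset[OF holomorphic_on_imp_continuous_on[OF f]]) (use s in auto)
      show "cmod (f x) \<le> M" if "cmod (0 - x) = s" for x
        using that s by (intro M) auto
    qed (use s in auto)
    then show "?c * s ^ n \<le> M" using s by (simp add: norm_divide field_simps)
  qed (use assms in auto)
qed auto

lemma holomorphic2_onD: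
  assumes "holomorphic2_on f A" "open A" "p \<in> A"
  obtains a b where "(f has_derivative (\<lambda>h. a * fst h + b * snd h)) (at p)"
  using assms at_within_open[OF assms(3,2)] unfolding holomorphic2_on_def by metis

lemma holomorphic2_on_subset:
  assumes "holomorphic2_on f A" "B \<subseteq> A"
  shows "holomorphic2_on f B"
  unfolding holomorphic2_on_def
proof
  fix p assume "p \<in> B"
  with assms obtain a b where "(f has_derivative (\<lambda>h. a * fst h + b * snd h)) (at p within A)"
    unfolding holomorphic2_on_def by blast
  from has_derivative_subset[OF this assms(2)]
  show "\<exists>a b. (f has_derivative (\<lambda>h. a * fst h + b * snd h)) (at p within B)"
    by (intro exI)
qed

lemma holomorphic2_on_imp_continuous_on:
  assumes "holomorphic2_on f A"
  shows "continuous_on A f"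
  unfolding continuous_on_eq_continuous_within
proof
  fix p assume "p \<in> A"
  with assms obtain a b where "(f has_derivative (\<lambda>h. a * fst h + b * snd h)) (at p within A)"
    unfolding holomorphic2_on_def by blast
  from has_derivative_continuous[OF this] show "continuous (at p within A) f" .
qed

lemma holomorphic2_on_slices:
  assumes f: "holomorphic2_on f (A \<times> B)" and op: "open A" "open B"
  shows "w \<in> B \<Longrightarrow> (\<lambda>z. f (z, w)) holomorphic_on A"
    and "z \<in> A \<Longrightarrow> (\<lambda>w. f (z, w)) holomorphic_on B"
proof -
  \<comment> \<open>Both slices are compositions with an embedding of one complex variable whose
    derivative is the constant direction (c, d).\<close>
  have slice: "(\<lambda>x. f (\<phi> x)) holomorphic_on C"
    if C: "\<And>x. x \<in> C \<Longrightarrow> \<phi> x \<in> A \<times> B"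
      and \<phi>: "\<And>x. (\<phi> has_derivative (\<lambda>h. (h * c, h * d))) (at x)" for \<phi> C c d
  proof (rule holomorphic_onI)
    fix x assume "x \<in> C"
    then obtain a b where D: "(f has_derivative (\<lambda>h. a * fst h + b * snd h)) (at (\<phi> x))"
      by (rule holomorphic2_onD[OF f open_Times[OF op] C])
    have "((\<lambda>x. f (\<phi> x)) has_field_derivative (a * c + b * d)) (at x)"
      unfolding has_field_derivative_def
      by (rule has_derivative_eq_rhs[OF has_derivative_compose[OF \<phi> D]]) (simp add: fun_eq_iff algebra_simps)
    then show "(\<lambda>x. f (\<phi> x)) field_differentiable at x within C"
      by (metis field_differentiable_def field_differentiable_at_within)
  qed
  show "(\<lambda>z. f (z, w)) holomorphic_on A" if "w \<in> B"
    by (rule slice[where c = 1 and d = 0]) (use that in \<open>auto intro!: derivative_eq_intros\<close>)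
  show "(\<lambda>w. f (z, w)) holomorphic_on B" if "z \<in> A"
    by (rule slice[where c = 0 and d = 1]) (use that in \<open>auto intro!: derivative_eq_intros\<close>)
qed

section \<open>Taylor expansion on a bidisc\<close>

definition zcoeff :: "(complex \<times> complex \<Rightarrow> complex) \<Rightarrow> nat \<Rightarrow> complex \<Rightarrow> complex" where
  "zcoeff f a w = (deriv ^^ a) (\<lambda>z. f (z, w)) 0 / fact a"

text \<open>The expansion is iterated: in z with w as a parameter, and then in w. Being derivatives
  at the origin, the coefficients do not depend on the bidisc on which the expansion is carried
  out.\<close>

definition taylor2 :: "(complex \<times> complex \<Rightarrow> complex) \<Rightarrow> nat \<times> nat \<Rightarrow> complex" where
  "taylor2 f i = (deriv ^^ snd i) (zcoeff f (fst i)) 0 / fact (snd i)"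

locale polydisc_fun =
  fixes f :: "complex \<times> complex \<Rightarrow> complex" and R r M :: real
  assumes hol: "holomorphic2_on f (ball 0 R \<times> ball 0 r)"
    and pos: "R > 0" "r > 0"
    and bdd: "\<And>p. p \<in> ball 0 R \<times> ball 0 r \<Longrightarrow> cmod (f p) \<le> M"
begin

lemma M_nonneg: "M \<ge> 0"
proof -
  have "cmod (f (0, 0)) \<le> M" by (rule bdd) (use pos in simp)
  then show ?thesis using norm_ge_zero[of "f (0, 0)"] by linarith
qed

lemma slice_z: "w \<in> ball 0 r \<Longrightarrow> (\<lambda>z. f (z, w)) holomorphic_on ball 0 R"
  by (rule holomorphic2_on_slices(1)[OF hol open_ball open_ball])

lemma slice_w: "z \<in> ball 0 R \<Longrightarrow> (\<lambda>w. f (z, w)) holomorphic_on ball 0 r"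
  by (rule holomorphic2_on_slices(2)[OF hol open_ball open_ball])

lemma zcoeff_bound:
  assumes "w \<in> ball 0 r"
  shows "cmod (zcoeff f a w) * R ^ a \<le> M"
  unfolding zcoeff_def
proof (rule taylor_coeff_bound[OF slice_z[OF assms] pos(1)])
  show "cmod (f (z, w)) \<le> M" if "z \<in> ball 0 R" for z
    by (rule bdd) (use that assms in simp)
qed

lemma zcoeff_sums:
  assumes "z \<in> ball 0 R" "w \<in> ball 0 r"
  shows "(\<lambda>a. zcoeff f a w * z ^ a) sums f (z, w)"
  using holomorphic_power_series[OF slice_z[OF assms(2)] assms(1)]
  by (simp add: zcoeff_def)

text \<open>Induction on \<open>a\<close>, by a limit of difference quotients: for a fixed z the
  remainder of order \<open>a\<close>, divided by \<open>z ^ a\<close>, is holomorphic in w once the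
  lower coefficients are, and as z tends to 0 it converges to \<open>zcoeff f a\<close> uniformly in
  w.\<close>

lemma zcoeff_holomorphic: "zcoeff f a holomorphic_on ball 0 r"
proof (induction a rule: less_induct)
  case (less a)
  have "zcoeff f a holomorphic_on ball 0 s" if s: "s \<in> {0<..<r}" for s
  proof -
    \<comment> \<open>Any null sequence would do; \<open>x n \<le> 1 / 2\<close> keeps the factor
      \<open>1 / (1 - x n)\<close> of the geometric tail at most 2.\<close>
    define x :: "nat \<Rightarrow> real" where "x n = (1 / 2) ^ Suc n" for n
    have x: "0 < x n" "x n \<le> 1 / 2" for n
      by (auto simp: x_def power_le_one)
    define z where "z n = complex_of_real (R * x n)" for n
    have nz: "cmod (z n) = R * x n" for n
      using x[of n] pos by (simp add: z_def norm_mult)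
    have zR: "z n \<in> ball 0 R" for n
      using x(2)[of n] pos by (simp add: nz)
    define g where "g n w = (f (z n, w) - (\<Sum>k<a. zcoeff f k w * z n ^ k)) / z n ^ a" for n w
    have hg: "g n holomorphic_on ball 0 r" for n
      unfolding g_def
      by (intro holomorphic_intros slice_w zR less) (use x(1)[of n] pos in \<open>auto simp: z_def\<close>)
    have err: "cmod (g n w - zcoeff f a w) \<le> 2 * M / R ^ a * x n" if w: "w \<in> ball 0 r" for n w
    proof -
      let ?e = "f (z n, w) - (\<Sum>k<Suc a. zcoeff f k w * z n ^ k)"
      let ?t = "\<lambda>j. zcoeff f (j + Suc a) w * z n ^ (j + Suc a)"
      have tb: "cmod (?t j) \<le> M * x n ^ Suc a * x n ^ j" for j
      proof -
        have "cmod (?t j) = (cmod (zcoeff f (j + Suc a) w) * R ^ (j + Suc a)) * x n ^ (j + Suc a)"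
          by (simp add: norm_mult norm_power nz power_mult_distrib)
        also have "\<dots> \<le> M * x n ^ (j + Suc a)"
          using x(1)[of n] by (intro mult_right_mono zcoeff_bound w) auto
        finally show ?thesis by (simp add: power_add mult_ac)
      qed
      \<comment> \<open>The terms up to order \<open>a\<close> are split off. The tail has size
        \<open>x n ^ Suc a\<close>, so that division by \<open>z n ^ a\<close> leaves one factor
        \<open>x n\<close>.\<close>
      have "?t sums (?e)"
        by (rule sums_split_initial_segment[OF zcoeff_sums[OF zR w]])
      moreover have s2: "(\<lambda>j. M * x n ^ Suc a * x n ^ j) sums (M * x n ^ Suc a * (1 / (1 - x n)))"
        using x[of n] by (intro sums_mult geometric_sums) auto
      moreover have "cmod (suminf ?t) \<le> (\<Sum>j. M * x n ^ Suc a * x n ^ j)"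
        by (rule norm_suminf_le[OF tb sums_summable[OF s2]])
      ultimately have "cmod (?e)
          \<le> M * x n ^ Suc a * (1 / (1 - x n))"
        by (simp add: sums_iff)
      also have "\<dots> \<le> M * x n ^ Suc a * 2"
        using x[of n] M_nonneg by (intro mult_left_mono) (auto simp: field_simps)
      finally have *: "cmod (?e) \<le> M * x n ^ Suc a * 2" .
      have "z n \<noteq> 0" using x(1)[of n] pos by (simp add: z_def)
      then have "g n w - zcoeff f a w = (?e) / z n ^ a"
        by (simp add: g_def field_simps)
      then have "cmod (g n w - zcoeff f a w)
          = cmod (?e) / (R * x n) ^ a"
        by (simp add: norm_divide norm_power nz)
      also have "\<dots> \<le> (M * x n ^ Suc a * 2) / (R * x n) ^ a"
        using x[of n] pos by (intro divide_right_mono *) auto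
      also have "\<dots> = 2 * M / R ^ a * x n"
        using x(1)[of n] pos by (simp add: field_simps)
      finally show ?thesis .
    qed
    have "(\<lambda>n. 2 * M / R ^ a * (1 / 2 * (1 / 2) ^ n)) \<longlonglongrightarrow> 2 * M / R ^ a * (1 / 2 * 0)"
      by (intro tendsto_mult tendsto_const LIMSEQ_realpow_zero) auto
    then have lim: "(\<lambda>n. 2 * M / R ^ a * x n) \<longlonglongrightarrow> 0"
      by (simp add: x_def)
    have ul: "uniform_limit (cball 0 s) g (zcoeff f a) sequentially"
      unfolding uniform_limit_iff
    proof (intro allI impI)
      fix e :: real assume "e > 0"
      with lim have "\<forall>\<^sub>F n in sequentially. 2 * M / R ^ a * x n < e"
        by (simp add: order_tendsto_iff)
      then show "\<forall>\<^sub>F n in sequentially. \<forall>w\<in>cball 0 s. dist (g n w) (zcoeff f a w) < e"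
      proof eventually_elim
        case (elim n)
        show ?case
        proof
          fix w :: complex assume "w \<in> cball 0 s"
          then have "w \<in> ball 0 r" using s by auto
          from err[OF this, of n] elim show "dist (g n w) (zcoeff f a w) < e"
            by (simp add: dist_norm)
        qed
      qed
    qed
    have sub: "cball 0 s \<subseteq> ball (0::complex) r" "ball 0 s \<subseteq> ball (0::complex) r"
      using s by auto
    have "continuous_on (cball 0 s) (g n) \<and> g n holomorphic_on ball 0 s" for n
      using continuous_on_subset[OF holomorphic_on_imp_continuous_on[OF hg] sub(1)]
        holomorphic_on_subset[OF hg sub(2)] by blast
    then have "\<forall>\<^sub>F n in sequentially. continuous_on (cball 0 s) (g n) \<and> g n holomorphic_on ball 0 s"
      by simp
    from holomorphic_uniform_limit[OF this ul] show "zcoeff f a holomorphic_on ball 0 s"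
      by simp
  qed
  \<comment> \<open>The uniform limit is taken on closed discs, so the open disc is exhausted by the
    discs of radius s < r.\<close>
  then have "zcoeff f a holomorphic_on (\<Union>s\<in>{0<..<r}. ball 0 s)"
    by (intro holomorphic_on_UN_open) auto
  moreover have "ball 0 r \<subseteq> (\<Union>s\<in>{0<..<r}. ball (0::complex) s)"
  proof
    fix w :: complex assume "w \<in> ball 0 r"
    then have "(cmod w + r) / 2 \<in> {0<..<r}" "w \<in> ball 0 ((cmod w + r) / 2)"
      using pos by (auto simp: add_nonneg_pos)
    then show "w \<in> (\<Union>s\<in>{0<..<r}. ball 0 s)" by blast
  qed
  ultimately show ?case by (rule holomorphic_on_subset)
qed

lemma taylor2_bound: "cmod (taylor2 f i) * R ^ fst i * r ^ snd i \<le> M"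
proof -
  have "cmod (taylor2 f i) * r ^ snd i \<le> M / R ^ fst i"
    unfolding taylor2_def
    by (rule taylor_coeff_bound[OF zcoeff_holomorphic])
       (use pos zcoeff_bound in \<open>auto simp: field_simps\<close>)
  then show ?thesis using pos by (simp add: field_simps)
qed

text \<open>The bound on \<open>taylor2\<close> gives a geometric majorant, so the family is
  summable over pairs; its value is found by summing over the powers of w inside and those of z
  outside.\<close>

lemma taylor2_has_sum:
  assumes "z \<in> ball 0 R" "w \<in> ball 0 r"
  shows "((\<lambda>i. taylor2 f i * mon i (z, w)) has_sum f (z, w)) UNIV"
proof -
  define x y where "x = cmod z / R" and "y = cmod w / r"
  have xy: "0 \<le> x" "x < 1" "0 \<le> y" "y < 1"
    using assms pos by (auto simp: x_def y_def)
  have bd: "cmod (taylor2 f i * mon i (z, w)) \<le> M * (x ^ fst i * y ^ snd i)" for i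
  proof -
    have "cmod (taylor2 f i * mon i (z, w)) = (cmod (taylor2 f i) * R ^ fst i * r ^ snd i) * (x ^ fst i * y ^ snd i)"
      using pos by (simp add: norm_mult norm_mon x_def y_def power_divide)
    also have "\<dots> \<le> M * (x ^ fst i * y ^ snd i)"
      using xy by (intro mult_right_mono taylor2_bound) auto
    finally show ?thesis .
  qed
  have sm: "(\<lambda>i. taylor2 f i * mon i (z, w)) summable_on UNIV"
    by (rule summable_on_dominated(2)[OF summable_on_cmult_right[OF geometric_pair_summable[OF xy], of M] bd])
  have outer: "((\<lambda>a. zcoeff f a w * z ^ a) has_sum f (z, w)) UNIV"
  proof (rule norm_summable_imp_has_sum)
    have b: "cmod (zcoeff f a w * z ^ a) \<le> M * x ^ a" for a
    proof -
      have "cmod (zcoeff f a w * z ^ a) = (cmod (zcoeff f a w) * R ^ a) * x ^ a"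
        using pos by (simp add: norm_mult norm_power x_def power_divide)
      also have "\<dots> \<le> M * x ^ a" using xy by (intro mult_right_mono zcoeff_bound assms) auto
      finally show ?thesis .
    qed
    show "summable (\<lambda>a. cmod (zcoeff f a w * z ^ a))"
      by (rule summable_comparison_test[of _ "\<lambda>a. M * x ^ a"])
         (use b xy in \<open>auto intro!: summable_mult summable_geometric\<close>)
  qed (rule zcoeff_sums[OF assms])
  have inner: "((\<lambda>b. taylor2 f (a, b) * mon (a, b) (z, w)) has_sum (zcoeff f a w * z ^ a)) UNIV" for a
  proof (rule norm_summable_imp_has_sum)
    have "(\<lambda>b. (deriv ^^ b) (zcoeff f a) 0 / fact b * (w - 0) ^ b) sums zcoeff f a w"
      by (rule holomorphic_power_series[OF zcoeff_holomorphic assms(2)])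
    from sums_mult2[OF this, of "z ^ a"]
    show "(\<lambda>b. taylor2 f (a, b) * mon (a, b) (z, w)) sums (zcoeff f a w * z ^ a)"
      by (simp add: taylor2_def mon_def mult_ac)
    show "summable (\<lambda>b. cmod (taylor2 f (a, b) * mon (a, b) (z, w)))"
      by (rule summable_comparison_test[of _ "\<lambda>b. M * (x ^ a * y ^ b)"])
         (use bd[of "(a, _)"] xy in \<open>auto intro!: summable_mult summable_geometric\<close>)
  qed
  have "((\<lambda>i. taylor2 f i * mon i (z, w)) has_sum f (z, w)) (UNIV \<times> UNIV)"
    by (rule has_sum_SigmaI[OF inner outer]) (use sm in simp)
  then show ?thesis by simp
qed

end


section \<open>Geometry of the egg and the Taylor expansion on it\<close>

definition closed_egg :: "nat \<Rightarrow> (complex \<times> complex) set" where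
  "closed_egg m = {(z, w). (cmod z)\<^sup>2 + (cmod w) ^ (2 * m) \<le> 1}"

lemma continuous_on_rho: "continuous_on A (rho m)"
  unfolding rho_def case_prod_unfold by (intro continuous_intros)

lemma egg_eq_rho: "egg m = {p. rho m p < 0}"
  by (auto simp: egg_def rho_def)

lemma closed_egg_eq_rho: "closed_egg m = {p. rho m p \<le> 0}"
  by (auto simp: closed_egg_def rho_def)

lemma open_egg: "open (egg m)"
  unfolding egg_eq_rho using open_Collect_less[OF continuous_on_rho continuous_on_const] .

lemma closed_closed_egg: "closed (closed_egg m)"
  unfolding closed_egg_eq_rho using closed_Collect_le[OF continuous_on_rho continuous_on_const] .

lemma egg_subset_closed_egg: "egg m \<subseteq> closed_egg m"
  by (auto simp: egg_def closed_egg_def)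

text \<open>The egg is a complete Reinhardt domain, which is why one point of it brings a whole
  bidisc along.\<close>

lemma egg_mono:
  assumes "p \<in> egg m" "cmod (fst q) \<le> cmod (fst p)" "cmod (snd q) \<le> cmod (snd p)"
  shows "q \<in> egg m"
proof -
  have "(cmod (fst q))\<^sup>2 \<le> (cmod (fst p))\<^sup>2" "cmod (snd q) ^ (2 * m) \<le> cmod (snd p) ^ (2 * m)"
    using assms by (auto intro: power_mono)
  moreover have "(cmod (fst p))\<^sup>2 + cmod (snd p) ^ (2 * m) < 1"
    using assms(1) by (auto simp: egg_def)
  ultimately have "(cmod (fst q))\<^sup>2 + cmod (snd q) ^ (2 * m) < 1" by linarith
  then show ?thesis by (auto simp: egg_def case_prod_unfold)
qed

lemma closed_egg_norm_le:
  assumes "m \<ge> 1" "p \<in> closed_egg m"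
  shows "cmod (fst p) \<le> 1" "cmod (snd p) \<le> 1"
proof -
  have *: "(cmod (fst p))\<^sup>2 + cmod (snd p) ^ (2 * m) \<le> 1"
    using assms(2) by (auto simp: closed_egg_def)
  have "(cmod (fst p))\<^sup>2 \<le> 1" using * zero_le_power[OF norm_ge_zero[of "snd p"], of "2 * m"] by linarith
  then show "cmod (fst p) \<le> 1" by (simp add: power_le_one_iff abs_square_le_1)
  have "cmod (snd p) ^ (2 * m) \<le> 1" using * zero_le_power2[of "cmod (fst p)"] by linarith
  then show "cmod (snd p) \<le> 1" using assms(1) by (simp add: power_le_one_iff)
qed

lemma compact_closed_egg:
  assumes "m \<ge> 1"
  shows "compact (closed_egg m)"
proof -
  have "closed_egg m \<subseteq> cball 0 1 \<times> cball 0 1"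
    using closed_egg_norm_le[OF assms] by fastforce
  then have "bounded (closed_egg m)"
    by (rule bounded_subset[rotated]) (intro bounded_Times bounded_cball)
  then show ?thesis using closed_closed_egg compact_eq_bounded_closed by blast
qed

lemma scale_closed_egg:
  assumes "m \<ge> 1" "p \<in> closed_egg m" "0 \<le> t" "t < 1"
  shows "t *\<^sub>R p \<in> egg m"
proof -
  obtain z w where p: "p = (z, w)" by force
  have a: "t ^ (2 * m) * cmod w ^ (2 * m) \<le> t\<^sup>2 * cmod w ^ (2 * m)"
    using assms by (intro mult_right_mono power_decreasing) auto
  have b: "(cmod z)\<^sup>2 + cmod w ^ (2 * m) \<le> 1"
    using assms(2) by (simp add: closed_egg_def p)
  have "t\<^sup>2 < 1" using assms by (simp add: abs_square_less_1)
  moreover have "t\<^sup>2 * ((cmod z)\<^sup>2 + cmod w ^ (2 * m)) \<le> t\<^sup>2 * 1"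
    by (rule mult_left_mono[OF b]) simp
  ultimately show ?thesis
    using a assms by (simp add: p egg_def power_mult_distrib distrib_left)
qed

lemma egg_unscale:
  assumes "p \<in> egg m"
  obtains t q where "0 < t" "t < 1" "q \<in> egg m" "p = t *\<^sub>R q"
proof -
  have "isCont (\<lambda>t::real. t *\<^sub>R p) 1" by (intro continuous_intros)
  then have "\<forall>\<^sub>F t in at 1. t *\<^sub>R p \<in> egg m"
    unfolding isCont_def using topological_tendstoD[OF _ open_egg] assms by fastforce
  then obtain d where d: "d > 0" "\<And>t. t \<noteq> 1 \<Longrightarrow> dist t (1::real) < d \<Longrightarrow> t *\<^sub>R p \<in> egg m"
    unfolding eventually_at by auto
  define s where "s = 1 + d / 2"
  have "s *\<^sub>R p \<in> egg m" using d by (intro d(2)) (auto simp: s_def dist_real_def)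
  then show ?thesis using d(1) by (intro that[of "1 / s" "s *\<^sub>R p"]) (auto simp: s_def)
qed

text \<open>Openness, applied to a simultaneous increase of both moduli, puts p strictly inside a
  bidisc whose corner (R, r) is still in the egg.\<close>

lemma egg_enlarge:
  assumes "p \<in> egg m"
  obtains R r where "cmod (fst p) < R" "cmod (snd p) < r" "(complex_of_real R, complex_of_real r) \<in> egg m"
proof -
  define g where "g e = (complex_of_real (cmod (fst p) + e), complex_of_real (cmod (snd p) + e))" for e :: real
  have "isCont g 0" unfolding g_def by (intro continuous_intros)
  moreover have "g 0 \<in> egg m"
    by (rule egg_mono[OF assms]) (auto simp: g_def)
  ultimately have "\<forall>\<^sub>F e in at 0. g e \<in> egg m"
    unfolding isCont_def using topological_tendstoD[OF _ open_egg] by blast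
  then obtain d where d: "d > 0" "\<And>e. e \<noteq> 0 \<Longrightarrow> dist e 0 < d \<Longrightarrow> g e \<in> egg m"
    unfolding eventually_at by auto
  have "g (d / 2) \<in> egg m" using d(1) by (intro d(2)) auto
  then show ?thesis using d(1) by (intro that[of "cmod (fst p) + d / 2" "cmod (snd p) + d / 2"]) (auto simp: g_def)
qed

lemma polydisc_subset_egg:
  assumes "(complex_of_real R, complex_of_real r) \<in> egg m"
  shows "cball 0 R \<times> cball 0 r \<subseteq> egg m"
proof
  fix p :: "complex \<times> complex" assume "p \<in> cball 0 R \<times> cball 0 r"
  then show "p \<in> egg m" by (intro egg_mono[OF assms]) auto
qed

text \<open>Each point lies in a bidisc centred at the origin and contained in the egg. The bidisc
  varies with the point, but the coefficients, read off at the origin, do not.\<close>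

lemma taylor2_has_sum_egg:
  assumes f: "holomorphic2_on f (egg m)" and p: "p \<in> egg m"
  shows "((\<lambda>i. taylor2 f i * mon i p) has_sum f p) UNIV"
proof -
  obtain R r where R: "cmod (fst p) < R" "cmod (snd p) < r" "(complex_of_real R, complex_of_real r) \<in> egg m"
    using egg_enlarge[OF p] .
  note sub = polydisc_subset_egg[OF R(3)]
  have "compact (f ` (cball 0 R \<times> cball 0 r))"
    by (intro compact_continuous_image compact_Times compact_cball
        continuous_on_subset[OF holomorphic2_on_imp_continuous_on[OF f] sub])
  then obtain M where M: "\<And>q. q \<in> cball 0 R \<times> cball 0 r \<Longrightarrow> cmod (f q) \<le> M"
    by (meson compact_imp_bounded bounded_iff imageI)
  interpret polydisc_fun f R r M
  proof
    show "holomorphic2_on f (ball 0 R \<times> ball 0 r)"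
      by (rule holomorphic2_on_subset[OF f]) (use sub in fastforce)
    show "R > 0" "r > 0" using R norm_ge_zero less_le_trans le_less_trans by blast+
    show "cmod (f q) \<le> M" if "q \<in> ball 0 R \<times> ball 0 r" for q using that by (intro M) auto
  qed
  show ?thesis using taylor2_has_sum[of "fst p" "snd p"] R by simp
qed

lemma norm_mon_scaleR: "0 \<le> t \<Longrightarrow> cmod (mon i (t *\<^sub>R p)) = t ^ (fst i + snd i) * cmod (mon i p)"
  by (simp add: mon_scaleR norm_mult del: of_real_power)

text \<open>Three scales t < t1 < t2 < 1. On the compact t2-dilate of the closed egg f is bounded by
  one M; the room between t1 and t2 lets Cauchy's estimate bound every term at
  \<open>t1 *\<^sub>R p\<close> by the same M, whatever p; the passage from t1 to t contributes the
  decay \<open>(t / t1) ^ (fst i + snd i)\<close>.\<close>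

lemma taylor2_bound_egg:
  assumes m: "m \<ge> 1" and f: "holomorphic2_on f (egg m)" and t: "0 \<le> t" "t < 1"
  obtains M q where "0 \<le> M" "0 \<le> q" "q < 1"
    "\<And>i p. p \<in> closed_egg m \<Longrightarrow> cmod (taylor2 f i * mon i (t *\<^sub>R p)) \<le> M * q ^ (fst i + snd i)"
proof -
  define t1 where "t1 = (1 + t) / 2"
  define t2 where "t2 = (1 + t1) / 2"
  have tt: "0 < t1" "t < t1" "t1 < t2" "t2 < 1" using t by (auto simp: t1_def t2_def)
  define K where "K = (\<lambda>p. t2 *\<^sub>R p) ` closed_egg m"
  have K: "K \<subseteq> egg m" using scale_closed_egg[OF m] tt by (auto simp: K_def)
  have "compact K" unfolding K_def
    by (intro compact_continuous_image compact_closed_egg m continuous_intros)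
  then have "compact (f ` K)"
    by (intro compact_continuous_image continuous_on_subset[OF holomorphic2_on_imp_continuous_on[OF f] K])
  then obtain M where M: "\<And>q. q \<in> K \<Longrightarrow> cmod (f q) \<le> M"
    by (meson compact_imp_bounded bounded_iff imageI)
  have b: "cmod (taylor2 f i * mon i (t1 *\<^sub>R p)) \<le> M" if p: "p \<in> closed_egg m" for i p
  proof -
    \<comment> \<open>Since t1 / t2 < 1 this point is interior and has a bidisc of the egg around
      it. The t2-dilate of that bidisc contains \<open>t1 *\<^sub>R p\<close> and stays in
      \<open>K\<close>.\<close>
    have "(t1 / t2) *\<^sub>R p \<in> egg m" using tt by (intro scale_closed_egg m p) auto
    then obtain R r where R: "cmod (fst ((t1 / t2) *\<^sub>R p)) < R" "cmod (snd ((t1 / t2) *\<^sub>R p)) < r"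
        "(complex_of_real R, complex_of_real r) \<in> egg m"
      using egg_enlarge by blast
    have "0 < R" "0 < r" using R norm_ge_zero less_le_trans le_less_trans by blast+
    have sub: "ball 0 (t2 * R) \<times> ball 0 (t2 * r) \<subseteq> K"
    proof
      fix q :: "complex \<times> complex" assume q: "q \<in> ball 0 (t2 * R) \<times> ball 0 (t2 * r)"
      have "(1 / t2) *\<^sub>R q \<in> egg m"
        using q tt by (intro egg_mono[OF R(3)]) (auto simp: field_simps abs_of_pos \<open>0 < R\<close> \<open>0 < r\<close>)
      moreover have "q = t2 *\<^sub>R ((1 / t2) *\<^sub>R q)" using tt by simp
      ultimately show "q \<in> K" unfolding K_def using egg_subset_closed_egg by blast
    qed
    interpret polydisc_fun f "t2 * R" "t2 * r" M
    proof
      show "holomorphic2_on f (ball 0 (t2 * R) \<times> ball 0 (t2 * r))"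
        by (rule holomorphic2_on_subset[OF f]) (use sub K in blast)
      show "t2 * R > 0" "t2 * r > 0" using tt \<open>0 < R\<close> \<open>0 < r\<close> by auto
      show "cmod (f q) \<le> M" if "q \<in> ball 0 (t2 * R) \<times> ball 0 (t2 * r)" for q
        using that sub by (intro M) auto
    qed
    have le: "cmod (fst (t1 *\<^sub>R p)) \<le> t2 * R" "cmod (snd (t1 *\<^sub>R p)) \<le> t2 * r"
      using R tt by (auto simp: field_simps)
    have "cmod (taylor2 f i * mon i (t1 *\<^sub>R p)) =
        cmod (taylor2 f i) * (cmod (fst (t1 *\<^sub>R p)) ^ fst i * cmod (snd (t1 *\<^sub>R p)) ^ snd i)"
      by (simp add: norm_mult norm_mon)
    also have "\<dots> \<le> cmod (taylor2 f i) * ((t2 * R) ^ fst i * (t2 * r) ^ snd i)"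
      using pos by (intro mult_left_mono mult_mono power_mono le) auto
    also have "\<dots> \<le> M" using taylor2_bound[of i] by (simp add: mult_ac)
    finally show ?thesis .
  qed
  show ?thesis
  proof
    have "0 \<in> closed_egg m" using m by (simp add: closed_egg_def zero_prod_def power_0_left)
    from b[OF this] show "0 \<le> M" using norm_ge_zero order_trans by blast
    show "0 \<le> t / t1" "t / t1 < 1" using t tt by auto
    show "cmod (taylor2 f i * mon i (t *\<^sub>R p)) \<le> M * (t / t1) ^ (fst i + snd i)"
      if p: "p \<in> closed_egg m" for i p
    proof -
      have "t *\<^sub>R p = (t / t1) *\<^sub>R (t1 *\<^sub>R p)" using tt by simp
      then have "cmod (taylor2 f i * mon i (t *\<^sub>R p))
          = cmod (taylor2 f i * mon i (t1 *\<^sub>R p)) * (t / t1) ^ (fst i + snd i)"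
        using t tt by (simp only: norm_mult norm_mon_scaleR[of "t / t1"] divide_nonneg_pos) (simp only: mult_ac)
      also have "\<dots> \<le> M * (t / t1) ^ (fst i + snd i)"
        using t tt by (intro mult_right_mono b p) auto
      finally show ?thesis .
    qed
  qed
qed

section \<open>Sums of power series on the egg\<close>

lemma power_increment_ge:
  fixes x e R :: real
  assumes "0 \<le> x" "0 \<le> e" "x + e \<le> R"
  shows "real a * x ^ (a - 1) * e \<le> R ^ a"
proof (induction a)
  case (Suc a)
  have "x ^ a \<le> R ^ a" using assms by (intro power_mono) auto
  have "real (Suc a) * x ^ a * e = x * (real a * x ^ (a - 1) * e) + x ^ a * e"
    by (cases a) (auto simp: algebra_simps)
  also have "\<dots> \<le> x * R ^ a + R ^ a * e"
    using assms Suc \<open>x ^ a \<le> R ^ a\<close> by (intro add_mono mult_left_mono mult_right_mono) auto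
  also have "\<dots> = (x + e) * R ^ a" by (simp add: algebra_simps)
  also have "\<dots> \<le> R * R ^ a" using assms by (intro mult_right_mono) auto
  finally show ?case by simp
qed simp

text \<open>Enumerating the pairs turns unconditional sums into ordinary series, the form in which
  they are integrated and differentiated term by term.\<close>

lemma has_sum_pairs_sums:
  fixes f :: "nat \<times> nat \<Rightarrow> 'a :: {topological_comm_monoid_add, t2_space}"
  assumes "(f has_sum S) UNIV"
  shows "(\<lambda>n. f (prod_decode n)) sums S"
  using assms has_sum_reindex_bij_betw[OF bij_prod_decode, of f S] has_sum_imp_sums by blast

text \<open>Termwise differentiation on a bidisc that contains p. There
  \<open>power_increment_ge\<close>, the linear term of the binomial expansion of
  \<open>(x + e) ^ a\<close>, serves as Cauchy estimate: the derivative of a term is at most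
  \<open>1 / e\<close> times the modulus of the term at the corner (R, r), where the majorant
  \<open>B\<close> applies.\<close>

lemma power_series2_holomorphic2:
  assumes B: "B summable_on UNIV" and c: "\<And>i p. p \<in> egg m \<Longrightarrow> cmod (c i * mon i p) \<le> B i"
  shows "holomorphic2_on (\<lambda>p. \<Sum>\<^sub>\<infinity>i. c i * mon i p) (egg m)"
  unfolding holomorphic2_on_def
proof
  fix p assume p: "p \<in> egg m"
  obtain R r where R: "cmod (fst p) < R" "cmod (snd p) < r" "(complex_of_real R, complex_of_real r) \<in> egg m"
    using egg_enlarge[OF p] .
  have R0: "0 < R" "0 < r" using R norm_ge_zero less_le_trans le_less_trans by blast+
  \<comment> \<open>Half of the smaller gap: p lies in the bidisc of radii R - e and r - e, and from
    there a step e still stays within R and r.\<close>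
  define e where "e = min (R - cmod (fst p)) (r - cmod (snd p)) / 2"
  have e: "e > 0" "cmod (fst p) < R - e" "cmod (snd p) < r - e"
    using R by (auto simp: e_def min_def field_simps split: if_splits)
  define U where "U = ball (0::complex) (R - e) \<times> ball (0::complex) (r - e)"
  have U: "open U" "convex U" "p \<in> U"
    using e by (auto simp: U_def open_Times convex_Times mem_Times_iff)
  have UE: "U \<subseteq> egg m"
    using polydisc_subset_egg[OF R(3)] e(1) by (force simp: U_def)
  define D where "D n = prod_decode n" for n
  \<comment> \<open>At exponent 0 the truncated subtraction is harmless, as the factor
    \<open>of_nat 0\<close> vanishes.\<close>
  define \<alpha> where "\<alpha> n q = c (D n) * (of_nat (fst (D n)) * fst q ^ (fst (D n) - 1) * snd q ^ snd (D n))"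
    for n and q :: "complex \<times> complex"
  define \<beta> where "\<beta> n q = c (D n) * (fst q ^ fst (D n) * (of_nat (snd (D n)) * snd q ^ (snd (D n) - 1)))"
    for n and q :: "complex \<times> complex"
  have sB: "summable (\<lambda>n. B (D n) / e)"
    using has_sum_pairs_sums[OF has_sum_infsum[OF B]] by (auto simp: D_def sums_iff intro: summable_divide)
  have cR: "cmod (c i) * (R ^ fst i * r ^ snd i) \<le> B i" for i
    using c[OF R(3), of i] R0 by (simp add: norm_mult norm_mon)
  have bound: "cmod (\<alpha> n q) \<le> B (D n) / e" "cmod (\<beta> n q) \<le> B (D n) / e" if "q \<in> U" for n q
  proof -
    have q: "cmod (fst q) + e \<le> R" "cmod (snd q) + e \<le> r" using that by (auto simp: U_def)
    have "cmod (\<alpha> n q) * e = cmod (c (D n)) * ((real (fst (D n)) * cmod (fst q) ^ (fst (D n) - 1) * e) * cmod (snd q) ^ snd (D n))"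
      by (simp add: \<alpha>_def norm_mult norm_power)
    also have "\<dots> \<le> cmod (c (D n)) * (R ^ fst (D n) * r ^ snd (D n))"
      using q e R0 by (intro mult_left_mono mult_mono power_increment_ge power_mono) auto
    finally show "cmod (\<alpha> n q) \<le> B (D n) / e"
      using cR[of "D n"] e by (simp add: field_simps)
    have "cmod (\<beta> n q) * e = cmod (c (D n)) * (cmod (fst q) ^ fst (D n) * (real (snd (D n)) * cmod (snd q) ^ (snd (D n) - 1) * e))"
      by (simp add: \<beta>_def norm_mult norm_power)
    also have "\<dots> \<le> cmod (c (D n)) * (R ^ fst (D n) * r ^ snd (D n))"
      using q e R0 by (intro mult_left_mono mult_mono power_increment_ge power_mono) auto
    finally show "cmod (\<beta> n q) \<le> B (D n) / e"
      using cR[of "D n"] e by (simp add: field_simps)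
  qed
  have ul: "uniform_limit U (\<lambda>n q. \<Sum>i<n. \<alpha> i q) (\<lambda>q. \<Sum>i. \<alpha> i q) sequentially"
      "uniform_limit U (\<lambda>n q. \<Sum>i<n. \<beta> i q) (\<lambda>q. \<Sum>i. \<beta> i q) sequentially"
    using bound by (auto intro!: Weierstrass_m_test[OF _ sB])
  have hs: "((\<lambda>i. c i * mon i q) has_sum (\<Sum>\<^sub>\<infinity>i. c i * mon i q)) UNIV" if "q \<in> egg m" for q
    by (intro has_sum_infsum summable_on_dominated(2)[OF B c] that)
  note sm = has_sum_pairs_sums[OF hs, folded D_def]
  have "\<exists>g. \<forall>q\<in>U. (\<lambda>n. c (D n) * mon (D n) q) sums g q \<and>
      (g has_derivative (\<lambda>h. (\<Sum>i. \<alpha> i q) * fst h + (\<Sum>i. \<beta> i q) * snd h)) (at q within U)"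
  proof (rule has_derivative_series[where S = U and f = "\<lambda>n q. c (D n) * mon (D n) q"
        and f' = "\<lambda>n q h. \<alpha> n q * fst h + \<beta> n q * snd h"
        and g' = "\<lambda>q h. (\<Sum>i. \<alpha> i q) * fst h + (\<Sum>i. \<beta> i q) * snd h", OF U(2) _ _ U(3) sm[OF p]])
    show "((\<lambda>q. c (D n) * mon (D n) q) has_derivative (\<lambda>h. \<alpha> n q * fst h + \<beta> n q * snd h)) (at q within U)" for n q
      unfolding mon_def \<alpha>_def \<beta>_def
      by (rule derivative_eq_intros refl)+ (simp add: fun_eq_iff algebra_simps)
  next
    fix \<epsilon> :: real assume \<epsilon>: "\<epsilon> > 0"
    have "\<forall>\<^sub>F n in sequentially. \<forall>q\<in>U. dist (\<Sum>i<n. \<alpha> i q) (\<Sum>i. \<alpha> i q) < \<epsilon> / 2"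
         "\<forall>\<^sub>F n in sequentially. \<forall>q\<in>U. dist (\<Sum>i<n. \<beta> i q) (\<Sum>i. \<beta> i q) < \<epsilon> / 2"
      by (rule uniform_limitD[OF ul(1) half_gt_zero[OF \<epsilon>]], rule uniform_limitD[OF ul(2) half_gt_zero[OF \<epsilon>]])
    then show "\<forall>\<^sub>F n in sequentially. \<forall>q\<in>U. \<forall>h. cmod ((\<Sum>i<n. \<alpha> i q * fst h + \<beta> i q * snd h)
        - ((\<Sum>i. \<alpha> i q) * fst h + (\<Sum>i. \<beta> i q) * snd h)) \<le> \<epsilon> * norm h"
    proof eventually_elim
      case (elim n)
      show ?case
      proof (intro ballI allI)
        fix q and h :: "complex \<times> complex" assume q: "q \<in> U"
        have "(\<Sum>i<n. \<alpha> i q * fst h + \<beta> i q * snd h) - ((\<Sum>i. \<alpha> i q) * fst h + (\<Sum>i. \<beta> i q) * snd h)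
            = ((\<Sum>i<n. \<alpha> i q) - (\<Sum>i. \<alpha> i q)) * fst h + ((\<Sum>i<n. \<beta> i q) - (\<Sum>i. \<beta> i q)) * snd h"
          by (simp add: sum.distrib sum_distrib_left algebra_simps)
        also have "cmod \<dots> \<le> \<epsilon> / 2 * norm h + \<epsilon> / 2 * norm h"
        proof (rule norm_triangle_le, rule add_mono)
          show "cmod (((\<Sum>i<n. \<alpha> i q) - (\<Sum>i. \<alpha> i q)) * fst h) \<le> \<epsilon> / 2 * norm h"
            unfolding norm_mult
            by (rule mult_mono) (use elim(1) q \<epsilon> norm_fst_le[of "fst h" "snd h"] in \<open>auto simp: dist_norm less_imp_le\<close>)
          show "cmod (((\<Sum>i<n. \<beta> i q) - (\<Sum>i. \<beta> i q)) * snd h) \<le> \<epsilon> / 2 * norm h"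
            unfolding norm_mult
            by (rule mult_mono) (use elim(2) q \<epsilon> norm_snd_le[of "snd h" "fst h"] in \<open>auto simp: dist_norm less_imp_le\<close>)
        qed
        finally show "cmod ((\<Sum>i<n. \<alpha> i q * fst h + \<beta> i q * snd h)
            - ((\<Sum>i. \<alpha> i q) * fst h + (\<Sum>i. \<beta> i q) * snd h)) \<le> \<epsilon> * norm h"
          by simp
      qed
    qed
  qed
  then obtain g where g: "\<And>q. q \<in> U \<Longrightarrow> (\<lambda>n. c (D n) * mon (D n) q) sums g q"
      "(g has_derivative (\<lambda>h. (\<Sum>i. \<alpha> i p) * fst h + (\<Sum>i. \<beta> i p) * snd h)) (at p within U)"
    using U(3) by blast
  have "(g has_derivative (\<lambda>h. (\<Sum>i. \<alpha> i p) * fst h + (\<Sum>i. \<beta> i p) * snd h)) (at p)"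
    using g(2) at_within_open[OF U(3,1)] by simp
  then have "((\<lambda>q. \<Sum>\<^sub>\<infinity>i. c i * mon i q) has_derivative (\<lambda>h. (\<Sum>i. \<alpha> i p) * fst h + (\<Sum>i. \<beta> i p) * snd h)) (at p)"
    by (rule has_derivative_transform_within_open[OF _ U(1,3)])
       (use g(1) sm UE sums_unique2 in blast)
  then have "((\<lambda>q. \<Sum>\<^sub>\<infinity>i. c i * mon i q) has_derivative (\<lambda>h. (\<Sum>i. \<alpha> i p) * fst h + (\<Sum>i. \<beta> i p) * snd h)) (at p within egg m)"
    by (rule has_derivative_at_withinI)
  then show "\<exists>a b. ((\<lambda>q. \<Sum>\<^sub>\<infinity>i. c i * mon i q) has_derivative (\<lambda>h. a * fst h + b * snd h)) (at p within egg m)"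
    by blast
qed

lemma power_series2_continuous_on:
  assumes "B summable_on UNIV" "\<And>i p. p \<in> X \<Longrightarrow> cmod (c i * mon i p) \<le> B i"
  shows "continuous_on X (\<lambda>p. \<Sum>\<^sub>\<infinity>i. c i * mon i p)"
proof (rule uniform_limit_theorem)
  show "uniform_limit X (\<lambda>I p. \<Sum>i\<in>I. c i * mon i p) (\<lambda>p. \<Sum>\<^sub>\<infinity>i. c i * mon i p) (finite_subsets_at_top UNIV)"
    by (rule Weierstrass_m_test_general[OF assms(2,1)])
  show "\<forall>\<^sub>F I in finite_subsets_at_top UNIV. continuous_on X (\<lambda>p. \<Sum>i\<in>I. c i * mon i p)"
    by (intro always_eventually allI continuous_intros)
qed simp

section \<open>Orthogonal monomials and reproducing kernels\<close>


text \<open>Sum and integral commute because the norm of the i-th term integrates to at most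
  \<open>B i\<close> times the L^1 norm of g. Here g is a general integrable function, so that
  boundary values may take its place.\<close>

lemma integral_power_series_sums:
  fixes g :: "'a \<Rightarrow> complex" and T :: "nat \<times> nat \<Rightarrow> 'a \<Rightarrow> complex"
  assumes g: "integrable M g" and T: "\<And>i. T i \<in> borel_measurable M"
    and B: "B summable_on UNIV" "\<And>i x. x \<in> space M \<Longrightarrow> cmod (T i x) \<le> B i"
  shows "(\<lambda>n. \<integral>x. g x * T (prod_decode n) x \<partial>M) sums (\<integral>x. g x * (\<Sum>\<^sub>\<infinity>i. T i x) \<partial>M)"
proof -
  note [measurable] = T borel_measurable_integrable[OF g]
  let ?D = prod_decode
  have int: "integrable M (\<lambda>x. g x * T (?D n) x)" for n
  proof (rule Bochner_Integration.integrable_bound)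
    show "integrable M (\<lambda>x. B (?D n) * norm (g x))" using g by simp
    show "AE x in M. norm (g x * T (?D n) x) \<le> norm (B (?D n) * norm (g x))"
    proof (rule AE_I2)
      fix x assume x: "x \<in> space M"
      then have "0 \<le> B (?D n)" using B(2)[OF x, of "?D n"] norm_ge_zero order_trans by blast
      then show "norm (g x * T (?D n) x) \<le> norm (B (?D n) * norm (g x))"
        using mult_left_mono[OF B(2)[OF x, of "?D n"] norm_ge_zero[of "g x"]]
        by (simp add: norm_mult abs_mult mult.commute)
    qed
  qed simp
  have sB: "summable (\<lambda>n. B (?D n))"
    using has_sum_pairs_sums[OF has_sum_infsum[OF B(1)]] sums_summable by blast
  have pt: "(\<lambda>n. T (?D n) x) sums (\<Sum>\<^sub>\<infinity>i. T i x)" if "x \<in> space M" for x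
    by (intro has_sum_pairs_sums has_sum_infsum summable_on_dominated(2)[OF B(1)] B(2) that)
  have "(\<lambda>n. integral\<^sup>L M (\<lambda>x. g x * T (?D n) x)) sums (\<integral>x. (\<Sum>n. g x * T (?D n) x) \<partial>M)"
  proof (rule sums_integral[OF int])
    show "AE x in M. summable (\<lambda>n. norm (g x * T (?D n) x))"
    proof (rule AE_I2, rule summable_comparison_test, intro exI allI impI)
      fix x n assume "x \<in> space M"
      then show "norm (norm (g x * T (?D n) x)) \<le> norm (g x) * B (?D n)"
        by (simp add: norm_mult mult_left_mono B(2))
    qed (intro summable_mult sB)
    show "summable (\<lambda>n. \<integral>x. norm (g x * T (?D n) x) \<partial>M)"
    proof (rule summable_comparison_test, intro exI allI impI)
      fix n
      have "(\<integral>x. norm (g x * T (?D n) x) \<partial>M) \<le> (\<integral>x. norm (g x) * B (?D n) \<partial>M)"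
        using g by (intro integral_mono integrable_norm int) (auto simp: norm_mult intro!: mult_left_mono B(2))
      then show "norm (\<integral>x. norm (g x * T (?D n) x) \<partial>M) \<le> (\<integral>x. norm (g x) \<partial>M) * B (?D n)"
        by simp
    qed (intro summable_mult sB)
  qed
  also have "(\<integral>x. (\<Sum>n. g x * T (?D n) x) \<partial>M) = (\<integral>x. g x * (\<Sum>\<^sub>\<infinity>i. T i x) \<partial>M)"
    using pt by (intro Bochner_Integration.integral_cong refl) (metis sums_mult sums_unique)
  finally show ?thesis .
qed

text \<open>The squared norms of the monomials are written as \<open>1 / e\<close>, because the coefficients \<open>e\<close> are
  what enters the reproducing kernel.\<close>

definition diag_kernel :: "(nat \<times> nat \<Rightarrow> real) \<Rightarrow> complex \<times> complex \<Rightarrow> complex \<times> complex \<Rightarrow> complex" where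
  "diag_kernel e \<zeta> \<eta> = (\<Sum>\<^sub>\<infinity>i. (of_real (e i) * cnj (mon i \<zeta>)) * mon i \<eta>)"

lemma norm_mon_le_1:
  assumes "m \<ge> 1" "p \<in> closed_egg m"
  shows "cmod (mon i p) \<le> 1"
  using closed_egg_norm_le[OF assms] by (simp add: norm_mon mult_le_one power_le_one)

lemma mon_measurable [measurable]: "mon i \<in> borel_measurable borel"
  by (intro borel_measurable_continuous_onI continuous_intros)

lemma cnj_mon_measurable [measurable]: "(\<lambda>x. cnj (mon i x)) \<in> borel_measurable borel"
  by (intro borel_measurable_continuous_onI continuous_intros)

text \<open>The shared setting for \<open>sigma_F m\<close>, Lebesgue measure on the egg and
  Lebesgue measure on its dilates. What it keeps of rotation invariance is
  \<open>orth\<close>.\<close>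

locale egg_measure = finite_measure M for M :: "(complex \<times> complex) measure" +
  fixes m :: nat
  assumes m: "m \<ge> 1"
    and space: "space M \<subseteq> closed_egg m"
    and meas: "(\<lambda>x. x) \<in> measurable M borel"
    and orth: "\<And>i j. i \<noteq> j \<Longrightarrow> (\<integral>x. mon i x * cnj (mon j x) \<partial>M) = 0"
begin

lemma measurable_M: "f \<in> borel_measurable borel \<Longrightarrow> f \<in> borel_measurable M"
  using measurable_compose[OF meas] by blast

lemma integrable_bounded:
  assumes "f \<in> borel_measurable M" "\<And>x. x \<in> space M \<Longrightarrow> cmod (f x) \<le> B"
  shows "integrable M f"
  by (rule integrable_const_bound[of _ B]) (use assms in auto)

text \<open>Orthogonality leaves a single term of the expansion. The majorant has to hold on the
  whole space of \<open>M\<close>, which is why this is applied to dilated functions or on shrunken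
  domains.\<close>

lemma integral_cnj_mon:
  assumes B: "B summable_on UNIV" "\<And>i p. p \<in> space M \<Longrightarrow> cmod (c i * mon i p) \<le> B i"
    and f: "\<And>p. p \<in> space M \<Longrightarrow> ((\<lambda>i. c i * mon i p) has_sum f p) UNIV"
  shows "(\<integral>x. f x * cnj (mon j x) \<partial>M) = c j * of_real (\<integral>x. (cmod (mon j x))\<^sup>2 \<partial>M)"
proof -
  have mj: "(\<lambda>x. cnj (mon j x)) \<in> borel_measurable M" "mon i \<in> borel_measurable M" for i
    by (auto intro!: measurable_M)
  have "(\<lambda>n. \<integral>x. cnj (mon j x) * (c (prod_decode n) * mon (prod_decode n) x) \<partial>M) sums
      (\<integral>x. cnj (mon j x) * (\<Sum>\<^sub>\<infinity>i. c i * mon i x) \<partial>M)"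
  proof (rule integral_power_series_sums[OF _ _ B])
    show "integrable M (\<lambda>x. cnj (mon j x))"
    proof (rule integrable_bounded[OF mj(1)])
      show "cmod (cnj (mon j x)) \<le> 1" if "x \<in> space M" for x
        using norm_mon_le_1[OF m subsetD[OF space that]] by simp
    qed
  qed (use mj in auto)
  also have "(\<integral>x. cnj (mon j x) * (\<Sum>\<^sub>\<infinity>i. c i * mon i x) \<partial>M) = (\<integral>x. f x * cnj (mon j x) \<partial>M)"
    using f by (intro Bochner_Integration.integral_cong refl) (auto simp: infsumI mult.commute)
  also have "(\<lambda>n. \<integral>x. cnj (mon j x) * (c (prod_decode n) * mon (prod_decode n) x) \<partial>M) =
      (\<lambda>n. if n = prod_encode j then c j * of_real (\<integral>x. (cmod (mon j x))\<^sup>2 \<partial>M) else 0)"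
  proof
    fix n
    have "(\<integral>x. cnj (mon j x) * (c (prod_decode n) * mon (prod_decode n) x) \<partial>M) =
        (\<integral>x. c (prod_decode n) * (mon (prod_decode n) x * cnj (mon j x)) \<partial>M)"
      by (simp only: mult_ac)
    also have "\<dots> = c (prod_decode n) * (\<integral>x. mon (prod_decode n) x * cnj (mon j x) \<partial>M)"
      by (rule integral_mult_right_zero)
    finally have "(\<integral>x. cnj (mon j x) * (c (prod_decode n) * mon (prod_decode n) x) \<partial>M) =
        c (prod_decode n) * (\<integral>x. mon (prod_decode n) x * cnj (mon j x) \<partial>M)" .
    moreover have "(\<integral>x. mon j x * cnj (mon j x) \<partial>M) = of_real (\<integral>x. (cmod (mon j x))\<^sup>2 \<partial>M)"
      by (simp only: complex_norm_square[symmetric] integral_complex_of_real)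
    moreover have "prod_decode n = j \<longleftrightarrow> n = prod_encode j" by auto
    ultimately show "(\<integral>x. cnj (mon j x) * (c (prod_decode n) * mon (prod_decode n) x) \<partial>M) =
        (if n = prod_encode j then c j * of_real (\<integral>x. (cmod (mon j x))\<^sup>2 \<partial>M) else 0)"
      using orth[of "prod_decode n" j] by auto
  qed
  finally show ?thesis
    using sums_single[of "prod_encode j" "\<lambda>_. c j * of_real (\<integral>x. (cmod (mon j x))\<^sup>2 \<partial>M)"]
    by (rule sums_unique2)
qed

end

text \<open>\<open>e_bound\<close> is the growth condition behind convergence: the single terms of
  the diagonal series stay bounded, uniformly in the index, on every dilate of the closed
  egg.\<close>

locale diag_coeffs =
  fixes m :: nat and e :: "nat \<times> nat \<Rightarrow> real"
  assumes m_ge_1: "m \<ge> 1"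
    and e_pos: "\<And>i. e i > 0"
    and e_bound: "\<And>q. 0 < q \<Longrightarrow> q < 1 \<Longrightarrow> \<exists>C. \<forall>i. \<forall>p\<in>closed_egg m. e i * (cmod (mon i (q *\<^sub>R p)))\<^sup>2 \<le> C"
begin

lemma diag_kernel_dominated:
  assumes "\<zeta> \<in> egg m"
  obtains B where "B summable_on UNIV"
    "\<And>i \<eta>. \<eta> \<in> closed_egg m \<Longrightarrow> cmod ((of_real (e i) * cnj (mon i \<zeta>)) * mon i \<eta>) \<le> B i"
proof -
  obtain t \<zeta>' where t: "0 < t" "t < 1" "\<zeta>' \<in> egg m" "\<zeta> = t *\<^sub>R \<zeta>'"
    using egg_unscale[OF assms] .
  \<comment> \<open>The dilation factor t of \<zeta> is written as \<open>q ^ 3\<close>. By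
    homogeneity one factor q stays with \<zeta>' and one moves to \<eta>, so that
    \<open>e_bound\<close> applies to both; the third gives the geometric decay.\<close>
  define q where "q = root 3 t"
  have q: "0 < q" "q < 1" "q ^ 3 = t"
    using t by (auto simp: q_def)
  obtain C where C: "\<And>i p. p \<in> closed_egg m \<Longrightarrow> e i * (cmod (mon i (q *\<^sub>R p)))\<^sup>2 \<le> C"
    using e_bound[OF q(1,2)] by auto
  have bound: "cmod ((of_real (e i) * cnj (mon i \<zeta>)) * mon i \<eta>) \<le> C * (q ^ fst i * q ^ snd i)"
    if \<eta>: "\<eta> \<in> closed_egg m" for i \<eta>
  proof -
    define n where "n = fst i + snd i"
    define a b where "a = cmod (mon i (q *\<^sub>R \<zeta>'))" and "b = cmod (mon i (q *\<^sub>R \<eta>))"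
    have "\<zeta> = q *\<^sub>R q *\<^sub>R q *\<^sub>R \<zeta>'" using t(4) q(3) by (simp add: power3_eq_cube)
    then have "cmod (mon i \<zeta>) * cmod (mon i \<eta>) = q ^ n * (a * b)"
      using q by (simp add: norm_mon_scaleR a_def b_def n_def power_mult_distrib mult_ac)
    \<comment> \<open>The mixed product is reduced to the two diagonal terms, which
      \<open>e_bound\<close> controls.\<close>
    moreover have "a * b \<le> (a\<^sup>2 + b\<^sup>2) / 2" using sum_squares_bound[of a b] by simp
    then have "e i * (a * b) \<le> e i * ((a\<^sup>2 + b\<^sup>2) / 2)"
      using e_pos[of i] by (intro mult_left_mono) auto
    then have "e i * (a * b) \<le> C"
      using C[OF \<eta>, of i] C[of \<zeta>' i] t(3) egg_subset_closed_egg[of m]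
      by (auto simp: a_def b_def algebra_simps)
    then have "q ^ n * (e i * (a * b)) \<le> q ^ n * C" using q by (intro mult_left_mono) auto
    ultimately show ?thesis
      using e_pos[of i] by (simp add: norm_mult n_def power_add mult_ac)
  qed
  show ?thesis
    by (rule that[OF summable_on_cmult_right[OF geometric_pair_summable] bound]) (use q in auto)
qed

text \<open>For \<zeta> in the open egg the majorant is uniform in \<eta> over the closed egg, so
  boundedness and continuity extend up to the boundary.\<close>

lemma
  assumes \<zeta>: "\<zeta> \<in> egg m"
  shows diag_kernel_has_sum: "\<eta> \<in> closed_egg m \<Longrightarrow>
      ((\<lambda>i. (of_real (e i) * cnj (mon i \<zeta>)) * mon i \<eta>) has_sum diag_kernel e \<zeta> \<eta>) UNIV"
    and diag_kernel_bounded: "\<exists>C. \<forall>\<eta>\<in>closed_egg m. cmod (diag_kernel e \<zeta> \<eta>) \<le> C"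
    and diag_kernel_holomorphic2: "holomorphic2_on (diag_kernel e \<zeta>) (egg m)"
    and diag_kernel_continuous_on: "continuous_on (closed_egg m) (diag_kernel e \<zeta>)"
proof -
  obtain B where B: "B summable_on UNIV"
    "\<And>i \<eta>. \<eta> \<in> closed_egg m \<Longrightarrow> cmod ((of_real (e i) * cnj (mon i \<zeta>)) * mon i \<eta>) \<le> B i"
    using diag_kernel_dominated[OF \<zeta>] by blast
  note sm = summable_on_dominated(2)[OF B(1)]
  show "((\<lambda>i. (of_real (e i) * cnj (mon i \<zeta>)) * mon i \<eta>) has_sum diag_kernel e \<zeta> \<eta>) UNIV"
    if "\<eta> \<in> closed_egg m"
    unfolding diag_kernel_def by (intro has_sum_infsum sm B(2) that)
  show "\<exists>C. \<forall>\<eta>\<in>closed_egg m. cmod (diag_kernel e \<zeta> \<eta>) \<le> C"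
  proof (intro exI ballI)
    fix \<eta> assume \<eta>: "\<eta> \<in> closed_egg m"
    show "cmod (diag_kernel e \<zeta> \<eta>) \<le> infsum B UNIV"
      unfolding diag_kernel_def
      by (rule norm_infsum_le[OF has_sum_infsum[OF sm] has_sum_infsum[OF B(1)]]) (use B(2)[OF \<eta>] in auto)
  qed
  show "holomorphic2_on (diag_kernel e \<zeta>) (egg m)"
    unfolding diag_kernel_def
    by (rule power_series2_holomorphic2[OF B(1)]) (use B(2) egg_subset_closed_egg in blast)
  show "continuous_on (closed_egg m) (diag_kernel e \<zeta>)"
    unfolding diag_kernel_def by (rule power_series2_continuous_on[OF B(1)]) (use B(2) in blast)
qed

lemma diag_kernel_diag:
  assumes "\<zeta> \<in> egg m" "((\<lambda>i. e i * (cmod (mon i \<zeta>))\<^sup>2) has_sum G) UNIV"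
  shows "diag_kernel e \<zeta> \<zeta> = of_real G"
proof -
  have "(\<lambda>i. (of_real (e i) * cnj (mon i \<zeta>)) * mon i \<zeta>) = (\<lambda>i. complex_of_real (e i * (cmod (mon i \<zeta>))\<^sup>2))"
    by (simp only: fun_eq_iff of_real_mult complex_norm_square mult_ac) simp
  then have "((\<lambda>i. (of_real (e i) * cnj (mon i \<zeta>)) * mon i \<zeta>) has_sum of_real G) UNIV"
    using has_sum_of_real[OF assms(2)] by (simp only:)
  then show ?thesis
    using diag_kernel_has_sum[OF assms(1)] assms(1) egg_subset_closed_egg has_sum_unique by blast
qed

lemma diag_kernel_reproducing:
  assumes M: "egg_measure M m" and \<zeta>: "\<zeta> \<in> egg m"
    and N: "\<And>i. (\<integral>x. (cmod (mon i x))\<^sup>2 \<partial>M) = 1 / e i"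
    and g: "integrable M g" "\<And>i. (\<integral>x. g x * cnj (mon i x) \<partial>M) = c i * of_real (\<integral>x. (cmod (mon i x))\<^sup>2 \<partial>M)"
    and F: "((\<lambda>i. c i * mon i \<zeta>) has_sum F) UNIV"
  shows "(\<integral>x. g x * cnj (diag_kernel e \<zeta> x) \<partial>M) = F"
proof -
  interpret egg_measure M m by fact
  obtain B where B: "B summable_on UNIV"
    "\<And>i \<eta>. \<eta> \<in> closed_egg m \<Longrightarrow> cmod ((of_real (e i) * cnj (mon i \<zeta>)) * mon i \<eta>) \<le> B i"
    using diag_kernel_dominated[OF \<zeta>] by blast
  let ?T = "\<lambda>i x. cnj ((of_real (e i) * cnj (mon i \<zeta>)) * mon i x)"
  have "(\<lambda>n. \<integral>x. g x * ?T (prod_decode n) x \<partial>M) sums (\<integral>x. g x * (\<Sum>\<^sub>\<infinity>i. ?T i x) \<partial>M)"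
  proof (rule integral_power_series_sums[OF g(1) _ B(1)])
    show "?T i \<in> borel_measurable M" for i
      by (intro measurable_M borel_measurable_continuous_onI continuous_intros)
    show "cmod (?T i x) \<le> B i" if "x \<in> space M" for i x
      using B(2)[of x i] that space by (simp only: complex_mod_cnj) blast
  qed
  moreover have "(\<Sum>\<^sub>\<infinity>i. ?T i x) = cnj (diag_kernel e \<zeta> x)" for x
    unfolding diag_kernel_def by (rule infsum_cnj)
  moreover have "(\<integral>x. g x * ?T i x \<partial>M) = c i * mon i \<zeta>" for i
  proof -
    have "(\<integral>x. g x * ?T i x \<partial>M) = (\<integral>x. (of_real (e i) * mon i \<zeta>) * (g x * cnj (mon i x)) \<partial>M)"
      by (simp only: complex_cnj_mult complex_cnj_cnj complex_cnj_complex_of_real mult_ac)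
    also have "\<dots> = of_real (e i) * mon i \<zeta> * (\<integral>x. g x * cnj (mon i x) \<partial>M)"
      by (rule integral_mult_right_zero)
    also have "\<dots> = of_real (e i) * mon i \<zeta> * (c i * of_real (1 / e i))"
      by (simp only: g(2)[of i] N[of i])
    finally show ?thesis using e_pos[of i] by simp
  qed
  ultimately have "(\<lambda>n. c (prod_decode n) * mon (prod_decode n) \<zeta>) sums (\<integral>x. g x * cnj (diag_kernel e \<zeta> x) \<partial>M)"
    by (simp only:)
  then show ?thesis using has_sum_pairs_sums[OF F] by (rule sums_unique2)
qed

end

section \<open>The diagonal of the kernels\<close>


text \<open>Induction on \<open>a\<close> through
  \<open>(1 - x^k)^(a+1) = (1 - x^k)^a - x^k (1 - x^k)^a\<close>: the second term is the same
  integral with g raised by k, that is, with \<open>(g + 1) / k\<close> raised by 1. The exponent g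
  is real because the density of \<open>sigma_F\<close> carries a cube root.\<close>

lemma beta_has_integral:
  fixes g :: real
  assumes "k \<ge> 1" "g > -1"
  shows "((\<lambda>x. (1 - x ^ k) ^ a * x powr g) has_integral
           fact a / (real k * pochhammer ((g + 1) / real k) (Suc a))) {0..1}"
  using assms(2)
proof (induction a arbitrary: g)
  case 0
  then show ?case
    using has_integral_powr_from_0[of g 1] assms(1) by (simp add: pochhammer_Suc)
next
  case (Suc a)
  define \<beta> where "\<beta> = (g + 1) / real k"
  have \<beta>: "\<beta> > 0" "(g + real k + 1) / real k = \<beta> + 1"
    using Suc.prems assms(1) by (auto simp: \<beta>_def field_simps)
  define P where "P = pochhammer \<beta> (Suc a)"
  define Q where "Q = pochhammer (\<beta> + 1) (Suc a)"
  \<comment> \<open>The Pochhammer symbol of length \<open>a + 2\<close> splits off its lowest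
    factor or its highest; comparing the two evaluates the difference of the reciprocals.\<close>
  have PQ: "pochhammer \<beta> (Suc (Suc a)) = \<beta> * Q" "pochhammer \<beta> (Suc (Suc a)) = P * (\<beta> + Suc a)" "P > 0" "Q > 0"
    unfolding P_def Q_def using \<beta>(1)
    by (auto intro!: pochhammer_pos pochhammer_rec pochhammer_Suc simp del: of_nat_Suc)
  have "((\<lambda>x. (1 - x ^ k) ^ a * x powr g - (1 - x ^ k) ^ a * x powr (g + real k)) has_integral
      (fact a / (real k * P) - fact a / (real k * Q))) {0..1}"
    using has_integral_diff[OF Suc.IH[of g] Suc.IH[of "g + real k"]] Suc.prems
    unfolding \<beta>(2) \<beta>_def[symmetric] P_def Q_def by simp
  moreover have "(1 - x ^ k) ^ a * x powr g - (1 - x ^ k) ^ a * x powr (g + real k) = (1 - x ^ k) ^ Suc a * x powr g"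
    if "x \<in> {0..1}" for x
    using that assms(1) by (cases "x = 0") (auto simp: powr_add powr_realpow algebra_simps)
  ultimately have "((\<lambda>x. (1 - x ^ k) ^ Suc a * x powr g) has_integral
      (fact a / (real k * P) - fact a / (real k * Q))) {0..1}"
    by (rule has_integral_eq[rotated]) auto
  moreover have "fact a / (real k * P) - fact a / (real k * Q) = fact (Suc a) / (real k * (\<beta> * Q))"
  proof -
    have "P = \<beta> * Q / (\<beta> + Suc a)" using PQ \<beta>(1) by (simp add: field_simps)
    then have "fact a / (real k * P) = fact a * (\<beta> + Suc a) / (real k * (\<beta> * Q))"
      by simp
    moreover have "fact a / (real k * Q) = fact a * \<beta> / (real k * (\<beta> * Q))"
      using \<beta>(1) by simp
    moreover have "fact a * (\<beta> + Suc a) - fact a * \<beta> = fact (Suc a)"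
      by (simp add: algebra_simps)
    ultimately show ?thesis
      by (simp only: diff_divide_distrib[symmetric])
  qed
  ultimately show ?case unfolding PQ(1) \<beta>_def[symmetric] by simp
qed

text \<open>Newton's binomial series: \<open>(-1)^n\<close> times the generalized binomial
  coefficient of \<open>- \<tau>\<close> is \<open>pochhammer \<tau> n / fact n\<close>.\<close>

lemma pochhammer_sums:
  fixes x \<tau> :: real
  assumes "0 \<le> x" "x < 1"
  shows "(\<lambda>a. pochhammer \<tau> a / fact a * x ^ a) sums (1 - x) powr (- \<tau>)"
proof -
  have "(\<lambda>n. ((- \<tau>) gchoose n) * (- x) ^ n) sums (1 + - x) powr (- \<tau>)"
    using assms by (intro gen_binomial_real) auto
  moreover have "((- \<tau>) gchoose n) * (- x) ^ n = pochhammer \<tau> n / fact n * x ^ n" for n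
  proof -
    have "((- \<tau>) gchoose n) * (- x) ^ n = ((-1) ^ n * (-1) ^ n) * (pochhammer \<tau> n / fact n * x ^ n)"
      unfolding gbinomial_pochhammer power_minus[of x n] minus_minus by (simp only: mult_ac times_divide_eq_right times_divide_eq_left)
    moreover have "(-1) ^ n * (-1) ^ n = (1::real)"
      by (simp flip: power_mult_distrib)
    ultimately show ?thesis by simp
  qed
  ultimately show ?thesis by simp
qed

text \<open>The common shape of the reciprocal squared norms for both measures.
  \<open>\<tau>\<close> and \<open>k\<close> become the exponents of the growth of the kernel;
  \<open>u\<close> is compared with the coefficients of \<open>(1 - t)^(-k)\<close>.\<close>

locale kernel_weights =
  fixes m :: nat and \<tau> :: real and k :: nat and u :: "nat \<Rightarrow> real" and c1 c2 :: real
    and e :: "nat \<times> nat \<Rightarrow> real"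
  assumes m1: "m \<ge> 1" and \<tau>: "\<tau> > 0" and k: "k \<ge> 1" and c: "0 < c1" "c1 \<le> c2"
    and u: "\<And>b. c1 * (pochhammer (real k) b / fact b) \<le> u b" "\<And>b. u b \<le> c2 * (pochhammer (real k) b / fact b)"
    and e: "\<And>a b. e (a, b) = u b * (pochhammer (\<tau> + real b / real m) a / fact a)"
begin

lemma u_pos: "u b > 0"
proof -
  have "0 < c1 * (pochhammer (real k) b / fact b)"
    using c k by (intro mult_pos_pos divide_pos_pos pochhammer_pos) auto
  then show ?thesis using u(1)[of b] by linarith
qed

lemma e_pos: "e i > 0"
proof (cases i)
  case (Pair a b)
  have "\<tau> + real b / real m > 0" using \<tau> by (simp add: add_pos_nonneg)
  then show ?thesis unfolding Pair e
    by (intro mult_pos_pos u_pos divide_pos_pos pochhammer_pos) auto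
qed

text \<open>The slice of the egg over a fixed z is a disc in w; this is the squared modulus of w
  relative to the squared radius of that disc.\<close>

definition ratio :: "complex \<times> complex \<Rightarrow> real" where
  "ratio p = (cmod (snd p))\<^sup>2 * (1 - (cmod (fst p))\<^sup>2) powr (- (1 / real m))"

definition growth :: "complex \<times> complex \<Rightarrow> real" where
  "growth p = (1 - (cmod (fst p))\<^sup>2) powr (- \<tau>) * (1 - ratio p) powr (- real k)"

lemma ratio_power:
  assumes "(cmod (fst p))\<^sup>2 < 1"
  shows "ratio p ^ m = cmod (snd p) ^ (2 * m) / (1 - (cmod (fst p))\<^sup>2)"
proof -
  have "((1 - (cmod (fst p))\<^sup>2) powr (- (1 / real m))) ^ m = (1 - (cmod (fst p))\<^sup>2) powr (- 1)"
    using assms m1 by (simp add: powr_power)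
  then show ?thesis using assms
    by (simp add: ratio_def power_mult_distrib powr_minus power_mult divide_inverse)
qed

lemma egg_fst_less: "p \<in> egg m \<Longrightarrow> (cmod (fst p))\<^sup>2 < 1"
proof -
  assume "p \<in> egg m"
  then have "(cmod (fst p))\<^sup>2 + cmod (snd p) ^ (2 * m) < 1" by (auto simp: egg_def)
  then show ?thesis using zero_le_power[OF norm_ge_zero[of "snd p"], of "2 * m"] by linarith
qed

lemma ratio_nonneg: "0 \<le> ratio p"
  by (simp add: ratio_def)

lemma ratio_less_1:
  assumes "p \<in> egg m"
  shows "ratio p < 1"
proof (rule ccontr)
  assume "\<not> ratio p < 1"
  then have "ratio p ^ m \<ge> 1" by simp
  moreover have "(cmod (fst p))\<^sup>2 + cmod (snd p) ^ (2 * m) < 1"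
    using assms by (auto simp: egg_def)
  ultimately show False
    using ratio_power[OF egg_fst_less[OF assms]] egg_fst_less[OF assms] by (simp add: field_simps)
qed

lemma growth_pos: "p \<in> egg m \<Longrightarrow> growth p > 0"
  using ratio_less_1[of p] egg_fst_less[of p] by (simp add: growth_def)

text \<open>For fixed b the sum over a is a binomial series in \<open>|z|^2\<close> with value
  \<open>X^(-\<tau> - b/m)\<close>. The part \<open>X^(-b/m)\<close> turns \<open>|w|^(2 b)\<close>
  into \<open>t^b\<close>, so that \<open>X^(-\<tau>)\<close> is common to all b.\<close>

lemma diag_has_sum:
  assumes p: "p \<in> egg m"
  obtains G where "((\<lambda>i. e i * (cmod (mon i p))\<^sup>2) has_sum G) UNIV" "c1 * growth p \<le> G" "G \<le> c2 * growth p"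
proof -
  define X t where "X = 1 - (cmod (fst p))\<^sup>2" and "t = ratio p"
  have X: "0 < X" "X \<le> 1" using egg_fst_less[OF p] by (auto simp: X_def)
  have t: "0 \<le> t" "t < 1" using ratio_nonneg ratio_less_1[OF p] by (auto simp: t_def)
  define y where "y = (cmod (snd p))\<^sup>2"
  define v where "v b = X powr (- \<tau>) * (u b * t ^ b)" for b
  \<comment> \<open>The pairs are swapped so that the inner sum runs over the exponent of z.\<close>
  let ?h = "\<lambda>(b, a). e (a, b) * (cmod (mon (a, b) p))\<^sup>2"
  have inner: "((\<lambda>a. ?h (b, a)) has_sum v b) UNIV" for b
  proof (rule norm_summable_imp_has_sum)
    have pp: "\<tau> + real b / real m > 0" using \<tau> by (simp add: add_pos_nonneg)
    have tb: "t ^ b = y ^ b * X powr (- (real b / real m))"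
      using X(1) by (simp add: t_def ratio_def y_def X_def power_mult_distrib powr_power)
    have "(\<lambda>a. u b * y ^ b * (pochhammer (\<tau> + real b / real m) a / fact a * (1 - X) ^ a)) sums
        (u b * y ^ b * (1 - (1 - X)) powr (- (\<tau> + real b / real m)))"
      using X by (intro sums_mult pochhammer_sums) auto
    moreover have "u b * y ^ b * (1 - (1 - X)) powr (- (\<tau> + real b / real m)) = v b"
      using X(1) by (simp add: v_def tb powr_add powr_diff powr_minus field_simps)
    moreover have "(\<lambda>a. u b * y ^ b * (pochhammer (\<tau> + real b / real m) a / fact a * (1 - X) ^ a)) = (\<lambda>a. ?h (b, a))"
      by (simp add: fun_eq_iff e norm_mon X_def y_def power_mult_distrib mult_ac flip: power_mult)
    ultimately show s: "(\<lambda>a. ?h (b, a)) sums v b" by simp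
    show "summable (\<lambda>a. norm (?h (b, a)))"
      using sums_summable[OF s] e_pos by (simp add: abs_mult abs_of_pos)
  qed
  let ?p = "\<lambda>b. pochhammer (real k) b / fact b * t ^ b"
  have pk: "(\<lambda>b. ?p b) sums (1 - t) powr (- real k)"
    by (rule pochhammer_sums[OF t])
  have vle: "v b \<le> c2 * X powr (- \<tau>) * ?p b" for b
    using mult_right_mono[OF u(2)[of b], of "X powr (- \<tau>) * t ^ b"] t by (simp add: v_def mult_ac)
  have vge: "c1 * X powr (- \<tau>) * ?p b \<le> v b" for b
    using mult_right_mono[OF u(1)[of b], of "X powr (- \<tau>) * t ^ b"] t by (simp add: v_def mult_ac)
  have v0: "0 \<le> v b" for b using u_pos[of b] t by (simp add: v_def)
  have sv: "summable v"
    by (rule summable_comparison_test[OF _ summable_mult[OF sums_summable[OF pk], of "c2 * X powr (- \<tau>)"]])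
       (use vle v0 in auto)
  have hv: "(v has_sum suminf v) UNIV"
    using sv v0 by (intro norm_summable_imp_has_sum) auto
  \<comment> \<open>Positivity of the terms turns convergence of the iterated sum into summability
    over pairs.\<close>
  have "?h summable_on (UNIV \<times> UNIV)"
  proof (rule summable_on_SigmaI[OF inner has_sum_imp_summable[OF hv]])
    show "0 \<le> ?h (b, a)" for b a using e_pos[of "(a, b)"] by simp
  qed
  then have "(?h has_sum suminf v) (UNIV \<times> UNIV)"
    by (rule has_sum_SigmaI[OF inner hv])
  then have "((\<lambda>i. (\<lambda>i. e i * (cmod (mon i p))\<^sup>2) (prod.swap i)) has_sum suminf v) UNIV"
    by (simp add: case_prod_unfold prod.swap_def)
  then have "((\<lambda>i. e i * (cmod (mon i p))\<^sup>2) has_sum suminf v) UNIV"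
    by (subst (asm) has_sum_reindex_bij_betw[OF bij_swap])
  moreover have "c1 * growth p \<le> suminf v"
  proof -
    have s: "(\<lambda>b. c1 * X powr (- \<tau>) * ?p b) sums (c1 * X powr (- \<tau>) * (1 - t) powr (- real k))"
      by (intro sums_mult pk)
    show ?thesis
      using suminf_le[OF vge sums_summable[OF s] sv] sums_unique[OF s] by (simp add: growth_def X_def t_def mult_ac)
  qed
  moreover have "suminf v \<le> c2 * growth p"
  proof -
    have s: "(\<lambda>b. c2 * X powr (- \<tau>) * ?p b) sums (c2 * X powr (- \<tau>) * (1 - t) powr (- real k))"
      by (intro sums_mult pk)
    show ?thesis
      using suminf_le[OF vle sv sums_summable[OF s]] sums_unique[OF s] by (simp add: growth_def X_def t_def mult_ac)
  qed
  ultimately show ?thesis by (rule that)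
qed

text \<open>Dilation by q keeps both bases away from 0: \<open>1 - q^2 |z|^2 \<ge> 1 - q^2\<close>,
  and the m-th power of the ratio at the dilated point is \<open>q^(2 m)\<close> times a quotient
  that is at most 1.\<close>

lemma growth_scaled_le:
  assumes q: "0 < q" "q < 1" and p: "p \<in> closed_egg m"
  shows "growth (q *\<^sub>R p) \<le> (1 - q\<^sup>2) powr (- \<tau>) * (1 - q\<^sup>2) powr (- real k)"
proof -
  have qp: "q *\<^sub>R p \<in> egg m" using q by (intro scale_closed_egg m1 p) auto
  have q2: "0 < q\<^sup>2" "q\<^sup>2 < 1" using q by (auto simp: abs_square_less_1)
  have cp: "(cmod (fst p))\<^sup>2 + cmod (snd p) ^ (2 * m) \<le> 1" using p by (auto simp: closed_egg_def)
  have z: "(cmod (fst p))\<^sup>2 \<le> 1"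
    using cp zero_le_power[OF norm_ge_zero[of "snd p"], of "2 * m"] by linarith
  have zq: "q\<^sup>2 * (cmod (fst p))\<^sup>2 \<le> q\<^sup>2" using mult_left_mono[OF z, of "q\<^sup>2"] by simp
  have zq': "q\<^sup>2 * (cmod (fst p))\<^sup>2 \<le> (cmod (fst p))\<^sup>2"
    using mult_right_mono[of "q\<^sup>2" 1 "(cmod (fst p))\<^sup>2"] q2 by simp
  have X: "1 - q\<^sup>2 \<le> 1 - (cmod (fst (q *\<^sub>R p)))\<^sup>2"
    using zq q by (simp add: power_mult_distrib)
  have "ratio (q *\<^sub>R p) ^ m = (q\<^sup>2) ^ m * (cmod (snd p) ^ (2 * m) / (1 - (cmod (fst (q *\<^sub>R p)))\<^sup>2))"
    using ratio_power[OF egg_fst_less[OF qp]] q by (simp add: power_mult_distrib power_mult)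
  also have "\<dots> \<le> (q\<^sup>2) ^ m * 1"
    using cp zq' egg_fst_less[OF qp] q by (intro mult_left_mono) (auto simp: power_mult_distrib field_simps)
  finally have "ratio (q *\<^sub>R p) \<le> q\<^sup>2"
    using m1 q2 ratio_nonneg[of "q *\<^sub>R p"] by (simp add: power_mono_iff)
  then have t: "1 - q\<^sup>2 \<le> 1 - ratio (q *\<^sub>R p)" by simp
  show ?thesis unfolding growth_def
    using X t q2 \<tau> by (intro mult_mono powr_mono2') auto
qed

sublocale diag_coeffs m e
proof
  show "m \<ge> 1" by (rule m1)
  show "0 < e i" for i by (rule e_pos)
  fix q :: real assume q: "0 < q" "q < 1"
  show "\<exists>C. \<forall>i. \<forall>p\<in>closed_egg m. e i * (cmod (mon i (q *\<^sub>R p)))\<^sup>2 \<le> C"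
  proof (intro exI allI ballI)
    fix i p assume p: "p \<in> closed_egg m"
    have "q *\<^sub>R p \<in> egg m" using q by (intro scale_closed_egg m1 p) auto
    then obtain G where G: "((\<lambda>i. e i * (cmod (mon i (q *\<^sub>R p)))\<^sup>2) has_sum G) UNIV" "G \<le> c2 * growth (q *\<^sub>R p)"
      using diag_has_sum by blast
    have nn: "0 \<le> e j * (cmod (mon j (q *\<^sub>R p)))\<^sup>2" for j
      using e_pos[of j] by simp
    \<comment> \<open>A single nonnegative term is at most the sum, so the growth bound serves all
      indices at once.\<close>
    have "((\<lambda>i. e i * (cmod (mon i (q *\<^sub>R p)))\<^sup>2) has_sum (e i * (cmod (mon i (q *\<^sub>R p)))\<^sup>2)) {i}"
      by (rule has_sum_finiteI) auto
    from has_sum_mono_neutral[OF this G(1)] nn have "e i * (cmod (mon i (q *\<^sub>R p)))\<^sup>2 \<le> G"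
      by blast
    also note G(2)
    also have "c2 * growth (q *\<^sub>R p) \<le> c2 * ((1 - q\<^sup>2) powr (- \<tau>) * (1 - q\<^sup>2) powr (- real k))"
      using c by (intro mult_left_mono growth_scaled_le q p) auto
    finally show "e i * (cmod (mon i (q *\<^sub>R p)))\<^sup>2 \<le> c2 * ((1 - q\<^sup>2) powr (- \<tau>) * (1 - q\<^sup>2) powr (- real k))" .
  qed
qed

end

section \<open>The Fefferman measure\<close>


lemma lborel_integral_product:
  fixes f :: "'a::euclidean_space \<Rightarrow> complex" and g :: "'b::euclidean_space \<Rightarrow> complex"
  assumes f: "integrable lborel f" and g: "integrable lborel g"
  shows "integrable lborel (\<lambda>p. f (fst p) * g (snd p))"
    "(\<integral>p. f (fst p) * g (snd p) \<partial>lborel) = (\<integral>x. f x \<partial>lborel) * (\<integral>y. g y \<partial>lborel)"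
proof -
  have "integrable (lborel \<Otimes>\<^sub>M lborel) (\<lambda>p. f (fst p) * g (snd p))"
  proof (rule lborel_pair.Fubini_integrable)
    show "(\<lambda>p. f (fst p) * g (snd p)) \<in> borel_measurable (lborel \<Otimes>\<^sub>M lborel)"
      using borel_measurable_integrable[OF f] borel_measurable_integrable[OF g] by measurable
    show "integrable lborel (\<lambda>x. \<integral>y. norm (f (fst (x, y)) * g (snd (x, y))) \<partial>lborel)"
      using f by (simp add: norm_mult)
    show "AE x in lborel. integrable lborel (\<lambda>y. f (fst (x, y)) * g (snd (x, y)))"
      using g by simp
  qed
  then show "integrable lborel (\<lambda>p. f (fst p) * g (snd p))"
    and "(\<integral>p. f (fst p) * g (snd p) \<partial>lborel) = (\<integral>x. f x \<partial>lborel) * (\<integral>y. g y \<partial>lborel)"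
    using lborel_pair.integral_fst'[of "\<lambda>p. f (fst p) * g (snd p)"] by (simp_all add: lborel_prod)
qed

lemma integrable_Ioo_bounded:
  fixes f :: "real \<Rightarrow> complex"
  assumes [measurable]: "f \<in> borel_measurable borel" and "\<And>x. x \<in> {a<..<b} \<Longrightarrow> cmod (f x) \<le> B"
  shows "integrable lborel (\<lambda>x. indicator {a<..<b} x * f x)"
proof (rule Bochner_Integration.integrable_bound[of _ "\<lambda>x. indicator {a<..<b} x * B"])
  show "integrable lborel (\<lambda>x. indicator {a<..<b} x * B)"
    by (cases "a \<le> b") auto
  show "AE x in lborel. norm (indicator {a<..<b} x * f x) \<le> norm (indicator {a<..<b} x * B)"
  proof (rule AE_I2)
    fix x
    show "norm (indicator {a<..<b} x * f x) \<le> norm (indicator {a<..<b} x * B)"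
      using assms(2)[of x] by (auto split: split_indicator)
  qed
qed simp

lemma integral_cis:
  fixes n :: int
  shows "(\<integral>s. indicator {0<..<2 * pi} s * cis (of_int n * s) \<partial>lborel) = (if n = 0 then 2 * pi else 0)"
proof -
  have int: "set_integrable lborel {0<..<2 * pi} (\<lambda>s. cis (of_int n * s))"
  proof -
    have "(\<lambda>s. cis (of_int n * s)) \<in> borel_measurable borel"
      by (intro borel_measurable_continuous_onI continuous_intros)
    from integrable_Ioo_bounded[OF this, of 0 "2 * pi" 1] show ?thesis
      by (simp add: set_integrable_def scaleR_conv_of_real of_real_indicator)
  qed
  have "(\<integral>s. indicator {0<..<2 * pi} s * cis (of_int n * s) \<partial>lborel) = (LINT s:{0<..<2 * pi}|lborel. cis (of_int n * s))"
    by (simp add: set_lebesgue_integral_def scaleR_conv_of_real of_real_indicator)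
  also have "\<dots> = integral {0<..<2 * pi} (\<lambda>s. cis (of_int n * s))"
    by (rule set_borel_integral_eq_integral[OF int])
  also have "\<dots> = integral {0..2 * pi} (\<lambda>s. cis (of_int n * s))"
    by (rule integral_open_interval_real[symmetric])
  also have "\<dots> = (if n = 0 then 2 * pi else 0)"
  proof (cases "n = 0")
    case False
    have "((\<lambda>s. cis (of_int n * s)) has_integral (cis (of_int n * (2 * pi)) / (\<i> * of_int n) - cis (of_int n * 0) / (\<i> * of_int n))) {0..2 * pi}"
    proof (rule fundamental_theorem_of_calculus)
      show "((\<lambda>s. cis (of_int n * s) / (\<i> * of_int n)) has_vector_derivative cis (of_int n * x)) (at x within {0..2 * pi})" for x
        unfolding has_vector_derivative_def using False
        by (auto intro!: derivative_eq_intros simp: fun_eq_iff field_simps scaleR_conv_of_real)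
    qed simp
    moreover have "cis (of_int n * (2 * pi)) = 1"
      using cis_multiple_2pi[of "of_int n"] by (simp add: mult_ac)
    ultimately show ?thesis using False by (simp add: integral_unique)
  qed (simp add: scaleR_conv_of_real)
  finally show ?thesis .
qed

text \<open>The factor r of the area element times the cube root of the Fefferman determinant: what
  remains of area element times weight after \<open>|d\<rho>|\<close> cancels.\<close>

definition chart_weight :: "nat \<Rightarrow> real \<Rightarrow> real" where
  "chart_weight m r = r * root 3 ((real m)\<^sup>2 * r ^ (2 * m - 2))"

lemma bd_chart_has_derivative:
  fixes r s t :: real
  assumes m: "m \<ge> 1" and r: "0 < r" "r < 1"
  defines "R \<equiv> sqrt (1 - r ^ (2 * m))"
  shows "(bd_chart m has_derivative (\<lambda>(a, b, c).
      (of_real (- (real m * r ^ (2 * m - 1) / R) * a) * cis s + of_real (R * b) * (\<i> * cis s),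
       of_real a * cis t + of_real (r * c) * (\<i> * cis t)))) (at (r, s, t))"
proof -
  have pos: "0 < 1 - r ^ (2 * m)" using r m by (simp add: power_less_one_iff)
  then have R: "R > 0" by (simp add: R_def)
  have 1: "((\<lambda>u. sqrt (1 - fst u ^ (2 * m))) has_derivative (\<lambda>h. - (real m * r ^ (2 * m - 1) / R) * fst h)) (at (r, s, t))"
    using pos by (auto intro!: derivative_eq_intros simp: fun_eq_iff R_def field_simps)
  have 2: "((\<lambda>u::real \<times> real \<times> real. cis (fst (snd u))) has_derivative (\<lambda>h. fst (snd h) *\<^sub>R (\<i> * cis s))) (at (r, s, t))"
    by (auto intro!: derivative_eq_intros)
  have 3: "((\<lambda>u::real \<times> real \<times> real. cis (snd (snd u))) has_derivative (\<lambda>h. snd (snd h) *\<^sub>R (\<i> * cis t))) (at (r, s, t))"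
    by (auto intro!: derivative_eq_intros)
  have 4: "(fst has_derivative fst) (at (r, s, t))"
    by (rule derivative_eq_intros refl)+
  have "((\<lambda>u. (complex_of_real (sqrt (1 - fst u ^ (2 * m))) * cis (fst (snd u)), complex_of_real (fst u) * cis (snd (snd u))))
    has_derivative (\<lambda>h. (of_real (- (real m * r ^ (2 * m - 1) / R) * fst h) * cis s + of_real (R * fst (snd h)) * (\<i> * cis s),
       of_real (fst h) * cis t + of_real (r * snd (snd h)) * (\<i> * cis t)))) (at (r, s, t))"
    by (rule has_derivative_eq_rhs[OF has_derivative_Pair[OF
          has_derivative_mult[OF has_derivative_of_real[OF 1] 2] has_derivative_mult[OF has_derivative_of_real[OF 4] 3]]])
       (simp add: fun_eq_iff R_def scaleR_conv_of_real mult_ac)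
  then show ?thesis unfolding bd_chart_def case_prod_unfold .
qed

lemma area_element_bd_chart:
  fixes r s t :: real
  assumes m: "m \<ge> 1" and r: "0 < r" "r < 1"
  shows "area_element (bd_chart m) (r, s, t) = r * sqrt (1 - r ^ (2 * m) + (real m)\<^sup>2 * r ^ (4 * m - 2))"
proof -
  define R where "R = sqrt (1 - r ^ (2 * m))"
  define d where "d = real m * r ^ (2 * m - 1) / R"
  have pos: "0 < 1 - r ^ (2 * m)" using r m by (simp add: power_less_one_iff)
  then have R: "R > 0" "R\<^sup>2 = 1 - r ^ (2 * m)" by (auto simp: R_def)
  define D where "D = (\<lambda>(a, b, c).
      (of_real (- d * a) * cis s + of_real (R * b) * (\<i> * cis s),
       of_real a * cis t + of_real (r * c) * (\<i> * cis t)))"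
  define T :: "(complex \<times> complex) ^ 3" where "T = vector [D (1, 0, 0), D (0, 1, 0), D (0, 0, 1)]"
  have "frechet_derivative (bd_chart m) (at (r, s, t)) = D"
    using frechet_derivative_at[OF bd_chart_has_derivative[OF m r, of s t]]
    unfolding D_def d_def R_def by simp
  then have "area_element (bd_chart m) (r, s, t) =
      sqrt (det ((\<chi> i j. (vec_nth T i) \<bullet> (vec_nth T j)) :: real ^ 3 ^ 3))"
    by (simp add: area_element_def Let_def T_def)
  \<comment> \<open>The three tangent vectors are pairwise orthogonal, so the Gram determinant is
    the product of the squared lengths \<open>d^2 + 1\<close>, \<open>R^2\<close> and
    \<open>r^2\<close>.\<close>
  also have "det ((\<chi> i j. (vec_nth T i) \<bullet> (vec_nth T j)) :: real ^ 3 ^ 3) = (d\<^sup>2 + 1) * R\<^sup>2 * r\<^sup>2"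
  proof -
    have cs: "cos x * cos x + sin x * sin x = 1" for x :: real
      using sin_cos_squared_add3 .
    have "D (1, 0, 0) \<bullet> D (1, 0, 0) = d\<^sup>2 * (cos s * cos s + sin s * sin s) + (cos t * cos t + sin t * sin t)"
      by (simp add: D_def inner_complex_def algebra_simps power2_eq_square del: sin_cos_squared_add3)
    then have 11: "D (1, 0, 0) \<bullet> D (1, 0, 0) = d\<^sup>2 + 1" unfolding cs by simp
    have "D (0, 1, 0) \<bullet> D (0, 1, 0) = R\<^sup>2 * (cos s * cos s + sin s * sin s)"
      by (simp add: D_def inner_complex_def algebra_simps power2_eq_square del: sin_cos_squared_add3)
    then have 22: "D (0, 1, 0) \<bullet> D (0, 1, 0) = R\<^sup>2" unfolding cs by simp
    have "D (0, 0, 1) \<bullet> D (0, 0, 1) = r\<^sup>2 * (cos t * cos t + sin t * sin t)"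
      by (simp add: D_def inner_complex_def algebra_simps power2_eq_square del: sin_cos_squared_add3)
    then have 33: "D (0, 0, 1) \<bullet> D (0, 0, 1) = r\<^sup>2" unfolding cs by simp
    have 12: "D (1, 0, 0) \<bullet> D (0, 1, 0) = 0" "D (0, 1, 0) \<bullet> D (1, 0, 0) = 0"
      and 13: "D (1, 0, 0) \<bullet> D (0, 0, 1) = 0" "D (0, 0, 1) \<bullet> D (1, 0, 0) = 0"
      and 23: "D (0, 1, 0) \<bullet> D (0, 0, 1) = 0" "D (0, 0, 1) \<bullet> D (0, 1, 0) = 0"
      by (simp_all add: D_def inner_complex_def algebra_simps)
    show ?thesis by (simp add: det_3 T_def 11 22 33 12 13 23)
  qed
  also have "(d\<^sup>2 + 1) * R\<^sup>2 * r\<^sup>2 = r\<^sup>2 * (1 - r ^ (2 * m) + (real m)\<^sup>2 * r ^ (4 * m - 2))"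
  proof -
    have e: "4 * m - 2 = (2 * m - 1) * 2" using m by simp
    have "d\<^sup>2 * R\<^sup>2 = (real m)\<^sup>2 * r ^ (4 * m - 2)"
      using R(1) unfolding e by (simp add: d_def power_divide power_mult_distrib power_mult)
    moreover have "(d\<^sup>2 + 1) * R\<^sup>2 = d\<^sup>2 * R\<^sup>2 + R\<^sup>2" by (simp add: algebra_simps)
    ultimately have "(d\<^sup>2 + 1) * R\<^sup>2 = 1 - r ^ (2 * m) + (real m)\<^sup>2 * r ^ (4 * m - 2)"
      using R(2) by linarith
    then show ?thesis by (simp add: mult.commute)
  qed
  finally show ?thesis using r by (simp add: real_sqrt_mult)
qed

lemma bd_chart_in_frontier:
  assumes "m \<ge> 1" "u \<in> bd_params"
  shows "bd_chart m u \<in> frontier (egg m)"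
  using bd_chart_image[OF assms(1)] assms(2) by blast

lemma frontier_rho:
  assumes "m \<ge> 1" "p \<in> frontier (egg m)"
  shows "rho m p = 0"
  using assms frontier_egg by blast

text \<open>On the boundary \<open>|d\<rho>|^2 = 1 - r^(2 m) + m^2 r^(4 m - 2)\<close>, and the area
  element is r times the same root.\<close>

lemma chart_density:
  assumes m: "m \<ge> 1" and u: "(r, s, t) \<in> bd_params"
  shows "area_element (bd_chart m) (r, s, t) * fefferman_weight m (bd_chart m (r, s, t)) = chart_weight m r"
proof -
  have r: "0 < r" "r < 1" using u by (auto simp: bd_params_def)
  have pos: "0 < 1 - r ^ (2 * m)" using r m by (simp add: power_less_one_iff)
  define Q where "Q = sqrt (1 - r ^ (2 * m) + (real m)\<^sup>2 * r ^ (4 * m - 2))"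
  have "0 < 1 - r ^ (2 * m) + (real m)\<^sup>2 * r ^ (4 * m - 2)"
    using pos r by (intro add_pos_nonneg) auto
  then have Q: "Q > 0" by (simp add: Q_def)
  have "rho m (bd_chart m (r, s, t)) = 0"
    using frontier_rho[OF m bd_chart_in_frontier[OF m u]] .
  then have "fefferman_weight m (bd_chart m (r, s, t)) = root 3 ((real m)\<^sup>2 * r ^ (2 * m - 2)) / Q"
    using fefferman_weight_eq[OF m, of "fst (bd_chart m (r, s, t))" "snd (bd_chart m (r, s, t))"] r pos
    by (simp add: bd_chart_def norm_mult Q_def)
  then show ?thesis
    using Q unfolding area_element_bd_chart[OF m r] Q_def[symmetric] by (simp add: chart_weight_def)
qed

lemma bd_params_borel [measurable]: "bd_params \<in> sets borel"
  unfolding bd_params_def by (intro borel_open open_Times) auto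

lemma bd_chart_measurable:
  assumes m: "m \<ge> 1"
  shows "bd_chart m \<in> restrict_space lborel bd_params \<rightarrow>\<^sub>M restrict_space borel (frontier (egg m))"
proof (rule measurable_restrict_space2)
  have "bd_chart m \<in> borel_measurable borel"
    unfolding bd_chart_def case_prod_unfold
    by (intro borel_measurable_continuous_onI continuous_intros)
  then show "bd_chart m \<in> borel_measurable (restrict_space lborel bd_params)"
    by (intro measurable_restrict_space1) simp
qed (use bd_chart_in_frontier[OF m] in \<open>auto simp: space_restrict_space\<close>)

lemma fefferman_weight_measurable:
  assumes m: "m \<ge> 1"
  shows "fefferman_weight m \<in> borel_measurable (restrict_space borel (frontier (egg m)))"
proof -
  have "(\<lambda>p. root 3 ((real m)\<^sup>2 * cmod (snd p) ^ (2 * m - 2)) / sqrt ((cmod (fst p))\<^sup>2 + (real m)\<^sup>2 * cmod (snd p) ^ (4 * m - 2)))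
      \<in> borel_measurable (borel :: (complex \<times> complex) measure)"
    by (intro borel_measurable_divide borel_measurable_continuous_onI continuous_intros)
  then have "(\<lambda>p. root 3 ((real m)\<^sup>2 * cmod (snd p) ^ (2 * m - 2)) / sqrt ((cmod (fst p))\<^sup>2 + (real m)\<^sup>2 * cmod (snd p) ^ (4 * m - 2)))
      \<in> borel_measurable (restrict_space borel (frontier (egg m)))"
    by (rule measurable_restrict_space1)
  also have "?this \<longleftrightarrow> ?thesis"
    by (intro measurable_cong)
       (use fefferman_weight_eq[OF m] frontier_rho[OF m] in \<open>auto simp: space_restrict_space\<close>)
  finally show ?thesis .
qed

lemma chart_weight_measurable_restrict [measurable]:
  "(\<lambda>u. chart_weight m (fst u)) \<in> borel_measurable (restrict_space lborel bd_params)"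
  by (intro measurable_restrict_space1, simp, unfold chart_weight_def)
     (intro borel_measurable_continuous_onI continuous_intros)

text \<open>Moving the weight inside the push-forward makes both densities functions on the
  parameter box, where their product is known.\<close>

lemma sigma_F_eq:
  assumes m: "m \<ge> 1"
  shows "sigma_F m = distr (density (restrict_space lborel bd_params) (\<lambda>u. ennreal (chart_weight m (fst u))))
    (restrict_space borel (frontier (egg m))) (bd_chart m)"
proof -
  let ?L = "restrict_space lborel bd_params" and ?N = "restrict_space borel (frontier (egg m))"
  note [measurable] = bd_chart_measurable[OF m] fefferman_weight_measurable[OF m]
  have sp: "space ?L = bd_params" by (simp add: space_restrict_space)
  have [measurable]: "area_element (bd_chart m) \<in> borel_measurable ?L"
  proof -
    have "(\<lambda>u. fst u * sqrt (1 - fst u ^ (2 * m) + (real m)\<^sup>2 * fst u ^ (4 * m - 2))) \<in> borel_measurable ?L"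
      by (intro measurable_restrict_space1, simp)
         (intro borel_measurable_continuous_onI continuous_intros)
    also have "?this \<longleftrightarrow> ?thesis"
    proof (rule measurable_cong)
      fix u assume "u \<in> space ?L"
      then obtain r s t where u: "u = (r, s, t)" "(r, s, t) \<in> bd_params" unfolding sp by (metis prod.exhaust)
      then have "0 < r" "r < 1" by (auto simp: bd_params_def)
      then show "fst u * sqrt (1 - fst u ^ (2 * m) + (real m)\<^sup>2 * fst u ^ (4 * m - 2)) = area_element (bd_chart m) u"
        by (simp add: u(1) area_element_bd_chart[OF m])
    qed
    finally show ?thesis .
  qed
  have "sigma_F m = distr (density (density ?L (\<lambda>u. ennreal (area_element (bd_chart m) u)))
      (\<lambda>u. ennreal (fefferman_weight m (bd_chart m u)))) ?N (bd_chart m)"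
    unfolding sigma_F_def sigma_E_def surface_measure_def
    by (rule density_distr) measurable
  also have "density (density ?L (\<lambda>u. ennreal (area_element (bd_chart m) u))) (\<lambda>u. ennreal (fefferman_weight m (bd_chart m u)))
     = density ?L (\<lambda>u. ennreal (area_element (bd_chart m) u) * ennreal (fefferman_weight m (bd_chart m u)))"
    by (rule density_density_eq) measurable
  also have "\<dots> = density ?L (\<lambda>u. ennreal (chart_weight m (fst u)))"
  proof (rule density_cong)
    show "AE u in ?L. ennreal (area_element (bd_chart m) u) * ennreal (fefferman_weight m (bd_chart m u))
        = ennreal (chart_weight m (fst u))"
    proof (rule AE_I2)
      fix u assume "u \<in> space ?L"
      then obtain r s t where u: "u = (r, s, t)" "(r, s, t) \<in> bd_params" unfolding sp by (metis prod.exhaust)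
      have r: "0 < r" "r < 1" using u by (auto simp: bd_params_def)
      \<comment> \<open>\<open>ennreal\<close> respects the product because the area element is
        nonnegative.\<close>
      have "0 \<le> 1 - r ^ (2 * m) + (real m)\<^sup>2 * r ^ (4 * m - 2)"
        using r m by (intro add_nonneg_nonneg) (auto simp: power_le_one)
      then have "0 \<le> area_element (bd_chart m) u"
        using r by (simp add: u(1) area_element_bd_chart[OF m r])
      then show "ennreal (area_element (bd_chart m) u) * ennreal (fefferman_weight m (bd_chart m u))
        = ennreal (chart_weight m (fst u))"
        using chart_density[OF m u(2)] by (simp add: u(1) flip: ennreal_mult')
    qed
  qed measurable
  finally show ?thesis .
qed

section \<open>Finiteness and moments of the boundary measure\<close>

lemma space_sigma_F: "space (sigma_F m) = frontier (egg m)"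
  and sets_sigma_F: "sets (sigma_F m) = sets (restrict_space borel (frontier (egg m)))"
  by (simp_all add: sigma_F_def sigma_E_def surface_measure_def space_restrict_space)

lemma chart_weight_bounds:
  assumes "r \<in> {0<..<1}"
  shows "0 \<le> chart_weight m r" "chart_weight m r \<le> root 3 ((real m)\<^sup>2)"
proof -
  have r: "0 < r" "r < 1" using assms by auto
  have "r ^ (2 * m - 2) \<le> 1" using r by (simp add: power_le_one)
  then have "(real m)\<^sup>2 * r ^ (2 * m - 2) \<le> (real m)\<^sup>2 * 1" by (intro mult_left_mono) auto
  then have le: "root 3 ((real m)\<^sup>2 * r ^ (2 * m - 2)) \<le> root 3 ((real m)\<^sup>2)" by simp
  show "0 \<le> chart_weight m r"
    using r by (auto simp: chart_weight_def)
  have "r * root 3 ((real m)\<^sup>2 * r ^ (2 * m - 2)) \<le> 1 * root 3 ((real m)\<^sup>2)"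
    using r le by (intro mult_mono) auto
  then show "chart_weight m r \<le> root 3 ((real m)\<^sup>2)" by (simp add: chart_weight_def)
qed

lemma finite_sigma_F:
  assumes m: "m \<ge> 1"
  shows "finite_measure (sigma_F m)"
proof
  let ?L = "restrict_space lborel bd_params" and ?N = "restrict_space borel (frontier (egg m))"
  note [measurable] = bd_chart_measurable[OF m]
  define C where "C = root 3 ((real m)\<^sup>2)"
  have "emeasure (sigma_F m) (space (sigma_F m)) = (\<integral>\<^sup>+u. ennreal (chart_weight m (fst u)) \<partial>?L)"
  proof -
    have "emeasure (sigma_F m) (space (sigma_F m)) = (\<integral>\<^sup>+x. 1 \<partial>sigma_F m)" by simp
    also have "\<dots> = (\<integral>\<^sup>+u. 1 \<partial>density ?L (\<lambda>u. ennreal (chart_weight m (fst u))))"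
      unfolding sigma_F_eq[OF m] by (rule nn_integral_distr) measurable
    also have "\<dots> = (\<integral>\<^sup>+u. ennreal (chart_weight m (fst u)) * 1 \<partial>?L)"
      by (rule nn_integral_density) measurable
    finally show ?thesis by simp
  qed
  also have "\<dots> \<le> (\<integral>\<^sup>+u. ennreal C \<partial>?L)"
    by (intro nn_integral_mono ennreal_leI)
       (auto simp: space_restrict_space bd_params_def C_def intro!: chart_weight_bounds)
  also have "\<dots> = ennreal C * emeasure lborel bd_params"
    by (simp add: emeasure_restrict_space space_restrict_space)
  also have "\<dots> < \<infinity>"
  proof -
    have "bounded bd_params" unfolding bd_params_def
      by (intro bounded_Times bounded_subset[OF bounded_closed_interval greaterThanLessThan_subseteq_atLeastAtMost_iff[THEN iffD2]]) auto
    then show ?thesis using emeasure_bounded_finite[of bd_params] by (simp add: ennreal_mult_less_top)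
  qed
  finally show "emeasure (sigma_F m) (space (sigma_F m)) \<noteq> \<infinity>" by simp
qed

lemma integral_sigma_F:
  assumes m: "m \<ge> 1" and g: "g \<in> borel_measurable (restrict_space borel (frontier (egg m)))"
  shows "(\<integral>x. g x \<partial>sigma_F m) =
    (\<integral>u. indicator bd_params u *\<^sub>R (chart_weight m (fst u) *\<^sub>R (g (bd_chart m u) :: complex)) \<partial>lborel)"
proof -
  let ?L = "restrict_space lborel bd_params"
  note [measurable] = bd_chart_measurable[OF m] g
  have "(\<integral>x. g x \<partial>sigma_F m) = (\<integral>u. g (bd_chart m u) \<partial>density ?L (\<lambda>u. ennreal (chart_weight m (fst u))))"
    unfolding sigma_F_eq[OF m] by (rule integral_distr) measurable
  also have "\<dots> = (\<integral>u. chart_weight m (fst u) *\<^sub>R g (bd_chart m u) \<partial>?L)"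
  proof (rule integral_density)
    show "AE u in ?L. 0 \<le> chart_weight m (fst u)"
      by (rule AE_I2) (auto simp: space_restrict_space bd_params_def intro!: chart_weight_bounds)
  qed measurable
  also have "\<dots> = (\<integral>u. indicator bd_params u *\<^sub>R (chart_weight m (fst u) *\<^sub>R g (bd_chart m u)) \<partial>lborel)"
    by (rule integral_restrict_space) simp
  finally show ?thesis .
qed

definition radial_moment :: "nat \<Rightarrow> nat \<Rightarrow> nat \<Rightarrow> real \<Rightarrow> real" where
  "radial_moment m k l r = chart_weight m r * (sqrt (1 - r ^ (2 * m)) ^ k * r ^ l)"

lemma chart_mon:
  "chart_weight m r *\<^sub>R (mon i (bd_chart m (r, s, t)) * cnj (mon j (bd_chart m (r, s, t)))) =
    of_real (radial_moment m (fst i + fst j) (snd i + snd j) r) *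
      (cis (of_int (int (fst i) - int (fst j)) * s) * cis (of_int (int (snd i) - int (snd j)) * t))"
proof -
  have c: "cis (of_int (int a - int b) * x) = cis x ^ a * cnj (cis x) ^ b" for a b x
    by (simp add: Complex.DeMoivre cis_cnj cis_mult algebra_simps)
  show ?thesis
    unfolding c by (simp add: mon_def bd_chart_def radial_moment_def power_mult_distrib power_add scaleR_conv_of_real mult_ac)
qed

text \<open>In the chart the integrand is a function of r times two characters, and the angular
  integrals vanish unless both exponents agree.\<close>

lemma integral_mon_sigma_F:
  assumes m: "m \<ge> 1"
  shows "(\<integral>x. mon i x * cnj (mon j x) \<partial>sigma_F m) =
    (if i = j then of_real (4 * pi\<^sup>2 * (LINT r:{0<..<1}|lborel. radial_moment m (2 * fst i) (2 * snd i) r)) else 0)"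
proof -
  define A where "A = radial_moment m (fst i + fst j) (snd i + snd j)"
  define p q where "p = int (fst i) - int (fst j)" and "q = int (snd i) - int (snd j)"
  have meas: "(\<lambda>x. complex_of_real (A x)) \<in> borel_measurable borel"
    unfolding A_def radial_moment_def chart_weight_def
    by (intro borel_measurable_continuous_onI continuous_intros)
  have iA: "integrable lborel (\<lambda>r. indicator {0<..<1} r * complex_of_real (A r))"
  proof (rule integrable_Ioo_bounded[OF meas])
    fix r :: real assume r: "r \<in> {0<..<1}"
    have "sqrt (1 - r ^ (2 * m)) ^ (fst i + fst j) * r ^ (snd i + snd j) \<le> 1"
      using r by (intro mult_le_one power_le_one) (auto simp: power_le_one)
    moreover have "0 \<le> sqrt (1 - r ^ (2 * m)) ^ (fst i + fst j) * r ^ (snd i + snd j)"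
      using r by (auto simp: power_le_one)
    ultimately have "\<bar>A r\<bar> \<le> root 3 ((real m)\<^sup>2) * 1"
      unfolding A_def radial_moment_def abs_mult[of "chart_weight m r"]
      using chart_weight_bounds[OF r, of m] by (intro mult_mono) auto
    then show "cmod (complex_of_real (A r)) \<le> root 3 ((real m)\<^sup>2)" by simp
  qed
  have IA: "(\<integral>r. indicator {0<..<1} r * complex_of_real (A r) \<partial>lborel) = of_real (LINT r:{0<..<1}|lborel. A r)"
  proof -
    have "(\<integral>r. indicator {0<..<1} r * complex_of_real (A r) \<partial>lborel) =
        (\<integral>r. complex_of_real (indicator {0<..<1} r * A r) \<partial>lborel)"
      by (simp only: of_real_mult of_real_indicator)
    also have "\<dots> = of_real (\<integral>r. indicator {0<..<1} r * A r \<partial>lborel)"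
      by (rule integral_complex_of_real)
    finally show ?thesis by (simp only: set_lebesgue_integral_def real_scaleR_def)
  qed
  have ic: "integrable lborel (\<lambda>s. indicator {0<..<2 * pi} s * cis (of_int n * s))" for n
    by (rule integrable_Ioo_bounded[where B = 1])
       (auto intro!: borel_measurable_continuous_onI continuous_intros)
  have "(\<lambda>x. mon i x * cnj (mon j x)) \<in> borel_measurable (restrict_space borel (frontier (egg m)))"
    by (intro measurable_restrict_space1) measurable
  note E1 = integral_sigma_F[OF m this]
  define F where "F r = indicator {0<..<1} r * complex_of_real (A r)" for r :: real
  define G where "G n s = indicator {0<..<2 * pi} s * cis (of_int n * s)" for n :: int and s :: real
  have E2: "indicator bd_params u *\<^sub>R (chart_weight m (fst u) *\<^sub>R (mon i (bd_chart m u) * cnj (mon j (bd_chart m u)))) =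
      F (fst u) * (G p (fst (snd u)) * G q (snd (snd u)))" for u
  proof -
    obtain r s t where u: "u = (r, s, t)" by (metis prod.exhaust)
    show ?thesis
      unfolding u fst_conv snd_conv chart_mon A_def p_def q_def F_def G_def
      by (auto simp: bd_params_def indicator_def)
  qed
  have iF: "integrable lborel F" unfolding F_def by (rule iA)
  have iG: "integrable lborel (G n)" for n unfolding G_def by (rule ic)
  have iGG: "integrable lborel (\<lambda>v. G p (fst v) * G q (snd v))"
    by (rule lborel_integral_product(1)[OF iG iG])
  have E3: "(\<integral>u. F (fst u) * (G p (fst (snd u)) * G q (snd (snd u))) \<partial>lborel) =
      (\<integral>r. F r \<partial>lborel) * ((\<integral>s. G p s \<partial>lborel) * (\<integral>s. G q s \<partial>lborel))"
    using lborel_integral_product(2)[OF iF iGG] lborel_integral_product(2)[OF iG[of p] iG[of q]] by (simp only:)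
  have IF: "(\<integral>r. F r \<partial>lborel) = of_real (LINT r:{0<..<1}|lborel. A r)"
    using IA unfolding F_def .
  have IG: "(\<integral>s. G n s \<partial>lborel) = (if n = 0 then 2 * pi else 0)" for n
    using integral_cis unfolding G_def .
  have E4: "(\<integral>r. F r \<partial>lborel) * ((\<integral>s. G p s \<partial>lborel) * (\<integral>s. G q s \<partial>lborel)) =
    (if i = j then of_real (4 * pi\<^sup>2 * (LINT r:{0<..<1}|lborel. radial_moment m (2 * fst i) (2 * snd i) r)) else 0)"
  proof (cases "i = j")
    case True
    then have "p = 0" "q = 0" "A = radial_moment m (2 * fst i) (2 * snd i)"
      by (auto simp: p_def q_def A_def mult_2)
    with True show ?thesis
      unfolding IF IG by (simp add: power2_eq_square)
  next
    case False
    then have "p \<noteq> 0 \<or> q \<noteq> 0" by (auto simp: p_def q_def prod_eq_iff)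
    then show ?thesis unfolding IG using False by auto
  qed
  show ?thesis by (rule trans[OF E1[unfolded E2] trans[OF E3 E4]])
qed

lemma integral_radial_moment:
  assumes m: "m \<ge> 1"
  shows "(LINT r:{0<..<1}|lborel. radial_moment m (2 * a) (2 * b) r) =
    root 3 ((real m)\<^sup>2) * (fact a / (real (2 * m) * pochhammer (real b / real m + (real m + 2) / (3 * real m)) (Suc a)))"
proof -
  \<comment> \<open>In the exponent 1 comes from the area element, \<open>(2 m - 2) / 3\<close> from
    the cube root and \<open>2 b\<close> from the modulus of w.\<close>
  define g where "g = 2 * real b + (2 * real m + 1) / 3"
  let ?b = "\<lambda>r. (1 - r ^ (2 * m)) ^ a * r powr g"
  have eq: "radial_moment m (2 * a) (2 * b) r = root 3 ((real m)\<^sup>2) * ?b r"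
    if r: "r \<in> {0<..<1}" for r
  proof -
    have "root 3 (r ^ (2 * m - 2)) = (r powr (2 * real m - 2)) powr (1 / 3)"
      using r m by (simp add: root_powr_inverse powr_realpow[symmetric] of_nat_diff)
    then have "r * root 3 (r ^ (2 * m - 2)) * r ^ (2 * b) = r powr 1 * r powr ((2 * real m - 2) / 3) * r powr (2 * real b)"
      using r by (simp add: powr_powr powr_realpow[symmetric])
    also have "\<dots> = r powr (1 + (2 * real m - 2) / 3 + 2 * real b)"
      by (simp only: powr_add)
    also have "1 + (2 * real m - 2) / 3 + 2 * real b = g" by (simp add: g_def field_simps)
    finally have *: "r * root 3 (r ^ (2 * m - 2)) * r ^ (2 * b) = r powr g" .
    have "sqrt (1 - r ^ (2 * m)) ^ (2 * a) = (1 - r ^ (2 * m)) ^ a"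
      using r by (simp add: power_mult power_le_one)
    then show ?thesis
      by (simp add: radial_moment_def chart_weight_def real_root_mult *[symmetric] mult_ac)
  qed
  have g0: "g \<ge> 0" by (simp add: g_def)
  have beta: "((\<lambda>x. (1 - x ^ (2 * m)) ^ a * x powr g) has_integral
      fact a / (real (2 * m) * pochhammer ((g + 1) / real (2 * m)) (Suc a))) {0..1}"
    using m g0 by (intro beta_has_integral) auto
  have ge: "(g + 1) / real (2 * m) = real b / real m + (real m + 2) / (3 * real m)"
    using m by (simp add: g_def field_simps)
  have "(LINT r:{0<..<1}|lborel. radial_moment m (2 * a) (2 * b) r) =
      (LINT r:{0<..<1}|lborel. root 3 ((real m)\<^sup>2) * ?b r)"
    by (intro set_lebesgue_integral_cong) (auto simp: eq)
  also have "\<dots> = root 3 ((real m)\<^sup>2) * (LINT r:{0<..<1}|lborel. ?b r)"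
    by simp
  also have "(LINT r:{0<..<1}|lborel. ?b r) = integral {0<..<1} (\<lambda>r. ?b r)"
  proof (rule set_borel_integral_eq_integral)
    have "(\<lambda>r. complex_of_real (?b r)) \<in> borel_measurable borel" by measurable
    moreover have "cmod (complex_of_real (?b r)) \<le> 1" if "r \<in> {0<..<1}" for r
    proof -
      have "?b r \<le> 1"
        using that g0 by (intro mult_le_one power_le_one powr_le1) (auto simp: power_le_one)
      moreover have "0 \<le> ?b r"
        using that by (auto simp: power_le_one)
      ultimately show ?thesis by (simp only: norm_of_real abs_of_nonneg)
    qed
    ultimately have "integrable lborel (\<lambda>r. indicator {0<..<1} r * complex_of_real (?b r))"
      by (rule integrable_Ioo_bounded)
    then have "integrable lborel (\<lambda>r. complex_of_real (indicator {0<..<1} r * ?b r))"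
      by (simp add: of_real_indicator)
    then show "set_integrable lborel {0<..<1} (\<lambda>r. ?b r)"
      unfolding set_integrable_def by (simp only: complex_of_real_integrable_eq real_scaleR_def)
  qed
  also have "\<dots> = fact a / (real (2 * m) * pochhammer ((g + 1) / real (2 * m)) (Suc a))"
    using integral_unique[OF beta] by (simp add: integral_open_interval_real)
  finally show ?thesis unfolding ge .
qed

lemma egg_measure_sigma_F:
  assumes m: "m \<ge> 1"
  shows "egg_measure (sigma_F m) m"
proof -
  interpret finite_measure "sigma_F m" by (rule finite_sigma_F[OF m])
  show ?thesis
  proof
    show "m \<ge> 1" by (rule m)
    show "space (sigma_F m) \<subseteq> closed_egg m"
      using frontier_rho[OF m] by (auto simp: space_sigma_F closed_egg_eq_rho)
    show "(\<lambda>x. x) \<in> measurable (sigma_F m) borel"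
      using measurable_cong_sets[OF sets_sigma_F refl] measurable_restrict_space1[of "\<lambda>x. x" borel borel] by auto
    show "(\<integral>x. mon i x * cnj (mon j x) \<partial>sigma_F m) = 0" if "i \<noteq> j" for i j
      using that by (simp add: integral_mon_sigma_F[OF m])
  qed
qed

text \<open>The reciprocal of \<open>4 pi^2\<close> times the radial Beta integral.\<close>

definition szego_coeff :: "nat \<Rightarrow> nat \<times> nat \<Rightarrow> real" where
  "szego_coeff m i = real m / (2 * pi\<^sup>2 * root 3 ((real m)\<^sup>2)) *
     (pochhammer (real (snd i) / real m + (real m + 2) / (3 * real m)) (Suc (fst i)) / fact (fst i))"

lemma integral_norm_mon_sigma_F:
  assumes m: "m \<ge> 1"
  shows "(\<integral>x. (cmod (mon i x))\<^sup>2 \<partial>sigma_F m) = 1 / szego_coeff m i"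
proof -
  have "complex_of_real (\<integral>x. (cmod (mon i x))\<^sup>2 \<partial>sigma_F m) = (\<integral>x. mon i x * cnj (mon i x) \<partial>sigma_F m)"
    by (simp only: complex_norm_square[symmetric] integral_complex_of_real)
  also have "\<dots> = complex_of_real (4 * pi\<^sup>2 * (LINT r:{0<..<1}|lborel. radial_moment m (2 * fst i) (2 * snd i) r))"
    by (simp only: integral_mon_sigma_F[OF m] if_True refl)
  finally have "(\<integral>x. (cmod (mon i x))\<^sup>2 \<partial>sigma_F m) = 4 * pi\<^sup>2 * (LINT r:{0<..<1}|lborel. radial_moment m (2 * fst i) (2 * snd i) r)"
    by (simp only: of_real_eq_iff)
  also have "\<dots> = 1 / szego_coeff m i"
    unfolding integral_radial_moment[OF m] szego_coeff_def using m by (simp add: field_simps)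
  finally show ?thesis .
qed

text \<open>With \<open>\<beta> = (b + (m + 2)/3) / m\<close> the Pochhammer symbol of length
  \<open>a + 1\<close> is \<open>\<beta>\<close> times one of length \<open>a\<close> starting at
  \<open>\<beta> + 1 = 4/3 + 2/(3 m) + b/m\<close>. Since \<open>(m + 2)/3 \<ge> 1\<close>, the
  factor \<open>m \<beta>\<close> lies between \<open>b + 1\<close> and
  \<open>(b + 1) (m + 2)/3\<close>, and \<open>b + 1\<close> is the b-th coefficient of
  \<open>(1 - t)^(-2)\<close>.\<close>

lemma kernel_weights_szego:
  assumes m: "m \<ge> 1"
  obtains u c1 c2 where "kernel_weights m (4 / 3 + 2 / (3 * real m)) 2 u c1 c2 (szego_coeff m)"
proof -
  define \<kappa> where "\<kappa> = real m / (2 * pi\<^sup>2 * root 3 ((real m)\<^sup>2))"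
  have \<kappa>: "\<kappa> > 0" using m by (simp add: \<kappa>_def)
  define u where "u b = \<kappa> * (real b / real m + (real m + 2) / (3 * real m))" for b
  have p2: "pochhammer (2::real) b / fact b = real b + 1" for b
    using pochhammer_rec[of "1::real" b] pochhammer_fact[of "Suc b", where 'a = real] by (simp add: field_simps)
  have "kernel_weights m (4 / 3 + 2 / (3 * real m)) 2 u (\<kappa> / m) (\<kappa> * (real m + 2) / (3 * real m)) (szego_coeff m)"
  proof
    show "m \<ge> 1" "(1::nat) \<le> 2" by (use m in auto)
    show "0 < 4 / 3 + 2 / (3 * real m)" using m by (simp add: add_pos_pos)
    show "0 < \<kappa> / m" using \<kappa> m by simp
    have m3: "1 \<le> (real m + 2) / 3" using m by simp
    show "\<kappa> / m \<le> \<kappa> * (real m + 2) / (3 * real m)"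
      using mult_left_mono[OF m3, of "\<kappa> / m"] \<kappa> m by (simp add: field_simps)
    fix a b
    have "real b + 1 \<le> real b + (real m + 2) / 3" using m3 by simp
    from mult_left_mono[OF this, of "\<kappa> / m"]
    show "\<kappa> / m * (pochhammer (real 2) b / fact b) \<le> u b"
      using \<kappa> m by (simp add: p2 u_def field_simps)
    have "real b + (real m + 2) / 3 \<le> (real m + 2) / 3 * (real b + 1)"
      using mult_left_mono[OF m3, of "real b"] by (simp add: field_simps)
    from mult_left_mono[OF this, of "\<kappa> / m"]
    show "u b \<le> \<kappa> * (real m + 2) / (3 * real m) * (pochhammer (real 2) b / fact b)"
      using \<kappa> m by (simp add: p2 u_def field_simps)
    have e: "real b / real m + (real m + 2) / (3 * real m) + 1 = 4 / 3 + 2 / (3 * real m) + real b / real m"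
      using m by (simp add: field_simps)
    show "szego_coeff m (a, b) = u b * (pochhammer (4 / 3 + 2 / (3 * real m) + real b / real m) a / fact a)"
      unfolding szego_coeff_def u_def \<kappa>_def fst_conv snd_conv pochhammer_rec e by (simp add: mult_ac)
  qed
  then show ?thesis by (rule that)
qed

section \<open>Lebesgue measure on the egg\<close>


lemma Complex_measurable [measurable]:
  "(\<lambda>(x, y). Complex x y) \<in> (lborel \<Otimes>\<^sub>M lborel) \<rightarrow>\<^sub>M borel"
proof -
  have "(\<lambda>p::real \<times> real. Complex (fst p) (snd p)) \<in> borel_measurable borel"
    by (intro borel_measurable_continuous_onI) (auto simp: Complex_eq intro!: continuous_intros)
  then show ?thesis by (simp add: lborel_prod case_prod_unfold)
qed

lemma lborel_complex_eq: "(lborel :: complex measure) = distr (lborel \<Otimes>\<^sub>M lborel) borel (\<lambda>(x, y). Complex x y)"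
proof (rule lborel_eqI)
  fix l u :: complex assume le: "\<And>b. b \<in> Basis \<Longrightarrow> l \<bullet> b \<le> u \<bullet> b"
  have le': "Re l \<le> Re u" "Im l \<le> Im u"
    using le[of 1] le[of \<i>] by (auto simp: Basis_complex_def)
  have "(\<lambda>(x, y). Complex x y) -` box l u \<inter> space (lborel \<Otimes>\<^sub>M lborel) = {Re l<..<Re u} \<times> {Im l<..<Im u}"
    by (auto simp: box_def Basis_complex_def space_pair_measure)
  then have "emeasure (distr (lborel \<Otimes>\<^sub>M lborel) borel (\<lambda>(x, y). Complex x y)) (box l u) =
      emeasure (lborel \<Otimes>\<^sub>M lborel) ({Re l<..<Re u} \<times> {Im l<..<Im u})"
    by (simp add: emeasure_distr)
  also have "\<dots> = ennreal (Re u - Re l) * ennreal (Im u - Im l)"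
    using le' by (simp add: lborel.emeasure_pair_measure_Times)
  also have "\<dots> = (\<Prod>b\<in>Basis. (u - l) \<bullet> b)"
    using le' by (simp add: Basis_complex_def ennreal_mult)
  finally show "emeasure (distr (lborel \<Otimes>\<^sub>M lborel) borel (\<lambda>(x, y). Complex x y)) (box l u) = (\<Prod>b\<in>Basis. (u - l) \<bullet> b)" .
qed simp

lemma nn_integral_complex:
  assumes [measurable]: "f \<in> borel_measurable borel"
  shows "(\<integral>\<^sup>+z. f z \<partial>lborel) = (\<integral>\<^sup>+x. \<integral>\<^sup>+y. f (Complex x y) \<partial>lborel \<partial>lborel)"
    "(\<integral>\<^sup>+z. f z \<partial>lborel) = (\<integral>\<^sup>+y. \<integral>\<^sup>+x. f (Complex x y) \<partial>lborel \<partial>lborel)"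
proof -
  have fm [measurable]: "(\<lambda>p. f (case p of (x, y) \<Rightarrow> Complex x y)) \<in> borel_measurable (lborel \<Otimes>\<^sub>M lborel)"
    by measurable
  have "(\<integral>\<^sup>+z. f z \<partial>lborel) = (\<integral>\<^sup>+p. f (case p of (x, y) \<Rightarrow> Complex x y) \<partial>(lborel \<Otimes>\<^sub>M lborel))"
    unfolding lborel_complex_eq by (rule nn_integral_distr) measurable
  also have "\<dots> = (\<integral>\<^sup>+x. \<integral>\<^sup>+y. f (Complex x y) \<partial>lborel \<partial>lborel)"
    by (subst lborel.nn_integral_fst[symmetric]) (simp_all add: fm)
  finally show 1: "(\<integral>\<^sup>+z. f z \<partial>lborel) = (\<integral>\<^sup>+x. \<integral>\<^sup>+y. f (Complex x y) \<partial>lborel \<partial>lborel)" .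
  also have "\<dots> = (\<integral>\<^sup>+y. \<integral>\<^sup>+x. f (Complex x y) \<partial>lborel \<partial>lborel)"
    using lborel_pair.Fubini'[of "\<lambda>x y. f (Complex x y)"] fm by (simp add: case_prod_unfold)
  finally show "(\<integral>\<^sup>+z. f z \<partial>lborel) = (\<integral>\<^sup>+y. \<integral>\<^sup>+x. f (Complex x y) \<partial>lborel \<partial>lborel)" .
qed

text \<open>For a fixed value of one real coordinate a shear translates the other; Fubini in the
  matching order reduces it to translation invariance on the line.\<close>

lemma nn_integral_shear:
  fixes c :: real
  assumes [measurable]: "f \<in> borel_measurable (borel :: complex measure)"
  shows "(\<integral>\<^sup>+z. f (z + of_real (c * Im z)) \<partial>lborel) = (\<integral>\<^sup>+z. f z \<partial>lborel)"
    and "(\<integral>\<^sup>+z. f (z + \<i> * of_real (c * Re z)) \<partial>lborel) = (\<integral>\<^sup>+z. f z \<partial>lborel)"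
proof -
  have cm: "(\<lambda>x. Complex x y) \<in> borel_measurable borel" "(\<lambda>y. Complex x y) \<in> borel_measurable borel" for x y
    by (intro borel_measurable_continuous_onI; auto simp: Complex_eq intro!: continuous_intros)+
  note [measurable] = cm
  have m: "(\<lambda>z. f (z + of_real (c * Im z))) \<in> borel_measurable borel"
    "(\<lambda>z. f (z + \<i> * of_real (c * Re z))) \<in> borel_measurable borel"
    by measurable
  have "(\<integral>\<^sup>+z. f (z + of_real (c * Im z)) \<partial>lborel) = (\<integral>\<^sup>+y. \<integral>\<^sup>+x. f (Complex (c * y + 1 * x) y) \<partial>lborel \<partial>lborel)"
    unfolding nn_integral_complex(2)[OF m(1)] by (simp add: Complex_eq algebra_simps)
  also have "\<dots> = (\<integral>\<^sup>+y. \<integral>\<^sup>+x. f (Complex x y) \<partial>lborel \<partial>lborel)"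
  proof (rule nn_integral_cong)
    fix y
    have fm: "(\<lambda>x. f (Complex x y)) \<in> borel_measurable borel" by measurable
    show "(\<integral>\<^sup>+x. f (Complex (c * y + 1 * x) y) \<partial>lborel) = (\<integral>\<^sup>+x. f (Complex x y) \<partial>lborel)"
      using nn_integral_real_affine[OF fm, of 1 "c * y"] by simp
  qed
  also have "\<dots> = (\<integral>\<^sup>+z. f z \<partial>lborel)" by (rule nn_integral_complex(2)[symmetric]) measurable
  finally show "(\<integral>\<^sup>+z. f (z + of_real (c * Im z)) \<partial>lborel) = (\<integral>\<^sup>+z. f z \<partial>lborel)" .
  have "(\<integral>\<^sup>+z. f (z + \<i> * of_real (c * Re z)) \<partial>lborel) = (\<integral>\<^sup>+x. \<integral>\<^sup>+y. f (Complex x (c * x + 1 * y)) \<partial>lborel \<partial>lborel)"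
    unfolding nn_integral_complex(1)[OF m(2)] by (simp add: Complex_eq algebra_simps)
  also have "\<dots> = (\<integral>\<^sup>+x. \<integral>\<^sup>+y. f (Complex x y) \<partial>lborel \<partial>lborel)"
  proof (rule nn_integral_cong)
    fix x
    have fm: "(\<lambda>y. f (Complex x y)) \<in> borel_measurable borel" by measurable
    show "(\<integral>\<^sup>+y. f (Complex x (c * x + 1 * y)) \<partial>lborel) = (\<integral>\<^sup>+y. f (Complex x y) \<partial>lborel)"
      using nn_integral_real_affine[OF fm, of 1 "c * x"] by simp
  qed
  also have "\<dots> = (\<integral>\<^sup>+z. f z \<partial>lborel)" by (rule nn_integral_complex(1)[symmetric]) measurable
  finally show "(\<integral>\<^sup>+z. f (z + \<i> * of_real (c * Re z)) \<partial>lborel) = (\<integral>\<^sup>+z. f z \<partial>lborel)" .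
qed

text \<open>A rotation that is not a half turn is a product of three shears.\<close>

lemma nn_integral_rotation:
  assumes u: "cmod u = 1" "Im u \<noteq> 0" and f [measurable]: "f \<in> borel_measurable (borel :: complex measure)"
  shows "(\<integral>\<^sup>+z. f (u * z) \<partial>lborel) = (\<integral>\<^sup>+z. f z \<partial>lborel)"
proof -
  define c s where "c = Re u" and "s = Im u"
  have cs: "c\<^sup>2 + s\<^sup>2 = 1" using u(1) by (simp add: c_def s_def cmod_power2[symmetric])
  have s0: "s \<noteq> 0" using u(2) by (simp add: s_def)
  \<comment> \<open>For rotation by the angle \<theta> this is minus the tangent of \<theta>/2, the
    classical shear factor; the division is where \<open>Im u \<noteq> 0\<close> enters.\<close>
  define a where "a = - (1 - c) / s"
  define S where "S z = z + of_real (a * Im z)" for z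
  define T where "T z = z + \<i> * of_real (s * Re z)" for z
  have ab: "1 + a * s = c" "a * (1 + c) = - s"
    using s0 cs by (auto simp: a_def field_simps power2_eq_square)
  have rot: "u * z = S (T (S z))" for z
  proof (rule complex_eqI)
    have "Im (S (T (S z))) = s * Re z + (1 + a * s) * Im z"
      by (simp add: S_def T_def algebra_simps)
    then show "Im (u * z) = Im (S (T (S z)))" unfolding ab by (simp add: c_def s_def)
    have "Re (S (T (S z))) = (1 + a * s) * Re z + a * (1 + (1 + a * s)) * Im z"
      by (simp add: S_def T_def algebra_simps)
    then show "Re (u * z) = Re (S (T (S z)))" unfolding ab by (simp add: c_def s_def)
  qed
  have [measurable]: "S \<in> borel_measurable borel" "T \<in> borel_measurable borel"
    unfolding S_def T_def by measurable
  have "(\<integral>\<^sup>+z. f (u * z) \<partial>lborel) = (\<integral>\<^sup>+z. (\<lambda>z. f (S (T z))) (S z) \<partial>lborel)"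
    by (simp add: rot)
  also have "\<dots> = (\<integral>\<^sup>+z. (\<lambda>z. f (S z)) (T z) \<partial>lborel)"
    unfolding S_def by (rule nn_integral_shear(1)) (simp flip: S_def)
  also have "\<dots> = (\<integral>\<^sup>+z. f (S z) \<partial>lborel)"
    unfolding T_def by (rule nn_integral_shear(2)) measurable
  also have "\<dots> = (\<integral>\<^sup>+z. f z \<partial>lborel)"
    unfolding S_def by (rule nn_integral_shear(1)) measurable
  finally show ?thesis .
qed

lemma distr_rotation:
  assumes u: "cmod u = 1" "Im u \<noteq> 0"
  shows "distr lborel borel (\<lambda>z. u * z) = (lborel :: complex measure)"
proof (rule measure_eqI)
  fix A assume "A \<in> sets (distr lborel borel (\<lambda>z. u * z))"
  then have [measurable]: "A \<in> sets borel" by simp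
  have "emeasure (distr lborel borel (\<lambda>z. u * z)) A = (\<integral>\<^sup>+z. indicator A z \<partial>distr lborel borel (\<lambda>z. u * z))"
    by simp
  also have "\<dots> = (\<integral>\<^sup>+z. indicator A (u * z) \<partial>lborel)"
    by (rule nn_integral_distr) measurable
  also have "\<dots> = (\<integral>\<^sup>+z. indicator A z \<partial>lborel)"
    by (rule nn_integral_rotation[OF u]) measurable
  finally show "emeasure (distr lborel borel (\<lambda>z. u * z)) A = emeasure lborel A" by simp
qed simp

lemma distr_rotation_pair:
  assumes u: "cmod u = 1" "Im u \<noteq> 0"
  shows "distr lborel borel (\<lambda>p. (u * fst p, snd p)) = (lborel :: (complex \<times> complex) measure)"
    and "distr lborel borel (\<lambda>p. (fst p, u * snd p)) = (lborel :: (complex \<times> complex) measure)"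
proof -
  have sf: "sigma_finite_measure (distr lborel borel (\<lambda>z::complex. z))" "sigma_finite_measure (distr lborel borel (\<lambda>z. u * z))"
    unfolding distr_rotation[OF u] by (simp_all add: distr_id2 lborel.sigma_finite_measure_axioms)
  have id: "distr lborel borel (\<lambda>z::complex. z) = lborel" by (rule distr_id2) simp
  have b: "borel \<Otimes>\<^sub>M borel = (borel :: (complex \<times> complex) measure)" by (rule borel_prod)
  have "distr lborel borel (\<lambda>z. u * z) \<Otimes>\<^sub>M distr lborel borel (\<lambda>z::complex. z) =
      distr (lborel \<Otimes>\<^sub>M lborel) (borel \<Otimes>\<^sub>M borel) (\<lambda>(x, y). (u * x, y))"
    by (rule pair_measure_distr[OF _ _ sf(1)]) measurable
  then show "distr lborel borel (\<lambda>p. (u * fst p, snd p)) = (lborel :: (complex \<times> complex) measure)"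
    unfolding distr_rotation[OF u] id lborel_prod b case_prod_unfold by simp
  have "distr lborel borel (\<lambda>z::complex. z) \<Otimes>\<^sub>M distr lborel borel (\<lambda>z. u * z) =
      distr (lborel \<Otimes>\<^sub>M lborel) (borel \<Otimes>\<^sub>M borel) (\<lambda>(x, y). (x, u * y))"
    by (rule pair_measure_distr[OF _ _ sf(2)]) measurable
  then show "distr lborel borel (\<lambda>p. (fst p, u * snd p)) = (lborel :: (complex \<times> complex) measure)"
    unfolding distr_rotation[OF u] id lborel_prod b case_prod_unfold by simp
qed

text \<open>The angle \<open>pi / (2 n)\<close> with \<open>n = |a - c|\<close> gives
  \<open>u^a * cnj u^c\<close> the value i or -i, and it lies strictly between 0 and pi, as the
  decomposition into shears asks.\<close>

lemma rotation_separating_powers: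
  assumes "a \<noteq> c"
  obtains u where "cmod u = 1" "Im u \<noteq> 0" "u ^ a * cnj u ^ c \<noteq> 1"
proof -
  define n where "n = \<bar>int a - int c\<bar>"
  have n: "n \<ge> 1" using assms by (simp add: n_def)
  define u where "u = cis (pi / (2 * of_int n))"
  have "0 < pi / (2 * of_int n)" "pi / (2 * of_int n) < pi"
    using n by (auto simp: field_simps)
  then have "Im u \<noteq> 0" using sin_gt_zero[of "pi / (2 * of_int n)"] by (simp add: u_def)
  define X where "X = of_int (int a - int c) * (pi / (2 * of_int n))"
  have "X = pi / 2 \<or> X = - (pi / 2)"
  proof (cases "int a \<ge> int c")
    case True
    then have "of_int (int a - int c) = (of_int n :: real)" by (simp add: n_def)
    then show ?thesis unfolding X_def using n by simp
  next
    case False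
    then have "of_int (int a - int c) = - (of_int n :: real)" by (simp add: n_def)
    then show ?thesis unfolding X_def using n by simp
  qed
  then have "Re (cis X) = 0" by (metis cis.sel(1) cos_minus cos_pi_half)
  moreover have "u ^ a * cnj u ^ c = cis X"
    by (simp add: u_def X_def Complex.DeMoivre cis_cnj cis_mult algebra_simps diff_divide_distrib)
  ultimately have "u ^ a * cnj u ^ c \<noteq> 1" by (metis one_complex.sel(1) zero_neq_one)
  then show ?thesis
    using \<open>Im u \<noteq> 0\<close> by (intro that[of u]) (auto simp: u_def)
qed

text \<open>A rotation of one coordinate preserves \<open>E\<close> and the measure but multiplies
  the integrand by a factor other than 1, so the integral vanishes. \<open>E\<close> is kept general
  to cover the dilated eggs besides the egg.\<close>

lemma mon_orthogonal_lborel: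
  assumes [measurable]: "E \<in> sets borel"
    and E: "\<And>p q. cmod (fst p) = cmod (fst q) \<Longrightarrow> cmod (snd p) = cmod (snd q) \<Longrightarrow> p \<in> E \<longleftrightarrow> q \<in> E"
    and ij: "i \<noteq> j"
  shows "(\<integral>x. indicator E x *\<^sub>R (mon i x * cnj (mon j x)) \<partial>lborel) = 0"
proof -
  define h where "h x = indicator E x *\<^sub>R (mon i x * cnj (mon j x))" for x
  have hm [measurable]: "h \<in> borel_measurable borel" unfolding h_def by measurable
  have zero: "(\<integral>x. h x \<partial>lborel) = 0"
    if T: "distr lborel borel T = lborel" "continuous_on UNIV T" and "v \<noteq> 1"
      and TE: "\<And>x. T x \<in> E \<longleftrightarrow> x \<in> E"
      and v: "\<And>x. mon i (T x) * cnj (mon j (T x)) = v * (mon i x * cnj (mon j x))" for T v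
  proof -
    have "(\<integral>x. h x \<partial>lborel) = (\<integral>x. h x \<partial>distr lborel borel T)" unfolding T(1) ..
    also have "\<dots> = (\<integral>x. h (T x) \<partial>lborel)"
      by (intro integral_distr) (auto intro: borel_measurable_continuous_onI T(2))
    also have "\<dots> = (\<integral>x. v * h x \<partial>lborel)"
      by (simp add: h_def TE v indicator_def)
    also have "\<dots> = v * (\<integral>x. h x \<partial>lborel)" by (rule integral_mult_right_zero)
    finally show ?thesis using \<open>v \<noteq> 1\<close> by simp
  qed
  have "(\<integral>x. h x \<partial>lborel) = 0"
  proof (cases "fst i = fst j")
    case False
    then obtain u where u: "cmod u = 1" "Im u \<noteq> 0" "u ^ fst i * cnj u ^ fst j \<noteq> 1"
      by (rule rotation_separating_powers)
    show ?thesis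
      by (rule zero[OF distr_rotation_pair(1)[OF u(1,2)] _ u(3)])
         (auto intro!: continuous_intros E simp: norm_mult u mon_def power_mult_distrib)
  next
    case True
    with ij have "snd i \<noteq> snd j" by (auto simp: prod_eq_iff)
    then obtain u where u: "cmod u = 1" "Im u \<noteq> 0" "u ^ snd i * cnj u ^ snd j \<noteq> 1"
      by (rule rotation_separating_powers)
    show ?thesis
      by (rule zero[OF distr_rotation_pair(2)[OF u(1,2)] _ u(3)])
         (auto intro!: continuous_intros E simp: norm_mult u mon_def power_mult_distrib)
  qed
  then show ?thesis unfolding h_def .
qed

section \<open>Norms of the monomials over the egg\<close>

lemma distr_norm_square:
  "distr lborel borel (\<lambda>z::complex. (cmod z)\<^sup>2) = density lborel (\<lambda>x. ennreal pi * indicator {0..} x)"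
proof (rule measure_eqI_generator_eq[where E = "range lessThan" and \<Omega> = UNIV and A = "\<lambda>n. {..<real n}"])
  show "Int_stable (range lessThan :: real set set)"
  proof -
    have "{..<a} \<inter> {..<b} = {..<min a b}" for a b :: real by auto
    then show ?thesis by (auto simp: Int_stable_def)
  qed
  \<comment> \<open>The disc of squared radius x has area pi x. As the half-lines generate the Borel
    sets, this identifies the image of Lebesgue measure under |z|^2.\<close>
  have e: "emeasure (distr lborel borel (\<lambda>z::complex. (cmod z)\<^sup>2)) {..<x} = ennreal (pi * max 0 x)" for x :: real
  proof -
    have sq: "(cmod z)\<^sup>2 < x \<longleftrightarrow> cmod z < sqrt x" for z :: complex
      using real_sqrt_less_iff[of "(cmod z)\<^sup>2" x] by simp
    have "(\<lambda>z::complex. (cmod z)\<^sup>2) -` {..<x} = ball 0 (sqrt x)"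
      by (auto simp: sq)
    then have "emeasure (distr lborel borel (\<lambda>z::complex. (cmod z)\<^sup>2)) {..<x} = emeasure lborel (ball (0::complex) (sqrt x))"
      by (subst emeasure_distr) auto
    also have "\<dots> = ennreal (pi * max 0 x)"
    proof (cases "x \<le> 0")
      case True
      then have "ball (0::complex) (sqrt x) = {}" by (simp add: ball_empty)
      then show ?thesis using True by (simp only: emeasure_empty) (simp add: max_def)
    next
      case False
      then show ?thesis by (simp add: emeasure_ball unit_ball_vol_2)
    qed
    finally show ?thesis .
  qed
  have d: "emeasure (density lborel (\<lambda>x. ennreal pi * indicator {0..} x)) {..<x} = ennreal (pi * max 0 x)" for x :: real
  proof -
    have "emeasure (density lborel (\<lambda>x. ennreal pi * indicator {0..} x)) {..<x} = (\<integral>\<^sup>+t. ennreal pi * indicator {0..<x} t \<partial>lborel)"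
      by (subst emeasure_density) (auto intro!: nn_integral_cong split: split_indicator)
    also have "\<dots> = ennreal pi * ennreal (max 0 x)"
      by (subst nn_integral_cmult_indicator) (auto simp: max_def)
    finally show ?thesis by (simp add: ennreal_mult)
  qed
  show "emeasure (distr lborel borel (\<lambda>z::complex. (cmod z)\<^sup>2)) X = emeasure (density lborel (\<lambda>x. ennreal pi * indicator {0..} x)) X"
    if "X \<in> range lessThan" for X
    using that e d by auto
  show "emeasure (distr lborel borel (\<lambda>z::complex. (cmod z)\<^sup>2)) {..<real n} \<noteq> \<infinity>" for n
    by (simp add: e)
  show "(\<Union>n. {..<real n}) = UNIV" using reals_Archimedean2 by auto
qed (auto simp: borel_Iio)

lemma nn_integral_norm_square:
  fixes h :: "real \<Rightarrow> ennreal"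
  assumes [measurable]: "h \<in> borel_measurable borel"
  shows "(\<integral>\<^sup>+z. h ((cmod z)\<^sup>2) \<partial>lborel) = ennreal pi * (\<integral>\<^sup>+x. indicator {0..} x * h x \<partial>lborel)"
proof -
  have "(\<integral>\<^sup>+z. h ((cmod z)\<^sup>2) \<partial>lborel) = (\<integral>\<^sup>+x. h x \<partial>distr lborel borel (\<lambda>z::complex. (cmod z)\<^sup>2))"
    by (rule nn_integral_distr[symmetric]) measurable
  also have "\<dots> = (\<integral>\<^sup>+x. ennreal pi * indicator {0..} x * h x \<partial>lborel)"
    unfolding distr_norm_square by (rule nn_integral_density) measurable
  also have "\<dots> = ennreal pi * (\<integral>\<^sup>+x. indicator {0..} x * h x \<partial>lborel)"
    by (subst nn_integral_cmult[symmetric]) (auto simp: mult_ac)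
  finally show ?thesis .
qed

lemma nn_integral_power_Ico:
  assumes "0 \<le> c"
  shows "(\<integral>\<^sup>+x. ennreal (x ^ a) * indicator {0..<c} x \<partial>lborel) = ennreal (c ^ Suc a / Suc a)"
proof -
  have "(\<integral>\<^sup>+x. ennreal (x ^ a) * indicator {0..<c} x \<partial>lborel) = (\<integral>\<^sup>+x. ennreal (x ^ a) * indicator {0..c} x \<partial>lborel)"
    by (rule nn_integral_cong_AE, rule AE_mp[OF AE_lborel_singleton[of c]]) (auto split: split_indicator)
  also have "\<dots> = ennreal (c ^ Suc a / Suc a - 0 ^ Suc a / Suc a)"
  proof (rule nn_integral_FTC_Icc[where F = "\<lambda>x. x ^ Suc a / Suc a"])
    show "((\<lambda>x. x ^ Suc a / Suc a) has_real_derivative x ^ a) (at x)" for x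
    proof -
      have "((\<lambda>x. x ^ Suc a / Suc a) has_real_derivative (1 + real a) * (1 * x ^ a) / Suc a) (at x)"
        by (rule DERIV_cdivide[OF DERIV_power_Suc[OF DERIV_ident]])
      moreover have "(1 + real a) * (1 * x ^ a) / Suc a = x ^ a" by simp
      ultimately show ?thesis by (simp only:)
    qed
  qed (use assms in auto)
  finally show ?thesis by simp
qed

lemma egg_borel [measurable]: "egg m \<in> sets borel"
  by (rule borel_open[OF open_egg])

text \<open>In \<open>x = |z|^2\<close> and \<open>y = |w|^2\<close> the egg is
  \<open>0 \<le> x < 1 - y^m\<close>. Integration over x gives
  \<open>(1 - y^m)^(a+1) / (a+1)\<close>, which leaves a Beta integral in y with exponent
  \<open>a + 1\<close>; hence the Pochhammer symbol of length \<open>a + 2\<close>.\<close>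

lemma nn_integral_mon_egg:
  assumes m: "m \<ge> 1"
  shows "(\<integral>\<^sup>+p. ennreal ((cmod (mon (a, b) p))\<^sup>2) * indicator (egg m) p \<partial>lborel) =
    ennreal (pi\<^sup>2 * (fact a / (real m * pochhammer ((real b + 1) / real m) (a + 2))))"
proof -
  let ?c = "\<lambda>y. y ^ b * ((1 - y ^ m) ^ Suc a / Suc a)"
  let ?P = "real m * pochhammer ((real b + 1) / real m) (Suc (Suc a))"
  have [measurable]: "(\<lambda>p. ennreal ((cmod (mon (a, b) p))\<^sup>2)) \<in> borel_measurable borel"
    by measurable
  have "(\<integral>\<^sup>+p. ennreal ((cmod (mon (a, b) p))\<^sup>2) * indicator (egg m) p \<partial>lborel) =
      (\<integral>\<^sup>+w. \<integral>\<^sup>+z. ennreal ((cmod (mon (a, b) (z, w)))\<^sup>2) * indicator (egg m) (z, w) \<partial>lborel \<partial>lborel)"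
    unfolding lborel_prod[symmetric]
    by (rule lborel_pair.nn_integral_snd[symmetric]) (simp add: borel_prod lborel_prod)
  also have "\<dots> = (\<integral>\<^sup>+w. ennreal pi * (indicator {..<1} ((cmod w)\<^sup>2) * ennreal (?c ((cmod w)\<^sup>2))) \<partial>lborel)"
  proof (rule nn_integral_cong)
    fix w :: complex
    define y where "y = (cmod w)\<^sup>2"
    have y0: "0 \<le> y" by (simp add: y_def)
    have "(\<integral>\<^sup>+z. ennreal ((cmod (mon (a, b) (z, w)))\<^sup>2) * indicator (egg m) (z, w) \<partial>lborel) =
        (\<integral>\<^sup>+z. (\<lambda>x. ennreal (x ^ a * y ^ b) * indicator {..<1 - y ^ m} x) ((cmod z)\<^sup>2) \<partial>lborel)"
      by (intro nn_integral_cong)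
         (auto simp: norm_mon y_def egg_def power_mult_distrib power_mult[symmetric] mult.commute split: split_indicator)
    also have "\<dots> = ennreal pi * (\<integral>\<^sup>+x. indicator {0..} x * (ennreal (x ^ a * y ^ b) * indicator {..<1 - y ^ m} x) \<partial>lborel)"
      by (rule nn_integral_norm_square) measurable
    also have "(\<integral>\<^sup>+x. indicator {0..} x * (ennreal (x ^ a * y ^ b) * indicator {..<1 - y ^ m} x) \<partial>lborel) =
       (\<integral>\<^sup>+x. ennreal (y ^ b) * (ennreal (x ^ a) * indicator {0..<1 - y ^ m} x) \<partial>lborel)"
      using y0 by (intro nn_integral_cong) (auto simp: ennreal_mult mult_ac split: split_indicator)
    also have "\<dots> = ennreal (y ^ b) * (\<integral>\<^sup>+x. ennreal (x ^ a) * indicator {0..<1 - y ^ m} x \<partial>lborel)"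
      by (rule nn_integral_cmult) measurable
    also have "\<dots> = indicator {..<1} y * ennreal (?c y)"
    proof (cases "y < 1")
      case True
      then have "0 \<le> 1 - y ^ m" using y0 by (simp add: power_le_one)
      then have "ennreal (y ^ b) * ennreal ((1 - y ^ m) ^ Suc a / Suc a) = ennreal (?c y)"
        using y0 by (intro ennreal_mult[symmetric]) auto
      then show ?thesis using True nn_integral_power_Ico[OF \<open>0 \<le> 1 - y ^ m\<close>] by (simp del: power_Suc of_nat_Suc)
    next
      case False
      then have "1 \<le> y ^ m" by simp
      then have "{0..<1 - y ^ m} = {}" by auto
      then show ?thesis using False by simp
    qed
    finally show "(\<integral>\<^sup>+z. ennreal ((cmod (mon (a, b) (z, w)))\<^sup>2) * indicator (egg m) (z, w) \<partial>lborel) =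
        ennreal pi * (indicator {..<1} ((cmod w)\<^sup>2) * ennreal (?c ((cmod w)\<^sup>2)))"
      unfolding y_def .
  qed
  also have "\<dots> = ennreal pi * (\<integral>\<^sup>+w. (\<lambda>y. indicator {..<1} y * ennreal (?c y)) ((cmod (w::complex))\<^sup>2) \<partial>lborel)"
    by (rule nn_integral_cmult) measurable
  also have "(\<integral>\<^sup>+w. (\<lambda>y. indicator {..<1} y * ennreal (?c y)) ((cmod (w::complex))\<^sup>2) \<partial>lborel) =
     ennreal pi * (\<integral>\<^sup>+y. indicator {0..} y * (indicator {..<1} y * ennreal (?c y)) \<partial>lborel)"
    by (rule nn_integral_norm_square) measurable
  also have "(\<integral>\<^sup>+y. indicator {0..} y * (indicator {..<1} y * ennreal (?c y)) \<partial>lborel) =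
     (\<integral>\<^sup>+y\<in>{0..1}. ennreal ((1 - y ^ m) ^ Suc a * y powr real b / Suc a) \<partial>lborel)"
  proof (rule nn_integral_cong_AE)
    \<comment> \<open>The endpoints are discarded: at 1 the indicators differ, and at 0 the value
      \<open>0 powr 0 = 0\<close> disagrees with \<open>0 ^ 0 = 1\<close>.\<close>
    have "AE y in lborel. y \<noteq> (0::real) \<and> y \<noteq> 1"
      using AE_lborel_singleton[of "0::real"] AE_lborel_singleton[of "1::real"] by eventually_elim auto
    then show "AE y in lborel. indicator {0..} y * (indicator {..<1} y * ennreal (?c y)) =
        ennreal ((1 - y ^ m) ^ Suc a * y powr real b / Suc a) * indicator {0..1} y"
      by eventually_elim (auto simp: powr_realpow mult_ac split: split_indicator)
  qed
  also have "\<dots> = ennreal ((fact (Suc a) / (?P)) / Suc a)"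
  proof (rule nn_integral_has_integral_lebesgue')
    show "((\<lambda>y. (1 - y ^ m) ^ Suc a * y powr real b / Suc a) has_integral
        (fact (Suc a) / (?P)) / Suc a) {0..1}"
      by (intro has_integral_divide beta_has_integral m) auto
    show "0 \<le> (1 - y ^ m) ^ Suc a * y powr real b / Suc a" if "y \<in> {0..1}" for y
      using that by (auto simp: power_le_one)
  qed
  also have "fact (Suc a) / (?P) / Suc a =
      fact a / (real m * pochhammer ((real b + 1) / real m) (a + 2))"
    by (simp add: divide_simps)
  also have "ennreal pi * (ennreal pi * ennreal (fact a / (real m * pochhammer ((real b + 1) / real m) (a + 2)))) =
      ennreal (pi\<^sup>2 * (fact a / (real m * pochhammer ((real b + 1) / real m) (a + 2))))"
    by (simp only: power2_eq_square mult.assoc ennreal_mult' pi_ge_zero)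
  finally show ?thesis .
qed

definition bergman_coeff :: "nat \<Rightarrow> nat \<times> nat \<Rightarrow> real" where
  "bergman_coeff m i = real m / pi\<^sup>2 * (pochhammer ((real (snd i) + 1) / real m) (fst i + 2) / fact (fst i))"

lemma bergman_coeff_pos: "m \<ge> 1 \<Longrightarrow> bergman_coeff m i > 0"
  unfolding bergman_coeff_def
  by (intro mult_pos_pos divide_pos_pos pochhammer_pos) auto

lemma integral_norm_mon_egg:
  assumes m: "m \<ge> 1"
  shows "(\<integral>x. (cmod (mon i x))\<^sup>2 \<partial>restrict_space lborel (egg m)) = 1 / bergman_coeff m i"
proof -
  obtain a b where i: "i = (a, b)" by force
  have "(\<integral>x. (cmod (mon i x))\<^sup>2 \<partial>restrict_space lborel (egg m)) = (\<integral>x. indicator (egg m) x * (cmod (mon i x))\<^sup>2 \<partial>lborel)"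
    by (subst integral_restrict_space) auto
  also have "\<dots> = 1 / bergman_coeff m i"
  proof (rule integral_eq_nn_integral[THEN trans])
    show "(\<lambda>x. indicator (egg m) x * (cmod (mon i x))\<^sup>2) \<in> borel_measurable lborel" by measurable
    have "(\<integral>\<^sup>+x. ennreal (indicator (egg m) x * (cmod (mon i x))\<^sup>2) \<partial>lborel) =
        (\<integral>\<^sup>+p. ennreal ((cmod (mon (a, b) p))\<^sup>2) * indicator (egg m) p \<partial>lborel)"
      by (intro nn_integral_cong) (auto simp: i split: split_indicator)
    also have "\<dots> = ennreal (1 / bergman_coeff m i)"
      unfolding nn_integral_mon_egg[OF m] by (simp add: bergman_coeff_def i)
    finally show "enn2real (\<integral>\<^sup>+x. ennreal (indicator (egg m) x * (cmod (mon i x))\<^sup>2) \<partial>lborel) = 1 / bergman_coeff m i"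
      using bergman_coeff_pos[OF m, of i] by simp
  qed auto
  finally show ?thesis .
qed

lemma egg_measure_lborel:
  assumes m: "m \<ge> 1" and E: "E \<in> sets borel" "E \<subseteq> closed_egg m"
    "\<And>p q. cmod (fst p) = cmod (fst q) \<Longrightarrow> cmod (snd p) = cmod (snd q) \<Longrightarrow> p \<in> E \<longleftrightarrow> q \<in> E"
  shows "egg_measure (restrict_space lborel E) m"
proof -
  have "bounded E"
    using E(2) compact_imp_bounded[OF compact_closed_egg[OF m]] bounded_subset by blast
  then have fin: "emeasure lborel E < \<infinity>" by (rule emeasure_bounded_finite)
  interpret finite_measure "restrict_space lborel E"
    by standard (use fin E(1) in \<open>simp add: emeasure_restrict_space space_restrict_space\<close>)
  show ?thesis
  proof
    show "m \<ge> 1" by (rule m)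
    show "space (restrict_space lborel E) \<subseteq> closed_egg m"
      using E(2) by (simp add: space_restrict_space)
    show "(\<lambda>x. x) \<in> restrict_space lborel E \<rightarrow>\<^sub>M borel"
      by (rule measurable_restrict_space1) simp
    show "(\<integral>x. mon i x * cnj (mon j x) \<partial>restrict_space lborel E) = 0" if "i \<noteq> j" for i j
      using mon_orthogonal_lborel[OF E(1,3) that] E(1) by (subst integral_restrict_space) auto
  qed
qed

text \<open>With \<open>\<beta> = (b + 1)/m\<close> the Pochhammer symbol of length
  \<open>a + 2\<close> is \<open>\<beta> (\<beta> + 1)\<close> times one of length \<open>a\<close>
  starting at \<open>\<beta> + 2\<close>. The split factor is
  \<open>(b + 1)(b + 1 + m) / m^2\<close>, to be compared with \<open>(b + 1)(b + 2) / 2\<close>,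
  the b-th coefficient of \<open>(1 - t)^(-3)\<close>; the constants come from
  \<open>b + 2 \<le> b + 1 + m \<le> m (b + 2)\<close>.\<close>

lemma kernel_weights_bergman:
  assumes m: "m \<ge> 1"
  obtains u c1 c2 where "kernel_weights m (2 + 1 / real m) 3 u c1 c2 (bergman_coeff m)"
proof -
  define \<kappa> where "\<kappa> = real m / pi\<^sup>2"
  have \<kappa>: "\<kappa> > 0" using m by (simp add: \<kappa>_def)
  define \<beta> where "\<beta> b = (real b + 1) / real m" for b :: nat
  define u where "u b = \<kappa> * (\<beta> b * (\<beta> b + 1))" for b
  have ub: "u b = \<kappa> / (real m)\<^sup>2 * ((real b + 1) * (real b + 1 + real m))" for b
    using m by (simp add: u_def \<beta>_def field_simps power2_eq_square)
  have p3: "pochhammer (3::real) b / fact b = (real b + 1) * (real b + 2) / 2" for b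
    using pochhammer_rec[of "1::real" "Suc b"] pochhammer_rec[of "2::real" b]
      pochhammer_fact[of "Suc (Suc b)", where 'a = real] by (simp add: field_simps)
  have "kernel_weights m (2 + 1 / real m) 3 u (2 * \<kappa> / (real m)\<^sup>2) (2 * \<kappa> / (real m)\<^sup>2 * real m) (bergman_coeff m)"
  proof
    show "m \<ge> 1" "(1::nat) \<le> 3" by (use m in auto)
    show "0 < 2 + 1 / real m" using m by (simp add: add_pos_pos)
    show c: "0 < 2 * \<kappa> / (real m)\<^sup>2" using \<kappa> m by simp
    show "2 * \<kappa> / (real m)\<^sup>2 \<le> 2 * \<kappa> / (real m)\<^sup>2 * real m"
      using mult_left_mono[of 1 "real m" "2 * \<kappa> / (real m)\<^sup>2"] c m by simp
    fix a b
    have "(real b + 1) * (real b + 2) \<le> (real b + 1) * (real b + 1 + real m)"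
      using m by (intro mult_left_mono) auto
    from mult_left_mono[OF this, of "\<kappa> / (real m)\<^sup>2"]
    show "2 * \<kappa> / (real m)\<^sup>2 * (pochhammer (real 3) b / fact b) \<le> u b"
      using \<kappa> by (simp add: p3 ub)
    have "real b + 1 + real m \<le> real m * (real b + 2)"
      using m mult_right_mono[of 1 "real m" "real b + 1"] by (simp add: algebra_simps)
    then have "(real b + 1) * (real b + 1 + real m) \<le> (real b + 1) * (real m * (real b + 2))"
      by (intro mult_left_mono) auto
    then have le: "\<kappa> / (real m)\<^sup>2 * ((real b + 1) * (real b + 1 + real m)) \<le> \<kappa> / (real m)\<^sup>2 * ((real b + 1) * (real m * (real b + 2)))"
      using \<kappa> by (intro mult_left_mono) auto
    have aux: "2 * k / M * r * (A * B / 2) = k / M * (A * (r * B))" for k M r A B :: real by simp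
    show "u b \<le> 2 * \<kappa> / (real m)\<^sup>2 * real m * (pochhammer (real 3) b / fact b)"
    proof -
      have "2 * \<kappa> / (real m)\<^sup>2 * real m * ((real b + 1) * (real b + 2) / 2) = \<kappa> / (real m)\<^sup>2 * ((real b + 1) * (real m * (real b + 2)))"
        by (rule aux)
      then show ?thesis
        using le by (simp only: p3 ub of_nat_numeral)
    qed
    have e: "\<beta> b + 1 + 1 = 2 + 1 / real m + real b / real m"
      by (simp add: \<beta>_def add_divide_distrib)
    have "pochhammer (\<beta> b) (a + 2) = \<beta> b * ((\<beta> b + 1) * pochhammer (\<beta> b + 1 + 1) a)"
      by (simp only: add_2_eq_Suc' pochhammer_rec)
    then show "bergman_coeff m (a, b) = u b * (pochhammer (2 + 1 / real m + real b / real m) a / fact a)"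
      unfolding bergman_coeff_def u_def \<kappa>_def fst_conv snd_conv \<beta>_def[symmetric] e by simp
  qed
  then show ?thesis by (rule that)
qed

section \<open>Radii and approach regions\<close>


text \<open>Half the real gradient of \<open>rho m\<close>: the outer normal before normalization,
  in a form that is visibly continuous.\<close>

definition half_grad :: "nat \<Rightarrow> complex \<times> complex \<Rightarrow> complex \<times> complex" where
  "half_grad m p = (fst p, of_real (real m * cmod (snd p) ^ (2 * m - 2)) * snd p)"

lemma half_grad_eq: "half_grad m p = (d_bar (1, 0) (rhoC m) p, d_bar (0, 1) (rhoC m) p)"
proof -
  have "2 * m - 2 = 2 * (m - 1)" by simp
  then have "complex_of_real (cmod (snd p) ^ (2 * m - 2)) = complex_of_real ((cmod (snd p))\<^sup>2) ^ (m - 1)"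
    by (simp only: power_mult of_real_power)
  then have "(snd p * cnj (snd p)) ^ (m - 1) = complex_of_real (cmod (snd p) ^ (2 * m - 2))"
    by (simp only: complex_norm_square)
  then show ?thesis unfolding half_grad_def d_rho by (simp only: of_real_mult of_real_of_nat_eq)
qed

lemma d_rho_norm_eq_norm: "d_rho_norm m p = norm (half_grad m p)"
proof -
  have "d_hol (1, 0) (rhoC m) p = cnj (d_bar (1, 0) (rhoC m) p)" "d_hol (0, 1) (rhoC m) p = cnj (d_bar (0, 1) (rhoC m) p)"
    by (simp_all add: d_rho mult.commute[of "cnj (snd p)"])
  then show ?thesis
    unfolding d_rho_norm_def half_grad_eq norm_Pair by (simp only: complex_mod_cnj)
qed

lemma outer_normal_eq: "outer_normal m p = (1 / norm (half_grad m p)) *\<^sub>R half_grad m p"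
  unfolding outer_normal_def d_rho_norm_eq_norm half_grad_eq ..

lemma continuous_on_half_grad [continuous_intros]: "continuous_on A (half_grad m)"
  unfolding half_grad_def by (intro continuous_intros)

text \<open>Half the derivative of \<open>rho m\<close> along the radius through p, at p
  itself.\<close>

definition radial_deriv :: "nat \<Rightarrow> complex \<times> complex \<Rightarrow> real" where
  "radial_deriv m p = (cmod (fst p))\<^sup>2 + real m * cmod (snd p) ^ (2 * m)"

text \<open>Each coordinate of \<open>half_grad\<close> is a real multiple of the same coordinate of
  p, so the complex pairing with p is real and coincides with the Euclidean one.\<close>

lemma half_grad_inner:
  assumes m: "m \<ge> 1"
  shows "p \<bullet> half_grad m p = radial_deriv m p"
    and "cdot p (conj2 (half_grad m p)) = of_real (radial_deriv m p)"
proof -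
  have e: "cmod w ^ (2 * m - 2) * (cmod w)\<^sup>2 = cmod w ^ (2 * m)" for w
    using m by (cases m) (auto simp: power_add power2_eq_square)
  have "z \<bullet> (of_real c * z) = c * (cmod z)\<^sup>2" for z :: complex and c
    by (simp add: power2_norm_eq_inner flip: scaleR_conv_of_real)
  from this[of "fst p" 1] this[of "snd p" "real m * cmod (snd p) ^ (2 * m - 2)"]
  show "p \<bullet> half_grad m p = radial_deriv m p"
    by (simp add: half_grad_def radial_deriv_def inner_prod_def mult.assoc e)
  have "z * cnj (of_real c * z) = of_real (c * (cmod z)\<^sup>2)" for z :: complex and c
    by (simp only: of_real_mult complex_norm_square complex_cnj_mult complex_cnj_complex_of_real mult_ac)
  from this[of "fst p" 1] this[of "snd p" "real m * cmod (snd p) ^ (2 * m - 2)"]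
  show "cdot p (conj2 (half_grad m p)) = of_real (radial_deriv m p)"
    by (simp add: half_grad_def radial_deriv_def cdot_def conj2_def mult.assoc e del: complex_cnj_mult)
qed

lemma frontier_egg_sum:
  assumes "m \<ge> 1" "\<xi> \<in> frontier (egg m)"
  shows "(cmod (fst \<xi>))\<^sup>2 + cmod (snd \<xi>) ^ (2 * m) = 1"
  using frontier_rho[OF assms] by (auto simp: rho_def case_prod_unfold)

lemma frontier_subset_closed_egg: "m \<ge> 1 \<Longrightarrow> frontier (egg m) \<subseteq> closed_egg m"
  using frontier_rho by (fastforce simp: closed_egg_eq_rho)

lemma radial_deriv_ge_1:
  assumes "m \<ge> 1" "\<xi> \<in> frontier (egg m)"
  shows "radial_deriv m \<xi> \<ge> 1"
proof -
  have "1 * cmod (snd \<xi>) ^ (2 * m) \<le> real m * cmod (snd \<xi>) ^ (2 * m)"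
    using assms(1) by (intro mult_right_mono) auto
  then show ?thesis using frontier_egg_sum[OF assms] by (simp add: radial_deriv_def)
qed

lemma norm_closed_egg:
  assumes "m \<ge> 1" "p \<in> closed_egg m"
  shows "norm p \<le> 2"
proof -
  have "norm p \<le> cmod (fst p) + cmod (snd p)"
    using norm_triangle_ineq[of "(fst p, 0)" "(0, snd p)"] by (simp add: norm_Pair)
  then show ?thesis using closed_egg_norm_le[OF assms] by simp
qed

text \<open>The radial derivative is at least 1 and points of the closed egg have norm at most 2, so
  Cauchy-Schwarz keeps the gradient away from 0. The bounds make the estimates on approach regions
  uniform in the boundary point.\<close>

lemma half_grad_norm_bounds:
  assumes m: "m \<ge> 1" and \<xi>: "\<xi> \<in> frontier (egg m)"
  shows "1 / 2 \<le> norm (half_grad m \<xi>)" "norm (half_grad m \<xi>) \<le> 1 + real m"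
proof -
  note cl = subsetD[OF frontier_subset_closed_egg[OF m] \<xi>]
  have "1 \<le> norm \<xi> * norm (half_grad m \<xi>)"
    using radial_deriv_ge_1[OF m \<xi>] half_grad_inner(1)[OF m, of \<xi>] norm_cauchy_schwarz[of \<xi> "half_grad m \<xi>"] by simp
  also have "\<dots> \<le> 2 * norm (half_grad m \<xi>)"
    by (intro mult_right_mono norm_closed_egg[OF m cl]) simp
  finally show "1 / 2 \<le> norm (half_grad m \<xi>)" by simp
  have "norm (half_grad m \<xi>) \<le> cmod (fst (half_grad m \<xi>)) + cmod (snd (half_grad m \<xi>))"
    using norm_triangle_ineq[of "(fst (half_grad m \<xi>), 0)" "(0, snd (half_grad m \<xi>))"] by (simp add: norm_Pair)
  also have "\<dots> = cmod (fst \<xi>) + real m * (cmod (snd \<xi>) ^ (2 * m - 2) * cmod (snd \<xi>))"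
    by (simp add: half_grad_def norm_mult norm_power)
  also have "\<dots> \<le> 1 + real m * 1"
    using closed_egg_norm_le[OF m cl] by (intro add_mono mult_left_mono mult_le_one power_le_one) auto
  finally show "norm (half_grad m \<xi>) \<le> 1 + real m" by simp
qed

section \<open>Convexity and the distance to the boundary\<close>

lemma power_diff_le_tangent:
  fixes u v :: real
  assumes "0 \<le> u" "0 \<le> v"
  shows "u ^ n - v ^ n \<le> real n * u ^ (n - 1) * (u - v)"
proof (induction n)
  case (Suc k)
  have "u ^ Suc k - v ^ Suc k = u ^ k * (u - v) + v * (u ^ k - v ^ k)" by (simp add: algebra_simps)
  also have "\<dots> \<le> u ^ k * (u - v) + v * (real k * u ^ (k - 1) * (u - v))"
    using assms by (intro add_left_mono mult_left_mono Suc) auto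
  also have "v * (real k * u ^ (k - 1) * (u - v)) \<le> u * (real k * u ^ (k - 1) * (u - v))"
  proof -
    have "(v - u) * (u - v) = - ((u - v)\<^sup>2)" by (simp add: power2_eq_square algebra_simps)
    then have "(v - u) * (u - v) \<le> 0" by simp
    then have "(real k * u ^ (k - 1)) * ((v - u) * (u - v)) \<le> 0"
      using assms by (simp only: mult_nonneg_nonpos mult_nonneg_nonneg of_nat_0_le_iff zero_le_power)
    then show ?thesis by (simp add: algebra_simps)
  qed
  also have "u ^ k * (u - v) + u * (real k * u ^ (k - 1) * (u - v)) = real (Suc k) * u ^ (Suc k - 1) * (u - v)"
    by (cases k) (auto simp: algebra_simps)
  finally show ?case by simp
qed simp

text \<open>Convexity of \<open>rho m\<close>, with the gradient taken at q. For q on the boundary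
  and p inside it turns the depth \<open>- rho m p\<close> into a lower bound for the distance to
  q.\<close>

lemma rho_convex:
  assumes m: "m \<ge> 1"
  shows "rho m q - rho m p \<le> 2 * (half_grad m q \<bullet> (q - p))"
proof -
  have 1: "(cmod a)\<^sup>2 - (cmod b)\<^sup>2 \<le> 2 * (a \<bullet> (a - b))" for a b :: complex
    using zero_le_power2[of "norm (a - b)"] unfolding power2_norm_eq_inner
    by (simp add: inner_diff_left inner_diff_right inner_commute)
  have 2: "cmod a ^ (2 * m) - cmod b ^ (2 * m) \<le> 2 * ((of_real (real m * cmod a ^ (2 * m - 2)) * a) \<bullet> (a - b))" for a b :: complex
  proof -
    define u v where "u = cmod a" and "v = cmod b"
    have "u ^ (2 * m) - v ^ (2 * m) \<le> real (2 * m) * u ^ (2 * m - 1) * (u - v)"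
      by (rule power_diff_le_tangent) (auto simp: u_def v_def)
    also have "u ^ (2 * m - 1) = u ^ (2 * m - 2) * u"
      using m by (cases m) auto
    also have "real (2 * m) * (u ^ (2 * m - 2) * u) * (u - v) = 2 * (real m * u ^ (2 * m - 2)) * (u\<^sup>2 - u * v)"
      by (simp add: algebra_simps power2_eq_square)
    also have "\<dots> \<le> 2 * (real m * u ^ (2 * m - 2)) * (a \<bullet> (a - b))"
    proof (rule mult_left_mono)
      show "u\<^sup>2 - u * v \<le> a \<bullet> (a - b)"
        using norm_cauchy_schwarz[of a b] unfolding u_def v_def power2_norm_eq_inner
        by (simp add: inner_diff_right)
    qed (simp add: u_def)
    also have "\<dots> = 2 * ((of_real (real m * u ^ (2 * m - 2)) * a) \<bullet> (a - b))"
      by (simp only: scaleR_conv_of_real[symmetric] inner_scaleR_left mult.assoc)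
    finally show ?thesis unfolding u_def v_def .
  qed
  show ?thesis
    using 1[of "fst q" "fst p"] 2[of "snd q" "snd p"]
    by (simp add: rho_def case_prod_unfold half_grad_def inner_prod_def)
qed

text \<open>The tangent inequality for the exponents 2 and \<open>2 m\<close>, with r weakened to
  \<open>r ^ (2 * m - 1)\<close> in the former so that both share one factor.\<close>

lemma rho_scaled:
  assumes m: "m \<ge> 1" and \<xi>: "\<xi> \<in> frontier (egg m)" and r: "0 \<le> r" "r \<le> 1"
  shows "2 * (1 - r) * r ^ (2 * m - 1) * radial_deriv m \<xi> \<le> - rho m (r *\<^sub>R \<xi>)"
proof -
  define x y where "x = (cmod (fst \<xi>))\<^sup>2" and "y = cmod (snd \<xi>) ^ (2 * m)"
  have xy: "0 \<le> x" "0 \<le> y" "x + y = 1" using frontier_egg_sum[OF m \<xi>] by (auto simp: x_def y_def)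
  have t: "real n * r ^ (n - 1) * (1 - r) \<le> 1 - r ^ n" for n
    using power_diff_le_tangent[of r 1 n] r by (simp add: algebra_simps)
  have "r ^ (2 * m - 1) \<le> r ^ 1" using r m by (intro power_decreasing) auto
  then have "2 * r ^ (2 * m - 1) * (1 - r) \<le> 2 * r * (1 - r)"
    using r by (intro mult_right_mono mult_left_mono) auto
  also have "\<dots> \<le> 1 - r\<^sup>2" using t[of 2] by simp
  finally have "2 * r ^ (2 * m - 1) * (1 - r) * x \<le> (1 - r\<^sup>2) * x"
    using xy by (intro mult_right_mono) auto
  moreover have "real (2 * m) * r ^ (2 * m - 1) * (1 - r) * y \<le> (1 - r ^ (2 * m)) * y"
    using xy by (intro mult_right_mono t) auto
  moreover have "- rho m (r *\<^sub>R \<xi>) = (1 - r\<^sup>2) * x + (1 - r ^ (2 * m)) * y"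
    using r xy by (simp add: rho_def case_prod_unfold power_mult_distrib x_def y_def algebra_simps)
  ultimately show ?thesis
    by (simp add: radial_deriv_def x_def y_def algebra_simps)
qed

lemma dist_frontier_lower:
  assumes m: "m \<ge> 1" and \<xi>: "\<xi> \<in> frontier (egg m)" and \<eta>: "\<eta> \<in> frontier (egg m)" and r: "0 \<le> r" "r \<le> 1"
  shows "(1 - r) * r ^ (2 * m - 1) * radial_deriv m \<xi> \<le> norm (half_grad m \<eta>) * dist (r *\<^sub>R \<xi>) \<eta>"
proof -
  have "2 * (1 - r) * r ^ (2 * m - 1) * radial_deriv m \<xi> \<le> rho m \<eta> - rho m (r *\<^sub>R \<xi>)"
    using rho_scaled[OF m \<xi> r] frontier_rho[OF m \<eta>] by simp
  also have "\<dots> \<le> 2 * (half_grad m \<eta> \<bullet> (\<eta> - r *\<^sub>R \<xi>))" by (rule rho_convex[OF m])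
  also have "\<dots> \<le> 2 * (norm (half_grad m \<eta>) * norm (\<eta> - r *\<^sub>R \<xi>))"
    using norm_cauchy_schwarz by (intro mult_left_mono) auto
  finally have "2 * ((1 - r) * r ^ (2 * m - 1) * radial_deriv m \<xi>) \<le> 2 * (norm (half_grad m \<eta>) * norm (\<eta> - r *\<^sub>R \<xi>))"
    by (simp only: mult.assoc)
  then show ?thesis unfolding dist_norm norm_minus_commute[of "r *\<^sub>R \<xi>"] by linarith
qed

lemma infdist_hyperplane:
  fixes \<nu> :: "'a :: real_inner"
  assumes "norm \<nu> = 1"
  shows "infdist p {q. (q - \<xi>) \<bullet> \<nu> = 0} = \<bar>(p - \<xi>) \<bullet> \<nu>\<bar>"
proof (rule antisym)
  let ?H = "{q. (q - \<xi>) \<bullet> \<nu> = 0}"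
  define f where "f = p - ((p - \<xi>) \<bullet> \<nu>) *\<^sub>R \<nu>"
  have nn: "\<nu> \<bullet> \<nu> = 1" using assms by (simp flip: power2_norm_eq_inner)
  have "f \<in> ?H" by (simp add: f_def inner_diff_left nn)
  then have "infdist p ?H \<le> dist p f" by (rule infdist_le)
  also have "\<dots> = \<bar>(p - \<xi>) \<bullet> \<nu>\<bar>" using assms by (simp add: f_def dist_norm)
  finally show "infdist p ?H \<le> \<bar>(p - \<xi>) \<bullet> \<nu>\<bar>" .
  have "?H \<noteq> {}" using \<open>f \<in> ?H\<close> by auto
  then show "\<bar>(p - \<xi>) \<bullet> \<nu>\<bar> \<le> infdist p ?H"
    unfolding infdist_notempty[OF \<open>?H \<noteq> {}\<close>]
  proof (rule cINF_greatest)
    fix q assume "q \<in> ?H"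
    then have "(p - \<xi>) \<bullet> \<nu> = (p - q) \<bullet> \<nu>" by (simp add: inner_diff_left)
    then show "\<bar>(p - \<xi>) \<bullet> \<nu>\<bar> \<le> dist p q"
      using Cauchy_Schwarz_ineq2[of "p - q" \<nu>] assms by (simp add: dist_norm)
  qed
qed

lemma norm_outer_normal:
  assumes "m \<ge> 1" "\<xi> \<in> frontier (egg m)"
  shows "norm (outer_normal m \<xi>) = 1"
proof -
  have "half_grad m \<xi> \<noteq> 0" using half_grad_norm_bounds(1)[OF assms] by auto
  then show ?thesis by (simp add: outer_normal_eq)
qed

lemma delta_eq:
  assumes "m \<ge> 1" "\<xi> \<in> frontier (egg m)"
  shows "delta m \<xi> p = min (infdist p (frontier (egg m))) \<bar>(p - \<xi>) \<bullet> outer_normal m \<xi>\<bar>"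
  unfolding delta_def tangent_plane_def infdist_hyperplane[OF norm_outer_normal[OF assms]] ..

lemma compact_frontier_egg: "m \<ge> 1 \<Longrightarrow> compact (frontier (egg m))"
  using compact_Int_closed[OF compact_closed_egg frontier_closed, of m "egg m"] frontier_subset_closed_egg[of m]
  by (simp add: inf_absorb2)

text \<open>The distance to the boundary is compared with the distance
  \<open>(1 - r) * radial_deriv m \<xi> / norm (half_grad m \<xi>)\<close> to the tangent plane.
  Convexity bounds the distance to a boundary point \<eta> in terms of the gradient at \<eta>; close
  to \<xi>, uniform continuity exchanges it for the gradient at \<xi>.\<close>

lemma infdist_frontier_lower:
  assumes m: "m \<ge> 1" and \<theta>: "0 < \<theta>" "\<theta> < 1"
  obtains r0 where "0 \<le> r0" "r0 < 1"
    "\<And>r \<xi>. r0 < r \<Longrightarrow> r < 1 \<Longrightarrow> \<xi> \<in> frontier (egg m) \<Longrightarrow>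
       \<theta> * ((1 - r) * radial_deriv m \<xi> / norm (half_grad m \<xi>)) \<le> infdist (r *\<^sub>R \<xi>) (frontier (egg m))"
proof -
  \<comment> \<open>The loss \<theta> is shared equally: one factor \<kappa> for
    \<open>r ^ (2 * m - 1)\<close>, one for replacing the gradient at \<eta> by that at
    \<xi>.\<close>
  define \<kappa> where "\<kappa> = sqrt \<theta>"
  have \<kappa>: "0 < \<kappa>" "\<kappa> < 1" "\<kappa> * \<kappa> = \<theta>" using \<theta> by (auto simp: \<kappa>_def)
  \<comment> \<open>Since the gradient has norm at least 1/2, an additive error \<epsilon> is a
    relative error of at most \<open>1 / \<kappa> - 1\<close>.\<close>
  define \<epsilon> where "\<epsilon> = (1 / \<kappa> - 1) / 2"
  have \<epsilon>: "\<epsilon> > 0" using \<kappa> by (simp add: \<epsilon>_def)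
  have "uniformly_continuous_on (frontier (egg m)) (\<lambda>\<xi>. norm (half_grad m \<xi>))"
    by (intro compact_uniformly_continuous continuous_intros compact_frontier_egg m)
  then obtain d where d: "d > 0" "\<And>\<xi> \<eta>. \<xi> \<in> frontier (egg m) \<Longrightarrow> \<eta> \<in> frontier (egg m) \<Longrightarrow> dist \<eta> \<xi> < d \<Longrightarrow>
      dist (norm (half_grad m \<eta>)) (norm (half_grad m \<xi>)) < \<epsilon>"
    using \<epsilon> unfolding uniformly_continuous_on_def by metis
  have "((\<lambda>r::real. r ^ (2 * m - 1)) \<longlongrightarrow> 1 ^ (2 * m - 1)) (at 1)"
    by (intro tendsto_intros)
  then have "\<forall>\<^sub>F r in at (1::real). \<kappa> < r ^ (2 * m - 1)"
    using \<kappa> by (intro order_tendstoD) auto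
  then obtain d2 where d2: "d2 > 0" "\<And>r::real. r \<noteq> 1 \<Longrightarrow> dist r 1 < d2 \<Longrightarrow> \<kappa> < r ^ (2 * m - 1)"
    unfolding eventually_at by auto
  \<comment> \<open>As norms are at most 2, a boundary point nearer to
    \<open>r *\<^sub>R \<xi>\<close> than \<xi> is at most \<open>4 * (1 - r)\<close> away from
    \<xi>; hence the quarter of d.\<close>
  define r0 where "r0 = max 0 (1 - min (d / 4) d2)"
  have r0: "0 \<le> r0" "r0 < 1" using d d2 by (auto simp: r0_def)
  show ?thesis
  proof (rule that[OF r0])
    fix r \<xi> assume r: "r0 < r" "r < 1" and \<xi>: "\<xi> \<in> frontier (egg m)"
    let ?D = "norm (half_grad m \<xi>)" and ?E = "radial_deriv m \<xi>"
    have r': "0 < r" "4 * (1 - r) < d" "dist r 1 < d2" using r r0 by (auto simp: r0_def dist_real_def)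
    have rk: "\<kappa> < r ^ (2 * m - 1)" using d2(2)[of r] r r' by auto
    define h where "h = ?E / ?D"
    have D: "?D \<ge> 1 / 2" by (rule half_grad_norm_bounds[OF m \<xi>])
    have E: "?E \<ge> 1" by (rule radial_deriv_ge_1[OF m \<xi>])
    have h0: "h > 0" unfolding h_def by (rule divide_pos_pos) (use D E in linarith)+
    have nx: "norm \<xi> \<le> 2" by (rule norm_closed_egg[OF m subsetD[OF frontier_subset_closed_egg[OF m] \<xi>]])
    have hx: "h \<le> norm \<xi>"
    proof -
      have "0 < ?D" using D by linarith
      then show ?thesis
        using half_grad_inner(1)[OF m, of \<xi>] norm_cauchy_schwarz[of \<xi> "half_grad m \<xi>"]
        unfolding h_def by (simp only: pos_divide_le_eq)
    qed
    have key: "\<theta> * ((1 - r) * h) \<le> dist (r *\<^sub>R \<xi>) \<eta>" if \<eta>: "\<eta> \<in> frontier (egg m)" for \<eta>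
    \<comment> \<open>Points \<eta> that are no nearer than \<xi> satisfy the bound because
      \<open>h \<le> norm \<xi>\<close>; all others are close to \<xi>.\<close>
    proof (cases "(1 - r) * norm \<xi> \<le> dist (r *\<^sub>R \<xi>) \<eta>")
      case True
      have "\<theta> * ((1 - r) * h) \<le> 1 * ((1 - r) * norm \<xi>)"
        using \<theta> r h0 hx by (intro mult_mono mult_left_mono) auto
      with True show ?thesis by simp
    next
      case False
      have "dist \<xi> (r *\<^sub>R \<xi>) = norm ((1 - r) *\<^sub>R \<xi>)" by (simp add: dist_norm algebra_simps)
      also have "\<dots> = (1 - r) * norm \<xi>" using r by simp
      finally have "dist \<eta> \<xi> \<le> 2 * ((1 - r) * norm \<xi>)"
        using False dist_triangle[of \<eta> \<xi> "r *\<^sub>R \<xi>"] by (simp add: dist_commute)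
      also have "\<dots> \<le> 2 * ((1 - r) * 2)" using r nx by (intro mult_left_mono) auto
      finally have "dist \<eta> \<xi> < d" using r' by simp
      from d(2)[OF \<xi> \<eta> this] have "norm (half_grad m \<eta>) < ?D + \<epsilon>"
        by (simp add: dist_real_def)
      also have "\<epsilon> \<le> (1 / \<kappa> - 1) * ?D"
        using mult_left_mono[OF D, of "1 / \<kappa> - 1"] \<kappa> by (simp add: \<epsilon>_def)
      finally have De: "norm (half_grad m \<eta>) \<le> ?D / \<kappa>" by (simp add: algebra_simps)
      have "\<kappa> * ((1 - r) * ?E) \<le> r ^ (2 * m - 1) * ((1 - r) * ?E)"
        using rk r E by (intro mult_right_mono) auto
      also have "\<dots> \<le> norm (half_grad m \<eta>) * dist (r *\<^sub>R \<xi>) \<eta>"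
        using dist_frontier_lower[OF m \<xi> \<eta>, of r] r r' by (simp add: mult_ac)
      also have "\<dots> \<le> ?D / \<kappa> * dist (r *\<^sub>R \<xi>) \<eta>"
        by (intro mult_right_mono De) simp
      finally have "\<kappa> * (\<kappa> * ((1 - r) * ?E)) \<le> ?D * dist (r *\<^sub>R \<xi>) \<eta>"
        using \<kappa> by (simp add: field_simps)
      then have "\<theta> * ((1 - r) * ?E) \<le> ?D * dist (r *\<^sub>R \<xi>) \<eta>"
        by (simp add: \<kappa>(3)[symmetric] mult.assoc)
      moreover have "0 < ?D" using D by linarith
      ultimately have "\<theta> * ((1 - r) * ?E) / ?D \<le> dist (r *\<^sub>R \<xi>) \<eta>"
        by (simp only: pos_divide_le_eq mult.commute)
      then show ?thesis by (simp add: h_def)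
    qed
    have ne: "frontier (egg m) \<noteq> {}" using \<xi> by auto
    have "\<theta> * ((1 - r) * h) \<le> infdist (r *\<^sub>R \<xi>) (frontier (egg m))"
      unfolding infdist_notempty[OF ne] by (rule cINF_greatest[OF ne key])
    then show "\<theta> * ((1 - r) * radial_deriv m \<xi> / norm (half_grad m \<xi>)) \<le> infdist (r *\<^sub>R \<xi>) (frontier (egg m))"
      by (simp add: h_def)
  qed
qed

text \<open>Along the radius the complex normal displacement is real and equals the distance to the
  tangent plane, so that the aperture \<open>1 + \<alpha> > 1\<close> leaves room for the error in the distance
  to the boundary.\<close>

lemma radius_in_approach_region:
  assumes m: "m \<ge> 1" and \<alpha>: "\<alpha> > 0"
  obtains r0 where "0 \<le> r0" "r0 < 1"
    "\<And>r \<xi>. r0 < r \<Longrightarrow> r < 1 \<Longrightarrow> \<xi> \<in> frontier (egg m) \<Longrightarrow> r *\<^sub>R \<xi> \<in> approach_region \<alpha> m \<xi>"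
proof -
  \<comment> \<open>The denominator is the midpoint between 1 and \<open>1 + \<alpha>\<close>, so
    that \<open>\<theta> < 1\<close> and \<open>(1 + \<alpha>) * \<theta> > 1\<close> hold
    together.\<close>
  define \<theta> where "\<theta> = 1 / (1 + \<alpha> / 2)"
  have \<theta>: "0 < \<theta>" "\<theta> < 1" "1 < (1 + \<alpha>) * \<theta>" using \<alpha> by (auto simp: \<theta>_def field_simps)
  obtain r1 where r1: "0 \<le> r1" "r1 < 1"
    "\<And>r \<xi>. r1 < r \<Longrightarrow> r < 1 \<Longrightarrow> \<xi> \<in> frontier (egg m) \<Longrightarrow>
       \<theta> * ((1 - r) * radial_deriv m \<xi> / norm (half_grad m \<xi>)) \<le> infdist (r *\<^sub>R \<xi>) (frontier (egg m))"
    using infdist_frontier_lower[OF m \<theta>(1,2)] by blast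
  \<comment> \<open>The second bound serves the quadratic condition: it makes
    \<open>4 * (1 - r)\<close> smaller than \<open>\<alpha> * \<theta> / (1 + real m)\<close>, and
    \<open>1 / (1 + real m)\<close> is a lower bound for the quotient \<open>h\<close>
    below.\<close>
  define r0 where "r0 = max r1 (1 - \<alpha> * \<theta> / (4 * (1 + real m)))"
  have "0 < \<alpha> * \<theta> / (4 * (1 + real m))" using \<alpha> \<theta> by (intro divide_pos_pos) auto
  then have r0: "0 \<le> r0" "r0 < 1" using r1 by (auto simp: r0_def)
  show ?thesis
  proof (rule that[OF r0])
    fix r \<xi> assume r: "r0 < r" "r < 1" and \<xi>: "\<xi> \<in> frontier (egg m)"
    let ?D = "norm (half_grad m \<xi>)" and ?E = "radial_deriv m \<xi>" and ?\<delta> = "delta m \<xi> (r *\<^sub>R \<xi>)"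
    define h where "h = ?E / ?D"
    have D: "?D \<ge> 1 / 2" "?D \<le> 1 + real m"
      using half_grad_norm_bounds[OF m \<xi>] by auto
    have E: "?E \<ge> 1" by (rule radial_deriv_ge_1[OF m \<xi>])
    have h: "h > 0" unfolding h_def by (rule divide_pos_pos) (use D E in linarith)+
    have "1 / (1 + real m) \<le> h" unfolding h_def using D E by (intro frac_le) auto
    have cl: "\<xi> \<in> closed_egg m" using frontier_subset_closed_egg[OF m] \<xi> by auto
    have nx: "norm \<xi> \<le> 2" by (rule norm_closed_egg[OF m cl])
    have diff: "\<xi> - r *\<^sub>R \<xi> = (1 - r) *\<^sub>R \<xi>" "r *\<^sub>R \<xi> - \<xi> = (- (1 - r)) *\<^sub>R \<xi>"
      by (simp_all add: algebra_simps)
    have "\<xi> \<bullet> outer_normal m \<xi> = h"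
      by (simp add: outer_normal_eq half_grad_inner(1)[OF m] h_def)
    then have tang: "\<bar>(r *\<^sub>R \<xi> - \<xi>) \<bullet> outer_normal m \<xi>\<bar> = (1 - r) * h"
      unfolding diff(2) using r h by (simp add: abs_mult)
    have "\<theta> * ((1 - r) * h) \<le> infdist (r *\<^sub>R \<xi>) (frontier (egg m))"
      using r1(3)[of r \<xi>] r \<xi> by (simp add: r0_def h_def)
    moreover have "\<theta> * ((1 - r) * h) \<le> 1 * ((1 - r) * h)"
      using \<theta> r h by (intro mult_right_mono) auto
    ultimately have del: "\<theta> * ((1 - r) * h) \<le> ?\<delta>"
      unfolding delta_eq[OF m \<xi>] tang by simp
    have pos: "0 < (1 - r) * h" using r h by simp
    have cd: "cdot (\<xi> - r *\<^sub>R \<xi>) (conj2 (outer_normal m \<xi>)) = of_real ((1 - r) * h)"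
    proof -
      have "cdot ((1 - r) *\<^sub>R \<xi>) (conj2 (c *\<^sub>R v)) = of_real ((1 - r) * c) * cdot \<xi> (conj2 v)" for c v
        by (simp add: cdot_def conj2_def scaleR_conv_of_real algebra_simps)
      then show ?thesis unfolding diff(1) outer_normal_eq
        by (simp add: half_grad_inner(2)[OF m] h_def)
    qed
    have "(1 - r) * h < (1 + \<alpha>) * \<theta> * ((1 - r) * h)"
      using mult_strict_right_mono[OF \<theta>(3) pos] by simp
    also have "\<dots> \<le> (1 + \<alpha>) * ?\<delta>"
      using mult_left_mono[OF del, of "1 + \<alpha>"] \<alpha> by (simp add: mult.assoc)
    finally have c1: "cmod (cdot (\<xi> - r *\<^sub>R \<xi>) (conj2 (outer_normal m \<xi>))) < (1 + \<alpha>) * ?\<delta>"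
      unfolding cd norm_of_real using pos by simp
    have "(norm (\<xi> - r *\<^sub>R \<xi>))\<^sup>2 = (1 - r) * ((1 - r) * (norm \<xi>)\<^sup>2)"
      unfolding diff(1) using r by (simp add: power_mult_distrib power2_eq_square)
    also have "\<dots> \<le> (1 - r) * ((1 - r) * 2\<^sup>2)"
      using r nx by (intro mult_left_mono power_mono) auto
    also have "\<dots> < (1 - r) * (\<alpha> * \<theta> * h)"
    proof (rule mult_strict_left_mono)
      have "(1 - r) * 2\<^sup>2 < \<alpha> * \<theta> * (1 / (1 + real m))"
        using r by (simp add: r0_def field_simps)
      also have "\<dots> \<le> \<alpha> * \<theta> * h"
        using \<alpha> \<theta> \<open>1 / (1 + real m) \<le> h\<close> by (intro mult_left_mono) auto
      finally show "(1 - r) * 2\<^sup>2 < \<alpha> * \<theta> * h" .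
    qed (use r in simp)
    also have "\<dots> \<le> \<alpha> * ?\<delta>"
      using mult_left_mono[OF del, of \<alpha>] \<alpha> by (simp add: mult_ac)
    finally have c2: "(norm (\<xi> - r *\<^sub>R \<xi>))\<^sup>2 < \<alpha> * ?\<delta>" .
    have "r *\<^sub>R \<xi> \<in> egg m" using r r0 by (intro scale_closed_egg m cl) auto
    with c1 c2 show "r *\<^sub>R \<xi> \<in> approach_region \<alpha> m \<xi>"
      by (simp add: approach_region_def)
  qed
qed

section \<open>Measurability of the maximal function\<close>

lemma continuous_on_outer_normal:
  assumes "m \<ge> 1"
  shows "continuous_on (frontier (egg m)) (outer_normal m)"
proof -
  have "norm (half_grad m \<xi>) \<noteq> 0" if "\<xi> \<in> frontier (egg m)" for \<xi>
    using half_grad_norm_bounds(1)[OF assms that] by auto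
  then have "continuous_on (frontier (egg m)) (\<lambda>p. (1 / norm (half_grad m p)) *\<^sub>R half_grad m p)"
    by (intro continuous_intros) auto
  then show ?thesis unfolding outer_normal_eq[abs_def] .
qed

text \<open>With p fixed and the boundary point varying, both conditions are strict inequalities
  between continuous functions, as \<open>delta_eq\<close> replaces the distance to the moving
  tangent plane by an inner product.\<close>

lemma openin_approach_region:
  assumes m: "m \<ge> 1"
  shows "openin (top_of_set (frontier (egg m))) {\<xi> \<in> frontier (egg m). p \<in> approach_region \<alpha> m \<xi>}"
proof (cases "p \<in> egg m")
  case True
  let ?F = "frontier (egg m)"
  define d where "d \<xi> = min (infdist p ?F) \<bar>(p - \<xi>) \<bullet> outer_normal m \<xi>\<bar>" for \<xi>
  define a where "a \<xi> = cmod (cdot (\<xi> - p) (conj2 (outer_normal m \<xi>))) - (1 + \<alpha>) * d \<xi>" for \<xi>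
  define b where "b \<xi> = (norm (\<xi> - p))\<^sup>2 - \<alpha> * d \<xi>" for \<xi>
  note ct = continuous_on_outer_normal[OF m]
  have cd: "continuous_on ?F d" unfolding d_def by (intro continuous_intros ct)
  have "continuous_on ?F a"
    unfolding a_def cdot_def conj2_def fst_conv snd_conv by (intro continuous_intros ct cd)
  moreover have "continuous_on ?F b" unfolding b_def by (intro continuous_intros cd)
  ultimately have "openin (top_of_set ?F) (?F \<inter> a -` {..<0})" "openin (top_of_set ?F) (?F \<inter> b -` {..<0})"
    by (auto intro!: continuous_openin_preimage_gen)
  then have "openin (top_of_set ?F) ((?F \<inter> a -` {..<0}) \<inter> (?F \<inter> b -` {..<0}))"
    by (rule openin_Int)
  also have "(?F \<inter> a -` {..<0}) \<inter> (?F \<inter> b -` {..<0}) = {\<xi> \<in> ?F. p \<in> approach_region \<alpha> m \<xi>}"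
    using True by (auto simp: approach_region_def a_def b_def d_def delta_eq[OF m])
  finally show ?thesis .
qed (simp add: approach_region_def)

text \<open>A superlevel set is a union over possibly uncountably many p, so it is the relative
  openness of each piece that makes it measurable; the maximal function is lower
  semicontinuous.\<close>

lemma nt_max_measurable:
  assumes m: "m \<ge> 1"
  shows "nt_max \<alpha> m f \<in> borel_measurable (sigma_F m)"
proof (rule borel_measurableI_greater)
  fix y :: ennreal
  let ?F = "frontier (egg m)"
  let ?S = "\<lambda>p. {\<xi> \<in> ?F. p \<in> approach_region \<alpha> m \<xi>}"
  have "{\<xi> \<in> space (sigma_F m). y < nt_max \<alpha> m f \<xi>} = (\<Union>p\<in>{p. y < ennreal (cmod (f p))}. ?S p)"
    by (auto simp: space_sigma_F nt_max_def less_SUP_iff)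
  moreover have "openin (top_of_set ?F) (\<Union>p\<in>{p. y < ennreal (cmod (f p))}. ?S p)"
    using openin_approach_region[OF m] by (intro openin_Union) auto
  ultimately obtain T where "open T" "{\<xi> \<in> space (sigma_F m). y < nt_max \<alpha> m f \<xi>} = ?F \<inter> T"
    unfolding openin_open by auto
  then show "{\<xi> \<in> space (sigma_F m). y < nt_max \<alpha> m f \<xi>} \<in> sets (sigma_F m)"
    unfolding sets_sigma_F sets_restrict_space by auto
qed

section \<open>The Szego and Bergman kernels on the diagonal\<close>


lemma bounded_holomorphic_in_fefferman_hardy:
  assumes m: "m \<ge> 1" and f: "holomorphic2_on f (egg m)" "\<And>p. p \<in> egg m \<Longrightarrow> cmod (f p) \<le> C"
  shows "f \<in> fefferman_hardy \<alpha> m"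
proof -
  interpret finite_measure "sigma_F m" by (rule finite_sigma_F[OF m])
  have "nt_max \<alpha> m f \<xi> \<le> ennreal C" for \<xi>
    unfolding nt_max_def by (rule SUP_least) (auto simp: approach_region_def intro!: ennreal_leI f(2))
  then have "(\<integral>\<^sup>+\<xi>. (nt_max \<alpha> m f \<xi>)\<^sup>2 \<partial>sigma_F m) \<le> (\<integral>\<^sup>+\<xi>. (ennreal C)\<^sup>2 \<partial>sigma_F m)"
    by (intro nn_integral_mono power_mono) auto
  also have "\<dots> < \<infinity>"
    by (simp add: emeasure_eq_measure ennreal_mult_less_top power2_eq_square)
  finally show ?thesis
    using f(1) nt_max_measurable[OF m] by (simp add: fefferman_hardy_def)
qed

text \<open>Radii tending to 1; the shift by 2 keeps them strictly between 0 and 1 from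
  \<open>n = 0\<close> on, so that they may also be inverted.\<close>

definition dil :: "nat \<Rightarrow> real" where
  "dil n = 1 - 1 / (real n + 2)"

lemma dil_bounds: "0 < dil n" "dil n < 1" "dil \<longlonglongrightarrow> 1"
proof -
  show "0 < dil n" "dil n < 1" by (auto simp: dil_def field_simps)
  have "(\<lambda>n. 1 - 1 / real (n + 2)) \<longlonglongrightarrow> 1 - 0"
    by (intro tendsto_diff tendsto_const LIMSEQ_ignore_initial_segment[of "\<lambda>n. 1 / real n"] lim_1_over_n)
  then show "dil \<longlonglongrightarrow> 1" by (simp add: dil_def[abs_def] add.commute)
qed

lemma eventually_dil_in_approach_region:
  assumes m: "m \<ge> 1" and \<alpha>: "\<alpha> > 0"
  shows "\<exists>n0. \<forall>n\<ge>n0. \<forall>\<xi>\<in>frontier (egg m). dil n *\<^sub>R \<xi> \<in> approach_region \<alpha> m \<xi>"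
proof (rule radius_in_approach_region[OF m \<alpha>])
  fix r0 assume "r0 < 1"
    and r0: "\<And>r \<xi>. r0 < r \<Longrightarrow> r < 1 \<Longrightarrow> \<xi> \<in> frontier (egg m) \<Longrightarrow> r *\<^sub>R \<xi> \<in> approach_region \<alpha> m \<xi>"
  have "\<forall>\<^sub>F n in sequentially. r0 < dil n" using dil_bounds(3) \<open>r0 < 1\<close> by (rule order_tendstoD)
  then obtain n0 where n0: "\<And>n. n \<ge> n0 \<Longrightarrow> r0 < dil n" unfolding eventually_sequentially by blast
  show ?thesis by (intro exI allI impI ballI r0 n0 dil_bounds(2))
qed

lemma continuous_on_imp_measurable_sigma_F:
  assumes "continuous_on (frontier (egg m)) (f :: _ \<Rightarrow> complex)"
  shows "f \<in> borel_measurable (sigma_F m)"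
  using borel_measurable_continuous_on_restrict[OF assms]
  unfolding measurable_cong_sets[OF sets_sigma_F refl] .

lemma dil_closed_egg:
  assumes "m \<ge> 1" "p \<in> closed_egg m"
  shows "dil n *\<^sub>R p \<in> egg m"
  using dil_bounds(1,2)[of n] by (intro scale_closed_egg assms) auto

lemma boundary_value_along_radius:
  assumes m: "m \<ge> 1" and \<alpha>: "\<alpha> > 0" and g: "has_boundary_value \<alpha> m f g"
  shows "AE \<xi> in sigma_F m. (\<lambda>n. f (dil n *\<^sub>R \<xi>)) \<longlonglongrightarrow> g \<xi>"
proof -
  obtain n0 where "\<forall>n\<ge>n0. \<forall>\<xi>\<in>frontier (egg m). dil n *\<^sub>R \<xi> \<in> approach_region \<alpha> m \<xi>"
    using eventually_dil_in_approach_region[OF m \<alpha>] ..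
  then have n0: "dil n *\<^sub>R \<xi> \<in> approach_region \<alpha> m \<xi>" if "n \<ge> n0" "\<xi> \<in> frontier (egg m)" for n \<xi>
    using that by blast
  have "AE \<xi> in sigma_F m. \<xi> \<in> frontier (egg m)"
    by (rule AE_I2) (simp add: space_sigma_F)
  moreover have "AE \<xi> in sigma_F m. (f \<longlongrightarrow> g \<xi>) (at \<xi> within approach_region \<alpha> m \<xi>)"
    using g by (simp add: has_boundary_value_def)
  ultimately show ?thesis
  proof eventually_elim
    case (elim \<xi>)
    \<comment> \<open>The limit at \<xi> is punctured; the dilates differ from \<xi> because \<xi>
      is not the origin.\<close>
    have "\<xi> \<noteq> 0"
      using frontier_egg_sum[OF m elim(1)] m by (auto simp: power_0_left)
    have lim: "filterlim (\<lambda>n. dil n *\<^sub>R \<xi>) (at \<xi> within approach_region \<alpha> m \<xi>) sequentially"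
      unfolding filterlim_at
    proof
      have "(\<lambda>n. dil n *\<^sub>R \<xi>) \<longlonglongrightarrow> 1 *\<^sub>R \<xi>" by (intro tendsto_intros dil_bounds)
      then show "(\<lambda>n. dil n *\<^sub>R \<xi>) \<longlonglongrightarrow> \<xi>" by simp
      show "\<forall>\<^sub>F n in sequentially. dil n *\<^sub>R \<xi> \<in> approach_region \<alpha> m \<xi> \<and> dil n *\<^sub>R \<xi> \<noteq> \<xi>"
        using eventually_ge_at_top[of n0]
      proof eventually_elim
        case (elim n)
        have "dil n *\<^sub>R \<xi> \<noteq> 1 *\<^sub>R \<xi>" using dil_bounds(2)[of n] \<open>\<xi> \<noteq> 0\<close> by (subst scaleR_cancel_right) auto
        then show ?case using n0[OF elim \<open>\<xi> \<in> frontier (egg m)\<close>] by simp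
      qed
    qed
    show ?case by (rule filterlim_compose[OF elim(2) lim])
  qed
qed

lemma fefferman_hardy_coefficients:
  assumes m: "m \<ge> 1" and \<alpha>: "\<alpha> > 0" and f: "f \<in> fefferman_hardy \<alpha> m" and g: "has_boundary_value \<alpha> m f g"
  shows "integrable (sigma_F m) g"
    and "(\<integral>\<xi>. g \<xi> * cnj (mon j \<xi>) \<partial>sigma_F m) = taylor2 f j * of_real (\<integral>\<xi>. (cmod (mon j \<xi>))\<^sup>2 \<partial>sigma_F m)"
proof -
  interpret egg_measure "sigma_F m" m by (rule egg_measure_sigma_F[OF m])
  have hol: "holomorphic2_on f (egg m)"
    and [measurable]: "nt_max \<alpha> m f \<in> borel_measurable (sigma_F m)"
    and fin: "(\<integral>\<^sup>+\<xi>. (nt_max \<alpha> m f \<xi>)\<^sup>2 \<partial>sigma_F m) < \<infinity>"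
    using f by (auto simp: fefferman_hardy_def)
  have gm [measurable]: "g \<in> borel_measurable (sigma_F m)" using g by (simp add: has_boundary_value_def)
  have mm [measurable]: "(\<lambda>x. cnj (mon j x)) \<in> borel_measurable (sigma_F m)" for j
    by (rule measurable_M) measurable
  obtain n0 where "\<forall>n\<ge>n0. \<forall>\<xi>\<in>frontier (egg m). dil n *\<^sub>R \<xi> \<in> approach_region \<alpha> m \<xi>"
    using eventually_dil_in_approach_region[OF m \<alpha>] ..
  then have n0: "dil n *\<^sub>R \<xi> \<in> approach_region \<alpha> m \<xi>" if "n \<ge> n0" "\<xi> \<in> frontier (egg m)" for n \<xi>
    using that by blast
  \<comment> \<open>The real majorant. \<open>enn2real\<close> sends infinity to 0, so w dominates
    only where the maximal function is finite, which is almost everywhere since its square is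
    integrable.\<close>
  define w where "w \<xi> = enn2real (nt_max \<alpha> m f \<xi>)" for \<xi>
  have ntfin: "AE \<xi> in sigma_F m. nt_max \<alpha> m f \<xi> \<noteq> \<infinity>"
  proof -
    have "AE \<xi> in sigma_F m. (nt_max \<alpha> m f \<xi>)\<^sup>2 \<noteq> \<infinity>"
      using fin by (intro nn_integral_PInf_AE) auto
    then show ?thesis by eventually_elim auto
  qed
  have wint: "integrable (sigma_F m) w"
  proof (rule integrableI_bounded)
    show "w \<in> borel_measurable (sigma_F m)" unfolding w_def by measurable
    have "(\<integral>\<^sup>+\<xi>. ennreal (norm (w \<xi>)) \<partial>sigma_F m) \<le> (\<integral>\<^sup>+\<xi>. 1 + (nt_max \<alpha> m f \<xi>)\<^sup>2 \<partial>sigma_F m)"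
    proof (rule nn_integral_mono)
      fix \<xi>
      show "ennreal (norm (w \<xi>)) \<le> 1 + (nt_max \<alpha> m f \<xi>)\<^sup>2"
      proof (cases "nt_max \<alpha> m f \<xi>")
        case (real x)
        \<comment> \<open>On a finite measure space this inequality passes integrability from the
          square to the function.\<close>
        have "x \<le> 1 + x\<^sup>2"
          using sum_squares_bound[of x 1] real by simp
        then have "ennreal x \<le> ennreal (1 + x\<^sup>2)" by (rule ennreal_leI)
        then show ?thesis using real by (simp add: w_def ennreal_power)
      qed (simp add: w_def)
    qed
    also have "\<dots> = emeasure (sigma_F m) (space (sigma_F m)) + (\<integral>\<^sup>+\<xi>. (nt_max \<alpha> m f \<xi>)\<^sup>2 \<partial>sigma_F m)"
      by (subst nn_integral_add) auto
    also have "\<dots> < \<infinity>" using fin emeasure_finite by (simp add: less_top[symmetric])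
    finally show "(\<integral>\<^sup>+\<xi>. ennreal (norm (w \<xi>)) \<partial>sigma_F m) < \<infinity>" .
  qed
  \<comment> \<open>The shift by \<open>n0\<close> puts all dilates into the approach regions, so
    that the maximal function dominates every term of the sequence.\<close>
  define s where "s n \<xi> = f (dil (n + n0) *\<^sub>R \<xi>)" for n \<xi>
  have sm [measurable]: "s n \<in> borel_measurable (sigma_F m)" for n
  proof -
    have "continuous_on (frontier (egg m)) (\<lambda>\<xi>. dil (n + n0) *\<^sub>R \<xi>)" by (intro continuous_intros)
    moreover have "(\<lambda>\<xi>. dil (n + n0) *\<^sub>R \<xi>) ` frontier (egg m) \<subseteq> egg m"
      using dil_closed_egg[OF m] frontier_subset_closed_egg[OF m] by blast
    ultimately have "continuous_on (frontier (egg m)) (s n)"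
      unfolding s_def by (rule continuous_on_compose2[OF holomorphic2_on_imp_continuous_on[OF hol]])
    then show ?thesis by (rule continuous_on_imp_measurable_sigma_F)
  qed
  have slim: "AE \<xi> in sigma_F m. (\<lambda>n. s n \<xi>) \<longlonglongrightarrow> g \<xi>"
    using boundary_value_along_radius[OF m \<alpha> g]
    by eventually_elim (auto simp: s_def intro: LIMSEQ_ignore_initial_segment)
  have sb: "AE \<xi> in sigma_F m. norm (s n \<xi>) \<le> w \<xi>" for n
    using ntfin
  proof (rule AE_mp, intro AE_I2 impI)
    fix \<xi> assume \<xi>: "\<xi> \<in> space (sigma_F m)" "nt_max \<alpha> m f \<xi> \<noteq> \<infinity>"
    have "ennreal (cmod (s n \<xi>)) \<le> nt_max \<alpha> m f \<xi>"
      unfolding nt_max_def s_def using \<xi>(1) by (intro SUP_upper n0) (auto simp: space_sigma_F)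
    also have "\<dots> = ennreal (w \<xi>)" using \<xi>(2) by (simp add: w_def ennreal_enn2real_if)
    finally show "norm (s n \<xi>) \<le> w \<xi>" by (simp add: w_def)
  qed
  show "integrable (sigma_F m) g"
    by (rule integrable_dominated_convergence[OF gm sm wint slim sb])
  have "(\<lambda>n. \<integral>\<xi>. s n \<xi> * cnj (mon j \<xi>) \<partial>sigma_F m) \<longlonglongrightarrow> (\<integral>\<xi>. g \<xi> * cnj (mon j \<xi>) \<partial>sigma_F m)"
  proof (rule integral_dominated_convergence[OF _ _ wint])
    show "AE \<xi> in sigma_F m. (\<lambda>n. s n \<xi> * cnj (mon j \<xi>)) \<longlonglongrightarrow> g \<xi> * cnj (mon j \<xi>)"
      using slim by eventually_elim (intro tendsto_intros)
    show "AE \<xi> in sigma_F m. norm (s n \<xi> * cnj (mon j \<xi>)) \<le> w \<xi>" for n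
      using sb[of n]
    proof (rule AE_mp, intro AE_I2 impI)
      fix \<xi> assume \<xi>: "\<xi> \<in> space (sigma_F m)" "norm (s n \<xi>) \<le> w \<xi>"
      have "norm (s n \<xi> * cnj (mon j \<xi>)) \<le> w \<xi> * 1"
        unfolding norm_mult complex_mod_cnj
        using \<xi>(2) norm_mon_le_1[OF m subsetD[OF space \<xi>(1)], of j] by (intro mult_mono) (auto simp: w_def)
      then show "norm (s n \<xi> * cnj (mon j \<xi>)) \<le> w \<xi>" by simp
    qed
  qed measurable
  moreover
  let ?N = "complex_of_real (\<integral>\<xi>. (cmod (mon j \<xi>))\<^sup>2 \<partial>sigma_F m)"
  \<comment> \<open>The series of the dilated function is majorized on the whole boundary. Dilation
    multiplies the coefficient of index j by \<open>dil (n + n0) ^ (fst j + snd j)\<close>, which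
    tends to 1.\<close>
  have "(\<integral>\<xi>. s n \<xi> * cnj (mon j \<xi>) \<partial>sigma_F m) =
      taylor2 f j * of_real (dil (n + n0) ^ (fst j + snd j)) * ?N" for n
  proof -
    let ?r = "dil (n + n0)"
    obtain M q where q: "0 \<le> q" "q < 1"
      "\<And>i p. p \<in> closed_egg m \<Longrightarrow> cmod (taylor2 f i * mon i (?r *\<^sub>R p)) \<le> M * q ^ (fst i + snd i)"
    proof (rule taylor2_bound_egg[OF m hol less_imp_le[OF dil_bounds(1)] dil_bounds(2), of "n + n0"])
      fix M q assume "0 \<le> q" "q < 1"
        "\<And>i p. p \<in> closed_egg m \<Longrightarrow> cmod (taylor2 f i * mon i (?r *\<^sub>R p)) \<le> M * q ^ (fst i + snd i)"
      then show thesis by (rule that)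
    qed
    show ?thesis
    proof (rule integral_cnj_mon[where c = "\<lambda>i. taylor2 f i * of_real (?r ^ (fst i + snd i))"])
      show "(\<lambda>i. M * (q ^ fst i * q ^ snd i)) summable_on UNIV"
        by (intro summable_on_cmult_right geometric_pair_summable q)
      show "cmod (taylor2 f i * of_real (?r ^ (fst i + snd i)) * mon i p) \<le> M * (q ^ fst i * q ^ snd i)"
        if "p \<in> space (sigma_F m)" for i p
        using q(3)[OF subsetD[OF space that], of i] unfolding mon_scaleR power_add mult.assoc .
      show "((\<lambda>i. taylor2 f i * of_real (?r ^ (fst i + snd i)) * mon i p) has_sum s n p) UNIV"
        if "p \<in> space (sigma_F m)" for p
      proof -
        have "?r *\<^sub>R p \<in> egg m"
          by (rule dil_closed_egg[OF m subsetD[OF space that]])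
        from taylor2_has_sum_egg[OF hol this] show ?thesis
          unfolding mon_scaleR s_def mult.assoc .
      qed
    qed
  qed
  moreover have "(\<lambda>n. taylor2 f j * of_real (dil (n + n0) ^ (fst j + snd j)) * ?N)
     \<longlonglongrightarrow> taylor2 f j * of_real (1 ^ (fst j + snd j)) * ?N"
    by (intro tendsto_intros LIMSEQ_ignore_initial_segment dil_bounds)
  ultimately show "(\<integral>\<xi>. g \<xi> * cnj (mon j \<xi>) \<partial>sigma_F m) = taylor2 f j * ?N"
    using LIMSEQ_unique by simp
qed

lemma szego_kernel_diag:
  assumes m: "m \<ge> 1" and \<alpha>: "\<alpha> > 0" and S: "is_fefferman_szego_kernel \<alpha> m S"
    and e: "diag_coeffs m (szego_coeff m)" and \<zeta>: "\<zeta> \<in> egg m"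
    and G: "((\<lambda>i. szego_coeff m i * (cmod (mon i \<zeta>))\<^sup>2) has_sum G) UNIV"
  shows "S \<zeta> \<zeta> = of_real G"
proof -
  interpret diag_coeffs m "szego_coeff m" by (rule e)
  let ?h = "diag_kernel (szego_coeff m) \<zeta>"
  obtain C where C: "\<And>\<eta>. \<eta> \<in> closed_egg m \<Longrightarrow> cmod (?h \<eta>) \<le> C"
    using diag_kernel_bounded[OF \<zeta>] by blast
  have hH: "?h \<in> fefferman_hardy \<alpha> m"
    using C egg_subset_closed_egg
    by (intro bounded_holomorphic_in_fefferman_hardy m diag_kernel_holomorphic2 \<zeta>) blast
  have SH: "(\<lambda>\<eta>. S \<eta> \<zeta>) \<in> fefferman_hardy \<alpha> m"
    using S \<zeta> by (simp add: is_fefferman_szego_kernel_def)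
  obtain h' s' where bv: "has_boundary_value \<alpha> m ?h h'" "has_boundary_value \<alpha> m (\<lambda>\<eta>. S \<eta> \<zeta>) s'"
    and rep: "?h \<zeta> = (\<integral>\<xi>. cnj (s' \<xi>) * h' \<xi> \<partial>sigma_F m)"
    using S hH \<zeta> unfolding is_fefferman_szego_kernel_def by blast
  have [measurable]: "h' \<in> borel_measurable (sigma_F m)" "s' \<in> borel_measurable (sigma_F m)"
    using bv by (simp_all add: has_boundary_value_def)
  have hm [measurable]: "?h \<in> borel_measurable (sigma_F m)"
  proof -
    have "continuous_on (frontier (egg m)) ?h"
      by (rule continuous_on_subset[OF diag_kernel_continuous_on[OF \<zeta>] frontier_subset_closed_egg[OF m]])
    then show ?thesis by (rule continuous_on_imp_measurable_sigma_F)
  qed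
  \<comment> \<open>\<open>h'\<close> is merely some boundary value of the kernel series; continuity
    of the series up to the boundary identifies it almost everywhere through radial limits.\<close>
  have "AE \<xi> in sigma_F m. h' \<xi> = ?h \<xi>"
    using boundary_value_along_radius[OF m \<alpha> bv(1)]
  proof (rule AE_mp, intro AE_I2 impI)
    fix \<xi> assume \<xi>: "\<xi> \<in> space (sigma_F m)" and lim: "(\<lambda>n. ?h (dil n *\<^sub>R \<xi>)) \<longlonglongrightarrow> h' \<xi>"
    have cl: "\<xi> \<in> closed_egg m" using \<xi> frontier_subset_closed_egg[OF m] by (auto simp: space_sigma_F)
    have "(\<lambda>n. dil n *\<^sub>R \<xi>) \<longlonglongrightarrow> 1 *\<^sub>R \<xi>" by (intro tendsto_intros dil_bounds)
    moreover have "dil n *\<^sub>R \<xi> \<in> closed_egg m" for n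
      using dil_closed_egg[OF m cl] egg_subset_closed_egg[of m] by blast
    ultimately have "(\<lambda>n. ?h (dil n *\<^sub>R \<xi>)) \<longlonglongrightarrow> ?h \<xi>"
      using continuous_on_tendsto_compose[OF diag_kernel_continuous_on[OF \<zeta>], of "\<lambda>n. dil n *\<^sub>R \<xi>" \<xi> sequentially] cl
      by simp
    then show "h' \<xi> = ?h \<xi>" using lim LIMSEQ_unique by blast
  qed
  moreover have "cnj \<in> borel_measurable borel"
    by (intro borel_measurable_continuous_onI continuous_intros)
  then have [measurable]: "(\<lambda>\<xi>. cnj (s' \<xi>)) \<in> borel_measurable (sigma_F m)"
    by measurable
  ultimately have "?h \<zeta> = (\<integral>\<xi>. cnj (s' \<xi>) * ?h \<xi> \<partial>sigma_F m)"
    unfolding rep by (intro integral_cong_AE) (auto elim: eventually_mono)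
  also have "\<dots> = (\<integral>\<xi>. cnj (s' \<xi> * cnj (?h \<xi>)) \<partial>sigma_F m)" by simp
  also have "\<dots> = cnj (\<integral>\<xi>. s' \<xi> * cnj (?h \<xi>) \<partial>sigma_F m)" by (rule Bochner_Integration.integral_cnj)
  \<comment> \<open>Here \<open>s'\<close> takes the part of g: its coefficients are the Taylor
    coefficients of \<open>\<lambda>\<eta>. S \<eta> \<zeta>\<close>, and the pairing returns the
    value of that function at \<zeta>.\<close>
  also have "(\<integral>\<xi>. s' \<xi> * cnj (?h \<xi>) \<partial>sigma_F m) = S \<zeta> \<zeta>"
    using fefferman_hardy_coefficients[OF m \<alpha> SH bv(2)] taylor2_has_sum_egg[OF _ \<zeta>, of "\<lambda>\<eta>. S \<eta> \<zeta>"] SH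
    by (intro diag_kernel_reproducing[OF egg_measure_sigma_F[OF m] \<zeta> integral_norm_mon_sigma_F[OF m]])
       (auto simp: fefferman_hardy_def)
  finally have "S \<zeta> \<zeta> = cnj (?h \<zeta>)" by simp
  \<comment> \<open>On the diagonal the kernel series is real, so the conjugate disappears.\<close>
  then show ?thesis unfolding diag_kernel_diag[OF \<zeta> G] by simp
qed

section \<open>The Bergman kernel on the diagonal\<close>

lemma bergman_coefficients:
  assumes m: "m \<ge> 1" and f: "f \<in> bergman_space (egg m)"
  shows "integrable (restrict_space lborel (egg m)) f"
    and "(\<integral>x. f x * cnj (mon j x) \<partial>restrict_space lborel (egg m)) =
      taylor2 f j * of_real (\<integral>x. (cmod (mon j x))\<^sup>2 \<partial>restrict_space lborel (egg m))"
proof -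
  let ?M = "restrict_space lborel (egg m)"
  have hol: "holomorphic2_on f (egg m)" and fin: "(\<integral>\<^sup>+p\<in>egg m. ennreal ((cmod (f p))\<^sup>2) \<partial>lborel) < \<infinity>"
    using f by (auto simp: bergman_space_def)
  have eM: "egg_measure ?M m"
    by (rule egg_measure_lborel[OF m egg_borel egg_subset_closed_egg]) (auto simp: egg_def)
  interpret egg_measure ?M m by (rule eM)
  have sp: "space ?M = egg m" by (simp add: space_restrict_space)
  have fm [measurable]: "f \<in> borel_measurable ?M"
  proof -
    have "f \<in> borel_measurable (restrict_space borel (egg m))"
      by (rule borel_measurable_continuous_on_restrict[OF holomorphic2_on_imp_continuous_on[OF hol]])
    then show ?thesis by (simp cong: measurable_cong_sets add: sets_restrict_space)
  qed
  show int: "integrable ?M f"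
  proof (rule integrableI_bounded[OF fm])
    have "(\<integral>\<^sup>+x. ennreal (norm (f x)) \<partial>?M) \<le> (\<integral>\<^sup>+x. 1 + ennreal ((cmod (f x))\<^sup>2) \<partial>?M)"
    proof (rule nn_integral_mono)
      fix x
      have "cmod (f x) \<le> 1 + (cmod (f x))\<^sup>2"
        using sum_squares_bound[of "cmod (f x)" 1] norm_ge_zero[of "f x"] unfolding power_one mult_1_right
        by linarith
      then have "ennreal (norm (f x)) \<le> ennreal (1 + (cmod (f x))\<^sup>2)" by (rule ennreal_leI)
      then show "ennreal (norm (f x)) \<le> 1 + ennreal ((cmod (f x))\<^sup>2)" by simp
    qed
    also have "\<dots> = emeasure ?M (space ?M) + (\<integral>\<^sup>+x. ennreal ((cmod (f x))\<^sup>2) \<partial>?M)"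
      by (subst nn_integral_add) auto
    also have "(\<integral>\<^sup>+x. ennreal ((cmod (f x))\<^sup>2) \<partial>?M) = (\<integral>\<^sup>+p\<in>egg m. ennreal ((cmod (f p))\<^sup>2) \<partial>lborel)"
      by (subst nn_integral_restrict_space) auto
    also have "emeasure ?M (space ?M) + (\<integral>\<^sup>+p\<in>egg m. ennreal ((cmod (f p))\<^sup>2) \<partial>lborel) < \<infinity>"
      using fin emeasure_finite by (simp add: less_top[symmetric])
    finally show "(\<integral>\<^sup>+x. ennreal (norm (f x)) \<partial>?M) < \<infinity>" .
  qed
  \<comment> \<open>Here the domain is dilated instead of the function: on \<open>E n\<close> the
    expansion of f is majorized, and these sets exhaust the egg. Writing them through the inverse
    dilation presents them as open preimages.\<close>
  define E where "E n = {p. (1 / dil n) *\<^sub>R p \<in> egg m}" for n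
  have Eo: "open (E n)" for n
  proof -
    have "continuous_on UNIV (\<lambda>p :: complex \<times> complex. (1 / dil n) *\<^sub>R p)" by (intro continuous_intros)
    from open_vimage[OF open_egg this, of m] show ?thesis by (simp add: E_def vimage_def)
  qed
  have Es: "p \<in> E n \<longleftrightarrow> (\<exists>q\<in>egg m. p = dil n *\<^sub>R q)" for p n
    using dil_bounds(1)[of n] by (auto simp: E_def intro!: bexI[of _ "(1 / dil n) *\<^sub>R p"])
  have EE: "E n \<subseteq> egg m" for n
  proof
    fix p assume "p \<in> E n"
    then obtain q where "q \<in> egg m" "p = dil n *\<^sub>R q" unfolding Es by blast
    then show "p \<in> egg m" using dil_closed_egg[OF m subsetD[OF egg_subset_closed_egg], of q n] by simp
  qed
  have Eev: "\<forall>\<^sub>F n in sequentially. p \<in> E n" if "p \<in> egg m" for p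
  proof -
    have "(\<lambda>n. (1 / dil n) *\<^sub>R p) \<longlonglongrightarrow> (1 / 1) *\<^sub>R p" by (intro tendsto_intros dil_bounds) simp
    then have "\<forall>\<^sub>F n in sequentially. (1 / dil n) *\<^sub>R p \<in> egg m"
      using topological_tendstoD[OF _ open_egg] that by fastforce
    then show ?thesis by (simp add: E_def)
  qed
  have Erot: "p \<in> E n \<longleftrightarrow> q \<in> E n" if "cmod (fst p) = cmod (fst q)" "cmod (snd p) = cmod (snd q)" for p q n
    using that by (simp add: E_def egg_def case_prod_unfold)
  have [measurable]: "E n \<in> sets borel" for n using Eo by simp
  let ?g = "\<lambda>n x. indicator (E n) x *\<^sub>R (f x * cnj (mon j x))"
    and ?q = "\<lambda>n x. indicator (E n) x *\<^sub>R (cmod (mon j x))\<^sup>2"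
  have eq: "(\<integral>x. ?g n x \<partial>?M) =
      taylor2 f j * of_real (\<integral>x. ?q n x \<partial>?M)" for n
  proof -
    have En: "egg_measure (restrict_space lborel (E n)) m"
      by (rule egg_measure_lborel[OF m _ _ Erot]) (use EE egg_subset_closed_egg[of m] in auto)
    obtain M q where q: "0 \<le> q" "q < 1"
      "\<And>i p. p \<in> closed_egg m \<Longrightarrow> cmod (taylor2 f i * mon i (dil n *\<^sub>R p)) \<le> M * q ^ (fst i + snd i)"
    proof (rule taylor2_bound_egg[OF m hol less_imp_le[OF dil_bounds(1)] dil_bounds(2), of n])
      fix M q assume "0 \<le> q" "q < 1"
        "\<And>i p. p \<in> closed_egg m \<Longrightarrow> cmod (taylor2 f i * mon i (dil n *\<^sub>R p)) \<le> M * q ^ (fst i + snd i)"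
      then show thesis by (rule that)
    qed
    have I: "(\<integral>x. f x * cnj (mon j x) \<partial>restrict_space lborel (E n)) =
        taylor2 f j * of_real (\<integral>x. (cmod (mon j x))\<^sup>2 \<partial>restrict_space lborel (E n))"
    proof (rule egg_measure.integral_cnj_mon[OF En])
      show "(\<lambda>i. M * (q ^ fst i * q ^ snd i)) summable_on UNIV"
        by (intro summable_on_cmult_right geometric_pair_summable q)
      show "cmod (taylor2 f i * mon i p) \<le> M * (q ^ fst i * q ^ snd i)"
        if "p \<in> space (restrict_space lborel (E n))" for i p
      proof -
        from that obtain p' where "p' \<in> egg m" and p: "p = dil n *\<^sub>R p'"
          by (auto simp: space_restrict_space Es)
        then have "p' \<in> closed_egg m" using egg_subset_closed_egg by blast
        from q(3)[OF this, of i] show ?thesis unfolding p power_add .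
      qed
      show "((\<lambda>i. taylor2 f i * mon i p) has_sum f p) UNIV"
        if "p \<in> space (restrict_space lborel (E n))" for p
        using that subsetD[OF EE, of p n] by (intro taylor2_has_sum_egg[OF hol]) (simp add: space_restrict_space)
    qed
    have ind: "indicator (egg m) x * indicator (E n) x = (indicator (E n) x :: real)" for x
      using EE[of n] by (auto simp: indicator_def)
    have t1: "(\<integral>x. ?g n x \<partial>?M) = (\<integral>x. f x * cnj (mon j x) \<partial>restrict_space lborel (E n))"
      by (simp add: integral_restrict_space ind)
    have t2: "(\<integral>x. ?q n x \<partial>?M) = (\<integral>x. (cmod (mon j x))\<^sup>2 \<partial>restrict_space lborel (E n))"
      by (simp add: integral_restrict_space ind flip: mult.assoc)
    show ?thesis unfolding t1 t2 by (rule I)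
  qed
  have mm [measurable]: "mon j \<in> borel_measurable ?M" "(\<lambda>x. cnj (mon j x)) \<in> borel_measurable ?M"
    by (rule measurable_M; measurable)+
  have im [measurable]: "(indicator (E n) :: _ \<Rightarrow> real) \<in> borel_measurable ?M" for n
    by (rule measurable_M) measurable
  have m1: "cmod (mon j x) \<le> 1" if "x \<in> space ?M" for x
    using norm_mon_le_1[OF m subsetD[OF space that]] .
  \<comment> \<open>The monomials are bounded by 1 on the egg, so the modulus of f dominates all the
    truncated integrands.\<close>
  have l1: "(\<lambda>n. \<integral>x. ?g n x \<partial>?M) \<longlonglongrightarrow> (\<integral>x. f x * cnj (mon j x) \<partial>?M)"
  proof (rule integral_dominated_convergence[where w = "\<lambda>x. norm (f x)"])
    show "integrable ?M (\<lambda>x. norm (f x))" by (rule integrable_norm[OF int])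
    show "AE x in ?M. (\<lambda>n. ?g n x) \<longlonglongrightarrow> f x * cnj (mon j x)"
    proof (rule AE_I2)
      fix x assume "x \<in> space ?M"
      then have "\<forall>\<^sub>F n in sequentially. x \<in> E n" using Eev[of x] by (simp add: sp)
      then have "\<forall>\<^sub>F n in sequentially. ?g n x = f x * cnj (mon j x)"
        by eventually_elim simp
      then show "(\<lambda>n. ?g n x) \<longlonglongrightarrow> f x * cnj (mon j x)"
        by (rule tendsto_eventually)
    qed
    show "AE x in ?M. norm (?g n x) \<le> norm (f x)" for n
    proof (rule AE_I2)
      fix x assume "x \<in> space ?M"
      have "norm (f x) * cmod (mon j x) \<le> norm (f x) * 1"
        by (intro mult_left_mono m1[OF \<open>x \<in> space ?M\<close>]) simp
      then show "norm (?g n x) \<le> norm (f x)"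
        by (auto simp: norm_mult indicator_def)
    qed
  qed measurable
  have l2: "(\<lambda>n. \<integral>x. ?q n x \<partial>?M) \<longlonglongrightarrow> (\<integral>x. (cmod (mon j x))\<^sup>2 \<partial>?M)"
  proof (rule integral_dominated_convergence[where w = "\<lambda>x. 1"])
    show "AE x in ?M. (\<lambda>n. ?q n x) \<longlonglongrightarrow> (cmod (mon j x))\<^sup>2"
    proof (rule AE_I2)
      fix x assume "x \<in> space ?M"
      then have "\<forall>\<^sub>F n in sequentially. x \<in> E n" using Eev[of x] by (simp add: sp)
      then have "\<forall>\<^sub>F n in sequentially. ?q n x = (cmod (mon j x))\<^sup>2"
        by eventually_elim simp
      then show "(\<lambda>n. ?q n x) \<longlonglongrightarrow> (cmod (mon j x))\<^sup>2"
        by (rule tendsto_eventually)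
    qed
    show "AE x in ?M. norm (?q n x) \<le> 1" for n
      using m1 by (intro AE_I2) (auto simp: indicator_def power_le_one)
  qed (simp_all, measurable)
  have "(\<lambda>n. \<integral>x. ?g n x \<partial>?M) \<longlonglongrightarrow> taylor2 f j * of_real (\<integral>x. (cmod (mon j x))\<^sup>2 \<partial>?M)"
    unfolding eq by (intro tendsto_intros l2)
  with l1 show "(\<integral>x. f x * cnj (mon j x) \<partial>?M) = taylor2 f j * of_real (\<integral>x. (cmod (mon j x))\<^sup>2 \<partial>?M)"
    by (rule LIMSEQ_unique)
qed

lemma bergman_kernel_diag:
  assumes m: "m \<ge> 1" and K: "is_bergman_kernel (egg m) K"
    and e: "diag_coeffs m (bergman_coeff m)" and \<zeta>: "\<zeta> \<in> egg m"
    and G: "((\<lambda>i. bergman_coeff m i * (cmod (mon i \<zeta>))\<^sup>2) has_sum G) UNIV"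
  shows "K \<zeta> \<zeta> = of_real G"
proof -
  interpret diag_coeffs m "bergman_coeff m" by (rule e)
  let ?h = "diag_kernel (bergman_coeff m) \<zeta>"
  let ?M = "restrict_space lborel (egg m)"
  have eM: "egg_measure ?M m"
    by (rule egg_measure_lborel[OF m egg_borel egg_subset_closed_egg]) (auto simp: egg_def)
  obtain C where C: "\<And>\<eta>. \<eta> \<in> closed_egg m \<Longrightarrow> cmod (?h \<eta>) \<le> C"
    using diag_kernel_bounded[OF \<zeta>] by blast
  have "(\<integral>\<^sup>+p\<in>egg m. ennreal ((cmod (?h p))\<^sup>2) \<partial>lborel) \<le> (\<integral>\<^sup>+p\<in>egg m. ennreal (C\<^sup>2) \<partial>lborel)"
    using C egg_subset_closed_egg[of m]
    by (intro nn_integral_mono) (auto split: split_indicator intro!: ennreal_leI power_mono)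
  also have "\<dots> = ennreal (C\<^sup>2) * emeasure lborel (egg m)"
    by (rule nn_integral_cmult_indicator) simp
  also have "\<dots> < \<infinity>"
    using emeasure_bounded_finite[OF bounded_subset[OF compact_imp_bounded[OF compact_closed_egg[OF m]] egg_subset_closed_egg]]
    by (simp add: ennreal_mult_less_top)
  finally have hB: "?h \<in> bergman_space (egg m)"
    using diag_kernel_holomorphic2[OF \<zeta>] by (simp add: bergman_space_def)
  have KB: "(\<lambda>\<eta>. K \<eta> \<zeta>) \<in> bergman_space (egg m)"
    using K \<zeta> by (simp add: is_bergman_kernel_def)
  have "?h \<zeta> = (LINT \<xi>:egg m|lborel. cnj (K \<xi> \<zeta>) * ?h \<xi>)"
    using K hB \<zeta> unfolding is_bergman_kernel_def by blast
  also have "\<dots> = (\<integral>\<xi>. cnj (K \<xi> \<zeta> * cnj (?h \<xi>)) \<partial>?M)"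
    by (simp add: set_lebesgue_integral_def integral_restrict_space)
  also have "\<dots> = cnj (\<integral>\<xi>. K \<xi> \<zeta> * cnj (?h \<xi>) \<partial>?M)" by (rule Bochner_Integration.integral_cnj)
  also have "(\<integral>\<xi>. K \<xi> \<zeta> * cnj (?h \<xi>) \<partial>?M) = K \<zeta> \<zeta>"
    using bergman_coefficients[OF m KB] taylor2_has_sum_egg[OF _ \<zeta>, of "\<lambda>\<eta>. K \<eta> \<zeta>"] KB
    by (intro diag_kernel_reproducing[OF eM \<zeta> integral_norm_mon_egg[OF m]])
       (auto simp: bergman_space_def)
  finally have "K \<zeta> \<zeta> = cnj (?h \<zeta>)" by simp
  then show ?thesis unfolding diag_kernel_diag[OF \<zeta> G] by simp
qed

theorem proposition3p14:
  fixes m :: nat and \<alpha> :: real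
    and S K :: "complex \<times> complex \<Rightarrow> complex \<times> complex \<Rightarrow> complex"
  assumes "m \<ge> 1" and "\<alpha> > 0"
    and "is_fefferman_szego_kernel \<alpha> m S"
    and "is_bergman_kernel (egg m) K"
  shows "\<exists>c C. 0 < c \<and> c \<le> C \<and>
           (\<forall>p\<in>egg m. SK S K p \<in> \<real> \<and> c \<le> Re (SK S K p) \<and> Re (SK S K p) \<le> C)"
proof -
  obtain u a1 a2 where "kernel_weights m (4 / 3 + 2 / (3 * real m)) 2 u a1 a2 (szego_coeff m)"
    using kernel_weights_szego[OF assms(1)] .
  then interpret s: kernel_weights m "4 / 3 + 2 / (3 * real m)" 2 u a1 a2 "szego_coeff m" .
  obtain v b1 b2 where "kernel_weights m (2 + 1 / real m) 3 v b1 b2 (bergman_coeff m)"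
    using kernel_weights_bergman[OF assms(1)] .
  then interpret b: kernel_weights m "2 + 1 / real m" 3 v b1 b2 "bergman_coeff m" .
  have growth: "s.growth p ^ 3 = b.growth p ^ 2" if p: "p \<in> egg m" for p
  proof -
    \<comment> \<open>\<open>ratio\<close> depends on \<open>m\<close> alone, so one t serves both
      interpretations.\<close>
    define X t where "X = 1 - (cmod (fst p))\<^sup>2" and "t = 1 - b.ratio p"
    have X: "X > 0" "t > 0" using s.egg_fst_less[OF p] b.ratio_less_1[OF p] by (auto simp: X_def t_def)
    have pw: "(X powr c * t powr d) ^ n = X powr (c * real n) * t powr (d * real n)" for c d n
      using X by (simp add: power_mult_distrib powr_power mult.commute)
    have e: "- (4 / 3 + 2 / (3 * real m)) * real 3 = - (2 + 1 / real m) * real 2"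
      by (simp add: algebra_simps)
    have "s.growth p ^ 3 = X powr (- (4 / 3 + 2 / (3 * real m)) * real 3) * t powr (- real 2 * real 3)"
      unfolding s.growth_def X_def[symmetric] t_def[symmetric] pw ..
    moreover have "b.growth p ^ 2 = X powr (- (2 + 1 / real m) * real 2) * t powr (- real 3 * real 2)"
      unfolding b.growth_def X_def[symmetric] t_def[symmetric] pw ..
    moreover have "- real 2 * real 3 = - real 3 * real 2" by simp
    ultimately show ?thesis by (simp only: e)
  qed
  have ab: "0 < a1" "a1 \<le> a2" "0 < b1" "b1 \<le> b2" using s.c b.c by auto
  show ?thesis
  proof (intro exI conjI ballI)
    \<comment> \<open>The quotient is smallest for S at its lower bound and K at its upper one, and
      largest in the opposite case; the growth factors cancel.\<close>
    show "0 < a1 ^ 3 / b2\<^sup>2" using ab by simp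
    show "a1 ^ 3 / b2\<^sup>2 \<le> a2 ^ 3 / b1\<^sup>2"
      using ab by (intro frac_le power_mono) auto
    fix p assume p: "p \<in> egg m"
    obtain G where G: "((\<lambda>i. szego_coeff m i * (cmod (mon i p))\<^sup>2) has_sum G) UNIV" "a1 * s.growth p \<le> G" "G \<le> a2 * s.growth p"
      using s.diag_has_sum[OF p] .
    obtain H where H: "((\<lambda>i. bergman_coeff m i * (cmod (mon i p))\<^sup>2) has_sum H) UNIV" "b1 * b.growth p \<le> H" "H \<le> b2 * b.growth p"
      using b.diag_has_sum[OF p] .
    have SK: "SK S K p = of_real (G ^ 3 / H\<^sup>2)"
      unfolding SK_def szego_kernel_diag[OF assms(1-3) s.diag_coeffs_axioms p G(1)]
        bergman_kernel_diag[OF assms(1,4) b.diag_coeffs_axioms p H(1)] by simp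
    have sp: "0 < s.growth p" "0 < b.growth p" by (rule s.growth_pos[OF p], rule b.growth_pos[OF p])
    have "0 < a1 * s.growth p" "0 < b1 * b.growth p" using ab sp by auto
    then have GH: "0 < G" "0 < H" using G(2) H(2) by linarith+
    show "SK S K p \<in> \<real>" unfolding SK by simp
    have "a1 ^ 3 / b2\<^sup>2 = (a1 * s.growth p) ^ 3 / (b2 * b.growth p)\<^sup>2"
      using sp by (simp add: power_mult_distrib growth[OF p])
    also have "\<dots> \<le> G ^ 3 / H\<^sup>2"
      using G H GH ab sp by (intro frac_le power_mono) auto
    finally show "a1 ^ 3 / b2\<^sup>2 \<le> Re (SK S K p)" unfolding SK by simp
    have "G ^ 3 / H\<^sup>2 \<le> (a2 * s.growth p) ^ 3 / (b1 * b.growth p)\<^sup>2"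
      using G H GH ab sp by (intro frac_le power_mono) auto
    also have "\<dots> = a2 ^ 3 / b1\<^sup>2"
      using sp by (simp add: power_mult_distrib growth[OF p])
    finally show "Re (SK S K p) \<le> a2 ^ 3 / b1\<^sup>2" unfolding SK by simp
  qed
qed

end
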